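(* Let $\Phi(t)=t^r(1+\log^+t)^\delta$ with $r\ge1$ and $\delta\ge0$. Let $0<\gamma<n/r$ and $1/q=1/r-\gamma/n$. If $u\in A_1$ and $v^q\in A_\infty$ (weights on $\mathbb{R}^n$, $v>0$ a.e.), then there exists a constant $C>0$ such that for every measurable $f$ with $fv\in L^\Phi_{loc}$ and every $t>0$, $$uv^q\left(\left\{x\in\mathbb{R}^n:\frac{M_{\gamma,\Phi}(fv)(x)}{M_\eta v(x)}>t\right\}\right)\le C\,\varphi\left(\int_{\mathbb{R}^n}\Phi_\gamma\left(\frac{|f(x)|}{t}\right)\Psi\left(u^{1/q}(x)v(x)\right)dx\right),$$ where $\eta(t)=t^q(1+\log^+t)^{n\delta/(n-r\gamma)}$, $\varphi(t)=[t(1+\log^+t)^\delta]^{q/r}$, $\Psi(t)=t^r\left(1+\log^+(t^{1-q/r})\right)^{n\delta/(n-r\gamma)}$ and $\Phi_\gamma(t)=\Phi(t)(1+\log^+t)^{\delta r\gamma/(n-r\gamma)}$.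
   Context: $n$ is the dimension of $\mathbb{R}^n$; $\log^+t=\max\{0,\log t\}$ (all the functions $\Phi,\eta,\varphi,\Psi,\Phi_\gamma$ vanish at $0$, and $\varphi(\infty)=\infty$). Cubes $Q\subset\mathbb{R}^n$ have sides parallel to the coordinate axes. A weight is a locally integrable function that is positive and finite almost everywhere. For a nonnegative function $w$ and a measurable set $E$, $w(E)=\int_E w$; thus $uv^{q}(E)=\int_E u(x)v(x)^{q}\,dx$. A weight $w$ is in $A_1$ if there is $C>0$ with $\frac1{|Q|}\int_Q w\le C\,\mathrm{ess\,inf}_Q w$ for every cube $Q$. For $1<s<\infty$, $w\in A_s$ if $\left(\frac1{|Q|}\int_Q w\right)\left(\frac1{|Q|}\int_Q w^{1-s'}\right)^{s-1}\le C$ for every cube $Q$, where $1/s+1/s'=1$. $A_\infty=\bigcup_{s\ge1}A_s$. A Young function is a function $\theta:[0,\infty)\to[0,\infty]$ that is convex, increasing, with $\theta(0)=0$ and $\theta(t)\to\infty$ as $t\to\infty$. $L^\theta_{loc}$ is the set of measurable $f$ such that $\theta(|f|)$ is locally integrable. The Luxemburg average is $\|f\|_{\theta,Q}=\inf\left\{\lambda>0:\frac1{|Q|}\int_Q\theta\left(\frac{|f(y)|}{\lambda}\right)dy\le1\right\}$. The maximal operators are $M_\theta f(x)=\sup_{Q\ni x}\|f\|_{\theta,Q}$ and, for $0<\gamma<n$, $M_{\gamma,\theta}f(x)=\sup_{Q\ni x}|Q|^{\gamma/n}\|f\|_{\theta,Q}$, the suprema being over all cubes containing $x$. A condition $M_{\gamma,\Phi}(fv)(x)/M_\eta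 v(x)>t$ is read as $M_{\gamma,\Phi}(fv)(x)>t\,M_\eta v(x)$ where $M_\eta v(x)=\infty$. *)

theory Defs
  imports "HOL-Analysis.Analysis"
begin

text \<open>
  Functions on \<open>\<real>\<^sup>n\<close> are real-valued, so an almost everywhere finite function is represented
  by a finite representative; all quantities below depend only on almost everywhere classes with
  respect to Lebesgue measure. Quantities that may be infinite (averages, Luxemburg averages,
  maximal functions, weighted masses) live in \<^typ>\<open>ennreal\<close>. There \<open>a / \<infinity> = 0\<close> for every \<open>a\<close>,
  also for \<open>a = \<infinity>\<close>; hence where \<open>b = \<infinity>\<close> and \<open>t > 0\<close>, the condition \<open>a / b > t\<close> fails, and
  so does \<open>a > t * b\<close>. Powers and logarithms satisfy \<open>0 powr p = 0\<close> and \<open>ln 0 = 0\<close>.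
\<close>

definition cube :: "(real ^ 'n) set \<Rightarrow> bool" where
  "cube Q \<longleftrightarrow> (\<exists>a l. 0 < l \<and> Q = cbox a (\<chi> i. a $ i + l))"

definition locally_integrable :: "(real ^ 'n \<Rightarrow> real) \<Rightarrow> bool" where
  "locally_integrable w \<longleftrightarrow> (\<forall>K. compact K \<longrightarrow> w absolutely_integrable_on K)"

definition weight :: "(real ^ 'n \<Rightarrow> real) \<Rightarrow> bool" where
  "weight w \<longleftrightarrow> locally_integrable w \<and> (AE x in lebesgue. 0 < w x)"

text \<open>
  The mass \<open>w(E) = \<integral>\<^sub>E w\<close> and the average over \<open>Q\<close>, for (almost everywhere) nonnegative functions;
  the value \<open>\<infinity>\<close> is possible.
\<close>

definition mass :: "(real ^ 'n \<Rightarrow> real) \<Rightarrow> (real ^ 'n) set \<Rightarrow> ennreal" where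
  "mass w E = (\<integral>\<^sup>+x\<in>E. ennreal (w x) \<partial>lebesgue)"

definition average :: "(real ^ 'n) set \<Rightarrow> (real ^ 'n \<Rightarrow> real) \<Rightarrow> ennreal" where
  "average Q g = mass g Q / emeasure lebesgue Q"

definition essinf_on :: "(real ^ 'n) set \<Rightarrow> (real ^ 'n \<Rightarrow> real) \<Rightarrow> ennreal" where
  "essinf_on Q w = Sup {c. AE x in lebesgue. x \<in> Q \<longrightarrow> c \<le> ennreal (w x)}"

text \<open>Extension of a function on \<open>[0,\<infinity>)\<close> to \<open>[0,\<infinity>]\<close> by the value \<open>\<infinity>\<close> at \<open>\<infinity>\<close>.\<close>

definition extend_infinity :: "(real \<Rightarrow> real) \<Rightarrow> ennreal \<Rightarrow> ennreal" where
  "extend_infinity g t = (if t = \<infinity> then \<infinity> else ennreal (g (enn2real t)))"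

definition muckenhoupt_one :: "(real ^ 'n \<Rightarrow> real) \<Rightarrow> bool" where
  "muckenhoupt_one w \<longleftrightarrow> weight w \<and>
     (\<exists>C>0. \<forall>Q. cube Q \<longrightarrow> average Q w \<le> ennreal C * essinf_on Q w)"

text \<open>
  For \<open>1 < s\<close>. The second average may be infinite for an arbitrary weight; as the first
  one is positive, the inequality excludes this (the power \<open>s - 1\<close> of \<open>\<infinity>\<close> is \<open>\<infinity>\<close>).
\<close>

definition muckenhoupt :: "real \<Rightarrow> (real ^ 'n \<Rightarrow> real) \<Rightarrow> bool" where
  "muckenhoupt s w \<longleftrightarrow> weight w \<and>
     (let s' = s / (s - 1) in
      \<exists>C>0. \<forall>Q. cube Q \<longrightarrow>
        average Q w * extend_infinity (\<lambda>a. a powr (s - 1)) (average Q (\<lambda>x. w x powr (1 - s')))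
          \<le> ennreal C)"

definition muckenhoupt_infinity :: "(real ^ 'n \<Rightarrow> real) \<Rightarrow> bool" where
  "muckenhoupt_infinity w \<longleftrightarrow> muckenhoupt_one w \<or> (\<exists>s>1. muckenhoupt s w)"

definition log_plus :: "real \<Rightarrow> real" where
  "log_plus t = max 0 (ln t)"

definition orlicz_loc :: "(real \<Rightarrow> real) \<Rightarrow> (real ^ 'n \<Rightarrow> real) set" where
  "orlicz_loc \<theta> = {f \<in> borel_measurable lebesgue. locally_integrable (\<lambda>x. \<theta> \<bar>f x\<bar>)}"

definition luxemburg :: "(real \<Rightarrow> real) \<Rightarrow> (real ^ 'n) set \<Rightarrow> (real ^ 'n \<Rightarrow> real) \<Rightarrow> ennreal" where
  "luxemburg \<theta> Q f = Inf {ennreal c | c. 0 < c \<and> average Q (\<lambda>y. \<theta> (\<bar>f y\<bar> / c)) \<le> 1}"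

definition maximal :: "(real \<Rightarrow> real) \<Rightarrow> (real ^ 'n \<Rightarrow> real) \<Rightarrow> real ^ 'n \<Rightarrow> ennreal" where
  "maximal \<theta> f x = (SUP Q\<in>{Q. cube Q \<and> x \<in> Q}. luxemburg \<theta> Q f)"

definition fractional_maximal ::
    "real \<Rightarrow> (real \<Rightarrow> real) \<Rightarrow> (real ^ 'n \<Rightarrow> real) \<Rightarrow> real ^ 'n \<Rightarrow> ennreal" where
  "fractional_maximal \<gamma> \<theta> f x =
     (SUP Q\<in>{Q. cube Q \<and> x \<in> Q}.
        ennreal (measure lebesgue Q powr (\<gamma> / real CARD('n))) * luxemburg \<theta> Q f)"

end

theory Submission
  imports Defs
begin

text \<open>
  Put \<open>p = q/r > 1\<close>, \<open>w = v\<^sup>q\<close>, \<open>F = (\<bar>f\<bar>/t)\<^sup>r\<close> and \<open>\<Lambda>(t) = 1 + log\<^sup>+ t\<close>. Let \<open>x\<close> be a point of the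
  level set and put \<open>L = (M\<^sub>\<eta> v(x))\<^sup>q\<close>. Since \<open>\<eta>(t) \<ge> t\<^sup>q\<close>, every cube \<open>Q\<close> around \<open>x\<close> has \<open>w(Q) \<le> L\<bar>Q\<bar>\<close>;
  by differentiation, also \<open>w(x) \<le> L\<close> for almost every such \<open>x\<close>. The numerator being large means that
  some \<open>Q\<close> around \<open>x\<close> has \<open>\<integral>\<^sub>Q G \<Lambda>(G)\<^sup>\<delta> > \<bar>Q\<bar>\<close> with \<open>G = F (w/L)\<^sup>1\<^sup>/\<^sup>p \<bar>Q\<bar>\<^sup>1\<^sup>-\<^sup>1\<^sup>/\<^sup>p\<close>, because
  \<open>\<gamma>r/n = 1 - 1/p\<close>.

  Take \<open>\<delta> = 0\<close> first. The condition then reads \<open>L\<bar>Q\<bar> < Z\<close> with \<open>Z = (\<integral>\<^sub>Q F w\<^sup>1\<^sup>/\<^sup>p)\<^sup>p\<close>, so \<open>x\<close> lies in the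
  part of \<open>Q\<close> where \<open>w \<le> Z/\<bar>Q\<bar>\<close>, and \<open>w(Q) \<le> Z\<close>. The idea is to bound the measure \<open>uw\<close> of the level set
  by the plain sum, over all cubes \<open>Q\<close> of a countable family with \<open>w(Q) \<le> Z\<close>, of the integrals of
  \<open>u min(w, Z/\<bar>Q\<bar>)\<close> over \<open>Q\<close>; no selection of maximal or disjoint cubes is made. The sum converges for
  two reasons. As \<open>u\<close> is in \<open>A\<^sub>\<infinity>\<close>, the set where \<open>w\<close> is far above its average has small \<open>u\<close>-measure, and
  the term of \<open>Q\<close> is at most \<open>C A Z\<^sup>1\<^sup>-\<^sup>\<epsilon> w(Q)\<^sup>\<epsilon>\<close> with \<open>A = u(Q)/\<bar>Q\<bar>\<close> (\<open>A_inf_truncated\<close>,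
  \<open>cube_contribution\<close>). One factor \<open>Z\<^sup>1\<^sup>/\<^sup>p\<close> is an integral over \<open>Q\<close>, and interchanging it with the sum
  leaves, for fixed \<open>x\<close>, a sum over the cubes around \<open>x\<close>. With \<open>h = F (uw)\<^sup>1\<^sup>/\<^sup>p\<close>, \<open>B = \<integral> h\<close>, the \<open>A\<^sub>1\<close> bound
  \<open>A \<le> C u(x)\<close> and its consequence \<open>A Z \<le> C B\<^sup>p\<close>, the cubes of side \<open>2\<^sup>k\<close> contribute at most
  \<open>min(y\<^sup>\<epsilon>, y\<^sup>-\<^sup>\<epsilon>)\<close>, up to a common factor, for \<open>y = u(x) w(R)/B\<^sup>p\<close> and \<open>R\<close> the cube of side comparable
  to \<open>2\<^sup>k\<close> centred at \<open>x\<close> (\<open>coefficient_bound\<close>). As \<open>w\<close> is in \<open>A\<^sub>\<infinity>\<close>, these \<open>y\<close> grow geometrically with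
  \<open>k\<close>, so the sum is bounded (\<open>grid_sum_bound\<close>), and the level set has \<open>uw\<close>-measure at most \<open>C B\<^sup>p\<close>
  (\<open>mixed_mass_bound\<close>).

  For \<open>\<delta> > 0\<close> the logarithm \<open>\<Lambda>(G)\<close> has to be distributed over the factors available on the right-hand
  side. Put \<open>Y = w/L\<close>, \<open>U = u/A\<close> and \<open>b\<^sup>p = A\<bar>Q\<bar>L\<close>. Then \<open>\<bar>Q\<bar> = U Y b\<^sup>p/(uw)\<close>, hence
  \<open>G = X Y\<close> with \<open>X = F (U b\<^sup>p/(uw))\<^sup>1\<^sup>-\<^sup>1\<^sup>/\<^sup>p\<close>. By the reverse Hoelder inequality for \<open>w\<close>, the region
  where \<open>G \<Lambda>(G)\<^sup>\<delta> \<le> c Y\<^sup>1\<^sup>+\<^sup>e\<close> can be discarded; on the rest \<open>Y\<close> is at most a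
  multiple of a power of \<open>max(1, X)\<close>, so \<open>\<Lambda>(G)\<close> is
  at most a multiple of \<open>\<Lambda>(F) \<Lambda>(U) \<Lambda>(b) \<Lambda>(1/(uw))\<close> (\<open>logf_factorization\<close>). Here \<open>\<Lambda>(F)\<close> and \<open>\<Lambda>(1/(uw))\<close> are
  provided by \<open>\<Phi>\<^sub>\<gamma>\<close> and \<open>\<Psi>\<close>, a small power of \<open>U\<close> absorbs \<open>\<Lambda>(U)\<close>, and \<open>b \<le> C \<Lambda>(b)\<^sup>\<delta> H\<close>, where \<open>H\<close> is the
  integral on the right-hand side, turns \<open>\<Lambda>(b)\<close> into \<open>\<Lambda>(H)\<close>, the logarithm in \<open>\<phi>\<close> (\<open>local_estimate\<close>).
\<close>

section \<open>Half-open cubes and their bisection\<close>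

(* As a rewrite rule this replaces a set by its Borel part inside Lebesgue measure. *)
lemmas [simp del] = emeasure_completion

text \<open>
  Half-open cubes are used so that bisection yields an exact partition.
\<close>

definition hcube :: "real ^ 'n \<Rightarrow> real \<Rightarrow> (real ^ 'n) set" where
  "hcube a l = {x. \<forall>i. a $ i \<le> x $ i \<and> x $ i < a $ i + l}"

text \<open>
  The lower corners of the cubes of side \<open>l\<close> that partition the cube of side \<open>2l\<close> at \<open>a\<close>; the set \<open>e\<close>
  collects the directions in which the upper half is taken.
\<close>

definition corner :: "real ^ 'n \<Rightarrow> real \<Rightarrow> 'n set \<Rightarrow> real ^ 'n" where
  "corner a l e = (\<chi> i. if i \<in> e then a $ i + l else a $ i)"

lemma hcube_sandwich:
  "box a (\<chi> i. a $ i + l) \<subseteq> hcube a l" "hcube a l \<subseteq> cbox a (\<chi> i. a $ i + l)"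
  by (auto simp: hcube_def mem_box_cart less_imp_le)

lemma AE_hcube_eq_cbox:
  "AE x in lebesgue. x \<in> hcube a l \<longleftrightarrow> x \<in> cbox a (\<chi> i. a $ i + l)"
proof -
  have "AE x in lebesgue. x \<notin> cbox a (\<chi> i. a $ i + l) - box a (\<chi> i. a $ i + l)"
    using negligible_frontier_interval[of a "\<chi> i. a $ i + l"]
    unfolding negligible_iff_null_sets by (rule AE_not_in)
  then show ?thesis
    using hcube_sandwich[of a l] by (auto elim!: eventually_mono)
qed

lemma hcube_borel [measurable]: "hcube a l \<in> sets borel"
proof -
  have "hcube a l = (\<Inter>i\<in>UNIV. {x. a $ i \<le> x $ i} \<inter> {x. x $ i < a $ i + l})"
    by (auto simp: hcube_def)
  also have "\<dots> \<in> sets borel"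
    by (intro sets.finite_INT sets.Int borel_closed borel_open closed_halfspace_component_ge_cart
        open_halfspace_component_lt_cart) auto
  finally show ?thesis .
qed

lemma hcube_lebesgue [measurable, simp]: "hcube a l \<in> sets lebesgue"
  by (simp add: sets_completionI_sets)

lemma emeasure_hcube:
  fixes a :: "real ^ 'n"
  assumes "0 \<le> l"
  shows "emeasure lebesgue (hcube a l) = ennreal (l ^ CARD('n))"
proof -
  have "emeasure lebesgue (hcube a l) = emeasure lebesgue (cbox a (\<chi> i. a $ i + l))"
    using AE_hcube_eq_cbox by (intro emeasure_eq_AE) auto
  also have "\<dots> = ennreal (measure lborel (cbox a (\<chi> i. a $ i + l)))"
    using emeasure_lborel_cbox_finite[of a "\<chi> i. a $ i + l"]
    by (simp add: emeasure_eq_ennreal_measure less_top emeasure_completion)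
  also have "measure lborel (cbox a (\<chi> i. a $ i + l)) = l ^ CARD('n)"
    using assms by (subst content_cbox_cart) (auto simp: interval_ne_empty_cart)
  finally show ?thesis .
qed

lemma emeasure_cube:
  fixes a :: "real ^ 'n"
  assumes "0 \<le> l"
  shows "emeasure lebesgue (cbox a (\<chi> i. a $ i + l)) = ennreal (l ^ CARD('n))"
proof -
  have "emeasure lebesgue (hcube a l) = emeasure lebesgue (cbox a (\<chi> i. a $ i + l))"
    using AE_hcube_eq_cbox by (intro emeasure_eq_AE) auto
  then show ?thesis using assms by (simp add: emeasure_hcube)
qed

lemma hcube_bisect:
  assumes "0 < l"
  shows "hcube a l = (\<Union>e. hcube (corner a (l/2) e) (l/2))"
proof (intro equalityI subsetI)
  fix x assume x: "x \<in> hcube a l"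
  have "x \<in> hcube (corner a (l/2) {i. a $ i + l/2 \<le> x $ i}) (l/2)"
    using x by (auto simp: hcube_def corner_def not_le) (smt (verit) field_sum_of_halves)
  then show "x \<in> (\<Union>e. hcube (corner a (l/2) e) (l/2))" by blast
next
  fix x assume "x \<in> (\<Union>e. hcube (corner a (l/2) e) (l/2))"
  then obtain e where e: "x \<in> hcube (corner a (l/2) e) (l/2)" by blast
  have "a $ i \<le> x $ i \<and> x $ i < a $ i + l" for i
    using e[unfolded hcube_def corner_def, simplified, rule_format, of i] assms
    by (auto split: if_splits)
  then show "x \<in> hcube a l" by (auto simp: hcube_def)
qed

lemma disjoint_bisect:
  fixes a :: "real ^ 'n"
  shows "disjoint_family (\<lambda>e. hcube (corner a l e) l)"
proof (unfold disjoint_family_on_def, intro ballI impI)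
  fix e e' :: "'n set" assume "e \<noteq> e'"
  then obtain i where "i \<in> e \<and> i \<notin> e' \<or> i \<notin> e \<and> i \<in> e'" by blast
  then have "x \<notin> hcube (corner a l e) l \<or> x \<notin> hcube (corner a l e') l" for x
    by (auto simp: hcube_def corner_def intro!: exI[of _ i])
  then show "hcube (corner a l e) l \<inter> hcube (corner a l e') l = {}" by auto
qed

section \<open>Stopping cubes and differentiation of integrals\<close>

text \<open>
  The union of the maximal dyadic subcubes, of generation at most \<open>N\<close>, with the property \<open>P\<close>. The
  recursion stops at the first cube with the property, so that maximality and disjointness are built
  in, and facts about Calderon-Zygmund cubes become inductions on \<open>N\<close>.
\<close>

primrec stops :: "(real ^ 'n \<Rightarrow> real \<Rightarrow> bool) \<Rightarrow> nat \<Rightarrow> real ^ 'n \<Rightarrow> real \<Rightarrow> (real ^ 'n) set" where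
  "stops P 0 a l = (if P a l then hcube a l else {})"
| "stops P (Suc N) a l =
     (if P a l then hcube a l else (\<Union>e. stops P N (corner a (l/2) e) (l/2)))"

lemma stops_subset: "0 < l \<Longrightarrow> stops P N a l \<subseteq> hcube a l"
proof (induction N arbitrary: a l)
  case (Suc N)
  have "stops P N (corner a (l/2) e) (l/2) \<subseteq> hcube a l" for e
    using Suc.IH[of "l/2" "corner a (l/2) e"] Suc.prems hcube_bisect[OF Suc.prems, of a] by auto
  then show ?case by auto
qed auto

lemma stops_sets [measurable, simp]: "stops P N a l \<in> sets lebesgue"
  by (induction N arbitrary: a l) auto

lemma stops_mono: "0 < l \<Longrightarrow> N \<le> N' \<Longrightarrow> stops P N a l \<subseteq> stops P N' a l"
proof (induction N arbitrary: a l N')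
  case 0
  then show ?case by (cases N') auto
next
  case (Suc N)
  then obtain M where [simp]: "N' = Suc M" "N \<le> M" by (cases N') auto
  show ?case
    using Suc.IH[of "l/2" M "corner a (l/2) _"] \<open>0 < l\<close> by (auto split: if_splits)
qed

lemma emeasure_stops_Suc:
  assumes "0 < l" "\<not> P a l" "sets M = sets lebesgue" "X \<in> sets lebesgue"
  shows "emeasure M (stops P (Suc N) a l \<inter> X) =
    (\<Sum>e\<in>UNIV. emeasure M (stops P N (corner a (l/2) e) (l/2) \<inter> X))"
proof -
  have "(\<Sum>e\<in>UNIV. emeasure M (stops P N (corner a (l/2) e) (l/2) \<inter> X)) =
    emeasure M (\<Union>e. stops P N (corner a (l/2) e) (l/2) \<inter> X)"
  proof (rule sum_emeasure)
    show "disjoint_family (\<lambda>e. stops P N (corner a (l/2) e) (l/2) \<inter> X)"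
      using stops_subset[of "l/2" P N] \<open>0 < l\<close>
      by (intro disjoint_family_subset[OF disjoint_bisect[of a "l/2"]]) auto
    show "range (\<lambda>e. stops P N (corner a (l/2) e) (l/2) \<inter> X) \<subseteq> sets M"
      unfolding assms(3) by (intro image_subsetI sets.Int stops_sets assms(4))
  qed simp
  moreover have "(\<Union>e. stops P N (corner a (l/2) e) (l/2) \<inter> X) = stops P (Suc N) a l \<inter> X"
    using assms by auto
  ultimately show ?thesis by simp
qed

text \<open>
  The weak type \<open>(1,1)\<close> inequality of the dyadic maximal operator, with constant one.
\<close>

lemma stops_mass_le:
  assumes "sets F = sets lebesgue"
    and "\<And>a l. 0 < l \<Longrightarrow> P a l \<Longrightarrow> \<mu> * emeasure lebesgue (hcube a l) \<le> emeasure F (hcube a l)"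
  shows "0 < l \<Longrightarrow> \<mu> * emeasure lebesgue (stops P N a l) \<le> emeasure F (stops P N a l)"
proof (induction N arbitrary: a l)
  case (Suc N)
  show ?case
  proof (cases "P a l")
    case False
    have "\<mu> * (\<Sum>e\<in>UNIV. emeasure lebesgue (stops P N (corner a (l/2) e) (l/2)))
        \<le> (\<Sum>e\<in>UNIV. emeasure F (stops P N (corner a (l/2) e) (l/2)))"
      unfolding sum_distrib_left using Suc by (intro sum_mono) auto
    then show ?thesis
      using emeasure_stops_Suc[of l P a lebesgue UNIV N] emeasure_stops_Suc[of l P a F UNIV N]
        False Suc.prems assms(1) by simp
  qed (use assms Suc in simp)
qed (use assms in auto)

text \<open>
  The good-lambda step for a measure \<open>\<nu>\<close> satisfying an \<open>A\<^sub>\<infinity>\<close> condition. On a maximal cube \<open>Q\<close> with average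
  above \<open>t\<close> the average is at most \<open>2\<^sup>n t\<close>, its parent not having been selected; so the part of \<open>Q\<close> above
  level \<open>K t\<close> has Lebesgue measure at most \<open>\<alpha>\<bar>Q\<bar>\<close>, and \<open>\<nu>\<close> shrinks by the factor \<open>\<beta>\<close>. The bound
  \<open>2\<^sup>n t\<close> on the starting cube is what the induction needs in order to pass to the children.
\<close>

lemma stops_decay:
  fixes \<nu> F :: "(real ^ 'n) measure" and t K \<alpha> :: real and \<beta> :: ennreal
  assumes [simp]: "sets F = sets lebesgue" "sets \<nu> = sets lebesgue"
    and thin: "\<And>a l E. 0 < l \<Longrightarrow> E \<in> sets lebesgue \<Longrightarrow> E \<subseteq> hcube a l \<Longrightarrow>
        emeasure lebesgue E \<le> ennreal \<alpha> * emeasure lebesgue (hcube a l) \<Longrightarrow>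
        emeasure \<nu> E \<le> \<beta> * emeasure \<nu> (hcube a l)"
    and "0 < t" "0 < \<alpha>" "\<alpha> \<le> 1" "K = 2 ^ CARD('n) / \<alpha>"
  defines "P \<equiv> \<lambda>\<mu> a l. ennreal \<mu> * emeasure lebesgue (hcube a l) < emeasure F (hcube a l)"
  shows "0 < l \<Longrightarrow> emeasure F (hcube a l) \<le> ennreal (2 ^ CARD('n) * t) * emeasure lebesgue (hcube a l) \<Longrightarrow>
    emeasure \<nu> (stops (P (K * t)) N a l) \<le> \<beta> * emeasure \<nu> (stops (P t) N a l)"
proof (induction N arbitrary: a l)
  note [simp del] = stops.simps
  have "1 \<le> (2::real) ^ CARD('n)" by simp
  then have "\<alpha> \<le> 2 ^ CARD('n)" using \<open>\<alpha> \<le> 1\<close> by linarith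
  then have K: "1 \<le> K" using assms(5-7) by (simp add: le_divide_eq)
  then have le: "t \<le> K * t" using \<open>0 < t\<close> by simp
  have stop: "emeasure \<nu> (stops (P (K * t)) N a l) \<le> \<beta> * emeasure \<nu> (stops (P t) N a l)"
    if "P t a l" "0 < l"
      "emeasure F (hcube a l) \<le> ennreal (2 ^ CARD('n) * t) * emeasure lebesgue (hcube a l)" for N a l
  proof -
    let ?S = "stops (P (K * t)) N a l"
    have "ennreal (K * t) * emeasure lebesgue ?S \<le> emeasure F ?S"
      using that(2) by (intro stops_mass_le) (auto simp: P_def less_imp_le)
    also have "\<dots> \<le> emeasure F (hcube a l)"
      using stops_subset[OF that(2)] by (intro emeasure_mono) auto
    also have "\<dots> \<le> ennreal (2 ^ CARD('n) * t) * emeasure lebesgue (hcube a l)" by fact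
    also have "\<dots> = ennreal (K * t) * (ennreal \<alpha> * emeasure lebesgue (hcube a l))"
      using assms(4-7) K by (simp add: ennreal_mult[symmetric] mult.assoc[symmetric])
    finally have "emeasure lebesgue ?S \<le> ennreal \<alpha> * emeasure lebesgue (hcube a l)"
      using K \<open>0 < t\<close> by (subst (asm) ennreal_mult_le_mult_iff) auto
    then have "emeasure \<nu> ?S \<le> \<beta> * emeasure \<nu> (hcube a l)"
      using stops_subset[OF that(2)] that(2) by (intro thin) auto
    moreover have "stops (P t) N a l = hcube a l"
      using that(1) by (cases N) (auto simp: stops.simps)
    ultimately show ?thesis by simp
  qed
  have no: "emeasure F (hcube a l) \<le> ennreal t * emeasure lebesgue (hcube a l)" "\<not> P (K * t) a l"
    if "\<not> P t a l" for a l
  proof -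
    show *: "emeasure F (hcube a l) \<le> ennreal t * emeasure lebesgue (hcube a l)"
      using that by (simp add: P_def not_less)
    also have "\<dots> \<le> ennreal (K * t) * emeasure lebesgue (hcube a l)"
      using le by (intro mult_right_mono ennreal_leI) auto
    finally show "\<not> P (K * t) a l" by (simp add: P_def not_less)
  qed
  {
    case 0
    then show ?case using stop[of a l 0] no[of a l] by (cases "P t a l") (auto simp: stops.simps)
  next
    case (Suc N)
    show ?case
    proof (cases "P t a l")
      case False
      have child: "emeasure F (hcube (corner a (l/2) e) (l/2)) \<le>
          ennreal (2 ^ CARD('n) * t) * emeasure lebesgue (hcube (corner a (l/2) e) (l/2))" for e
      proof -
        have "emeasure F (hcube (corner a (l/2) e) (l/2)) \<le> emeasure F (hcube a l)"
          using hcube_bisect[OF Suc.prems(1), of a] by (intro emeasure_mono) auto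
        also have "\<dots> \<le> ennreal t * emeasure lebesgue (hcube a l)" using no False by simp
        also have "\<dots> = ennreal (2 ^ CARD('n) * t) * emeasure lebesgue (hcube (corner a (l/2) e) (l/2))"
          using Suc.prems \<open>0 < t\<close>
          by (simp add: emeasure_hcube ennreal_mult[symmetric] power_divide)
        finally show ?thesis .
      qed
      have "(\<Sum>e\<in>UNIV. emeasure \<nu> (stops (P (K * t)) N (corner a (l/2) e) (l/2)))
        \<le> \<beta> * (\<Sum>e\<in>UNIV. emeasure \<nu> (stops (P t) N (corner a (l/2) e) (l/2)))"
        unfolding sum_distrib_left using Suc child by (intro sum_mono Suc.IH) auto
      then show ?thesis
        using emeasure_stops_Suc[of l "P t" a \<nu> UNIV N]
          emeasure_stops_Suc[of l "P (K * t)" a \<nu> UNIV N] False no[OF False] Suc.prems by simp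
    qed (use stop Suc in blast)
  }
qed

text \<open>
  Subcubes of generation \<open>N\<close> have side \<open>l/2\<^sup>N\<close>, so they eventually fit into any ball around a point. Thus
  an open set is exhausted by its dyadic subcubes.
\<close>

lemma stops_inside_open:
  fixes x a :: "real ^ 'n"
  shows "0 < l \<Longrightarrow> x \<in> hcube a l \<Longrightarrow> cball x r \<subseteq> G \<Longrightarrow> real CARD('n) * l \<le> r * 2 ^ N \<Longrightarrow>
    x \<in> stops (\<lambda>a l. hcube a l \<subseteq> G) N a l"
proof (induction N arbitrary: a l)
  case 0
  have "y \<in> cball x r" if "y \<in> hcube a l" for y
  proof -
    have "dist x y \<le> (\<Sum>i\<in>UNIV. \<bar>(x - y) $ i\<bar>)"
      unfolding dist_norm by (rule norm_le_l1_cart)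
    also have "\<dots> \<le> (\<Sum>i\<in>(UNIV :: 'n set). l)"
    proof (rule sum_mono)
      fix i
      show "\<bar>(x - y) $ i\<bar> \<le> l"
        using that 0(2) unfolding hcube_def by (auto simp: abs_le_iff dest!: spec[of _ i])
    qed
    also have "\<dots> \<le> r" using 0(4) by simp
    finally show ?thesis by simp
  qed
  then show ?case using 0 by auto
next
  case (Suc N)
  then obtain e where e: "x \<in> hcube (corner a (l/2) e) (l/2)"
    using hcube_bisect[OF Suc.prems(1), of a] by blast
  have "x \<in> stops (\<lambda>a l. hcube a l \<subseteq> G) N (corner a (l/2) e) (l/2)"
    using Suc.prems e by (intro Suc.IH) auto
  then show ?case using Suc.prems by auto
qed

text \<open>
  Each cube counted by \<open>D\<close> that does not lie in a cube of large average has itself a small average.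
\<close>

lemma stops_diff_mass_le:
  fixes F :: "(real ^ 'n) measure" and t :: ennreal
  assumes [simp]: "sets F = sets lebesgue"
  defines "P \<equiv> \<lambda>a l. t * emeasure lebesgue (hcube a l) < emeasure F (hcube a l)"
  shows "0 < l \<Longrightarrow> emeasure F (stops D N a l - stops P N a l) \<le> t * emeasure lebesgue (stops D N a l)"
proof (induction N arbitrary: a l)
  have main: "emeasure F (stops D N a l - stops P N a l) \<le> t * emeasure lebesgue (stops D N a l)"
    if "P a l \<or> D a l" "0 < l" for N a l
  proof (cases "P a l")
    case True
    then have "stops P N a l = hcube a l" by (cases N) auto
    then have "stops D N a l - stops P N a l = {}" using stops_subset[OF that(2), of D N a] by auto
    then show ?thesis by (simp only: emeasure_empty zero_le)
  next
    case False
    then have D: "stops D N a l = hcube a l" using that by (cases N) auto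
    have "emeasure F (stops D N a l - stops P N a l) \<le> emeasure F (hcube a l)"
      unfolding D by (intro emeasure_mono) auto
    then show ?thesis unfolding D using False by (simp add: P_def not_less)
  qed
  {
    case 0
    then show ?case using main[of a l 0] by (cases "P a l \<or> D a l") auto
  next
    case (Suc N)
    show ?case
    proof (cases "P a l \<or> D a l")
      case False
      let ?c = "\<lambda>e. corner a (l/2) e" and ?X = "- stops P (Suc N) a l"
      have X_sets: "?X \<in> sets lebesgue"
        using sets.compl_sets[OF stops_sets[of P "Suc N" a l]] by (simp only: Compl_eq_Diff_UNIV) simp
      have X: "stops D N (?c e) (l/2) \<inter> ?X \<subseteq> stops D N (?c e) (l/2) - stops P N (?c e) (l/2)" for e
        using False by auto
      have "emeasure F (stops D (Suc N) a l \<inter> ?X) = (\<Sum>e\<in>UNIV. emeasure F (stops D N (?c e) (l/2) \<inter> ?X))"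
        using False Suc.prems by (intro emeasure_stops_Suc X_sets) auto
      also have "\<dots> \<le> (\<Sum>e\<in>UNIV. t * emeasure lebesgue (stops D N (?c e) (l/2)))"
        by (intro sum_mono order_trans[OF emeasure_mono[OF X] Suc.IH]) (use Suc.prems in auto)
      also have "\<dots> = t * emeasure lebesgue (stops D (Suc N) a l)"
        using emeasure_stops_Suc[of l D a lebesgue UNIV N] False Suc.prems
        by (simp add: sum_distrib_left)
      finally show ?thesis by (simp add: Diff_eq)
    qed (use main Suc in blast)
  }
qed

text \<open>
  A dyadic Lebesgue differentiation theorem in one-sided form. On the exceptional set \<open>S\<close> one has
  \<open>f > t\<close>, but all dyadic cubes meeting \<open>S\<close> have average at most \<open>t\<close>. Covering \<open>S\<close> by the dyadic cubes
  inside an open \<open>G\<close> gives \<open>\<integral>\<^sub>S f \<le> t\<bar>G\<bar>\<close>; letting \<open>G\<close> shrink to \<open>S\<close> gives \<open>\<integral>\<^sub>S f \<le> t\<bar>S\<bar>\<close>, which forces \<open>S\<close> to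
  be null.
\<close>

lemma stops_exhaust:
  fixes f :: "real ^ 'n \<Rightarrow> ennreal" and t :: real
  assumes [measurable]: "f \<in> borel_measurable lebesgue" and l: "0 < l" and t: "0 \<le> t"
  defines "P \<equiv> \<lambda>a l. ennreal t * emeasure lebesgue (hcube a l) < emeasure (density lebesgue f) (hcube a l)"
  shows "AE x in lebesgue. x \<in> hcube a l \<longrightarrow> ennreal t < f x \<longrightarrow> (\<exists>N. x \<in> stops P N a l)"
proof -
  let ?F = "density lebesgue f"
  define S where "S = {x\<in>space lebesgue. ennreal t < f x} \<inter> hcube a l - (\<Union>N. stops P N a l)"
  have S[measurable]: "S \<in> sets lebesgue" unfolding S_def by measurable
  have finS: "emeasure lebesgue S < \<infinity>"
  proof -
    have "emeasure lebesgue S \<le> emeasure lebesgue (hcube a l)"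
      by (intro emeasure_mono) (auto simp: S_def)
    then show ?thesis using l by (auto simp: emeasure_hcube le_less_trans)
  qed
  have open_bound: "emeasure ?F S \<le> ennreal t * emeasure lebesgue G" if G: "open G" "S \<subseteq> G" for G
  proof -
    define D where "D = (\<lambda>N. stops (\<lambda>a l. hcube a l \<subseteq> G) N a l)"
    have "emeasure ?F S \<le> emeasure ?F (\<Union>N. S \<inter> D N)"
    proof (rule emeasure_mono)
      show "S \<subseteq> (\<Union>N. S \<inter> D N)"
      proof
        fix x assume x: "x \<in> S"
        then obtain r where r: "0 < r" "cball x r \<subseteq> G" using G open_contains_cball by blast
        obtain N where "real CARD('n) * l / r < 2 ^ N" using real_arch_pow[of 2] by auto
        then have "x \<in> D N" unfolding D_def
          using x r l by (intro stops_inside_open) (auto simp: S_def field_simps)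
        with x show "x \<in> (\<Union>N. S \<inter> D N)" by blast
      qed
    qed (auto simp: D_def)
    also have "\<dots> = (SUP N. emeasure ?F (S \<inter> D N))"
      using stops_mono[OF l, of _ _ "\<lambda>a l. hcube a l \<subseteq> G" a]
      by (intro SUP_emeasure_incseq[symmetric]) (fastforce simp: D_def incseq_def)+
    also have "\<dots> \<le> ennreal t * emeasure lebesgue G"
    proof (rule SUP_least)
      fix N
      have sub: "stops (\<lambda>a l. hcube a l \<subseteq> G) N a l \<subseteq> G" for a :: "real ^ 'n" and l
        by (induction N arbitrary: a l) auto
      have "emeasure ?F (S \<inter> D N) \<le> emeasure ?F (D N - stops P N a l)"
        by (intro emeasure_mono) (auto simp: S_def D_def)
      also have "\<dots> \<le> ennreal t * emeasure lebesgue (D N)"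
        unfolding D_def P_def by (intro stops_diff_mass_le l) simp
      also have "\<dots> \<le> ennreal t * emeasure lebesgue G"
        using sub G(1) unfolding D_def by (intro mult_left_mono emeasure_mono) auto
      finally show "emeasure ?F (S \<inter> D N) \<le> ennreal t * emeasure lebesgue G" .
    qed
    finally show ?thesis .
  qed
  have le: "emeasure ?F S \<le> ennreal t * emeasure lebesgue S"
  proof (rule ennreal_le_epsilon)
    fix e :: real assume e: "0 < e"
    define d where "d = e / (t + 1)"
    have d: "0 < d" "t * d \<le> e" using e t by (auto simp: d_def field_simps)
    obtain G where G: "open G" "S \<subseteq> G" "G - S \<in> lmeasurable" "emeasure lebesgue (G - S) < ennreal d"
      using sets_lebesgue_outer_open[OF S d(1)] by blast
    have "emeasure lebesgue G \<le> emeasure lebesgue S + emeasure lebesgue (G - S)"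
      using emeasure_subadditive[of S lebesgue "G - S"] G by (auto simp: Un_absorb1)
    also have "\<dots> \<le> emeasure lebesgue S + ennreal d" using G by (intro add_left_mono) auto
    finally have "emeasure ?F S \<le> ennreal t * (emeasure lebesgue S + ennreal d)"
      using open_bound[OF G(1,2)] by (meson mult_left_mono order_trans zero_le)
    also have "\<dots> \<le> ennreal t * emeasure lebesgue S + ennreal e"
      using d t by (simp add: distrib_left ennreal_mult[symmetric] ennreal_leI)
    finally show "emeasure ?F S \<le> ennreal t * emeasure lebesgue S + ennreal e" .
  qed
  have "(\<integral>\<^sup>+x. (f x - ennreal t) * indicator S x \<partial>lebesgue) + ennreal t * emeasure lebesgue S
      = (\<integral>\<^sup>+x. (f x - ennreal t) * indicator S x + ennreal t * indicator S x \<partial>lebesgue)"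
    by (subst nn_integral_add) (auto simp: nn_integral_cmult_indicator)
  also have "\<dots> = emeasure ?F S"
    by (subst emeasure_density)
      (auto intro!: nn_integral_cong simp: S_def diff_add_cancel_ennreal split: split_indicator)
  also have "\<dots> \<le> 0 + ennreal t * emeasure lebesgue S" using le by simp
  finally have "(\<integral>\<^sup>+x. (f x - ennreal t) * indicator S x \<partial>lebesgue) \<le> 0"
    using finS ennreal_add_left_cancel_le[of "ennreal t * emeasure lebesgue S" _ 0]
    by (auto simp: add.commute ennreal_mult_eq_top_iff)
  then have "AE x in lebesgue. (f x - ennreal t) * indicator S x = 0"
    by (subst (asm) le_zero_eq, subst (asm) nn_integral_0_iff_AE) auto
  then show ?thesis
  proof eventually_elim
    case (elim x)
    then have "x \<notin> S"
      by (cases "x \<in> S") (auto simp: S_def diff_eq_0_iff_ennreal)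
    then show ?case by (simp add: S_def)
  qed
qed

lemma stops_witness:
  "0 < l \<Longrightarrow> x \<in> stops P N a l \<Longrightarrow> \<exists>a' l'. 0 < l' \<and> P a' l' \<and> x \<in> hcube a' l'"
proof (induction N arbitrary: a l)
  case 0
  then show ?case by (auto split: if_splits)
next
  case (Suc N)
  show ?case
  proof (cases "P a l")
    case False
    then obtain e where "x \<in> stops P N (corner a (l/2) e) (l/2)" using Suc.prems by auto
    with Suc.IH[of "l/2"] Suc.prems show ?thesis by auto
  qed (use Suc.prems in auto)
qed

abbreviation weighted :: "(real ^ 'n \<Rightarrow> real) \<Rightarrow> (real ^ 'n) measure" where
  "weighted w \<equiv> density lebesgue (\<lambda>x. ennreal (w x))"

text \<open>
  The inequality \<open>w \<le> M w\<close> almost everywhere, in the form in which it is applied to \<open>w = v\<^sup>q\<close>.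
\<close>

lemma AE_cube_average_exceeds:
  fixes w :: "real ^ 'n \<Rightarrow> real"
  assumes [measurable]: "w \<in> borel_measurable lebesgue"
  shows "AE x in lebesgue. \<forall>t\<ge>0. t < w x \<longrightarrow>
    (\<exists>a l. 0 < l \<and> x \<in> hcube a l \<and> ennreal t * emeasure lebesgue (hcube a l) < emeasure (weighted w) (hcube a l))"
proof -
  define P where "P = (\<lambda>t a l. ennreal t * emeasure lebesgue (hcube a l) < emeasure (weighted w) (hcube a l))"
  define A :: "nat \<Rightarrow> real ^ 'n" where "A = (\<lambda>k. \<chi> i. - real (Suc k))"
  define S where "S = (\<lambda>k. 2 * real (Suc k))"
  have "AE x in lebesgue. \<forall>t :: rat. \<forall>k. 0 \<le> t \<longrightarrow> x \<in> hcube (A k) (S k) \<longrightarrow> ennreal (real_of_rat t) < ennreal (w x) \<longrightarrow>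
      (\<exists>N. x \<in> stops (P (real_of_rat t)) N (A k) (S k))"
    unfolding AE_all_countable
  proof (intro allI)
    fix t :: rat and k
    show "AE x in lebesgue. 0 \<le> t \<longrightarrow> x \<in> hcube (A k) (S k) \<longrightarrow> ennreal (real_of_rat t) < ennreal (w x) \<longrightarrow>
      (\<exists>N. x \<in> stops (P (real_of_rat t)) N (A k) (S k))"
      using stops_exhaust[of "\<lambda>x. ennreal (w x)" "S k" "real_of_rat t" "A k"]
      by (cases "0 \<le> t") (auto simp: P_def S_def)
  qed
  then show ?thesis
  proof eventually_elim
    case (elim x)
    show ?case
    proof (intro allI impI)
      fix t :: real assume t: "0 \<le> t" "t < w x"
      then obtain s where s: "t < real_of_rat s" "real_of_rat s < w x" using of_rat_dense by blast
      then have "(0::real) \<le> real_of_rat s" using t by linarith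
      then have s0: "0 \<le> s" by (simp only: zero_le_of_rat_iff)
      obtain k :: nat where k: "norm x \<le> real k" using real_arch_simple by blast
      have "\<bar>x $ i\<bar> \<le> real k" for i using component_le_norm_cart[of x i] k by linarith
      then have "x \<in> hcube (A k) (S k)" unfolding hcube_def A_def S_def
        by (simp add: abs_le_iff) (smt (verit))
      moreover have "ennreal (real_of_rat s) < ennreal (w x)" using s s0 by (subst ennreal_less_iff) auto
      ultimately obtain N where "x \<in> stops (P (real_of_rat s)) N (A k) (S k)" using elim s0 by blast
      then obtain a l where al: "0 < l" "P (real_of_rat s) a l" "x \<in> hcube a l"
        using stops_witness[of "S k" x "P (real_of_rat s)" N "A k"] by (auto simp: S_def)
      have "ennreal t * emeasure lebesgue (hcube a l) \<le> ennreal (real_of_rat s) * emeasure lebesgue (hcube a l)"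
        using s by (intro mult_right_mono ennreal_leI) auto
      also have "\<dots> < emeasure (weighted w) (hcube a l)" using al(2) by (simp add: P_def)
      finally show "\<exists>a l. 0 < l \<and> x \<in> hcube a l \<and> ennreal t * emeasure lebesgue (hcube a l) < emeasure (weighted w) (hcube a l)"
        using al by blast
    qed
  qed
qed

section \<open>The \<open>A\<^sub>\<infinity>\<close> condition on thin subsets of cubes\<close>

text \<open>
  The qualitative form of \<open>A\<^sub>\<infinity>\<close>: subsets that occupy a fraction \<open>\<alpha> < 1\<close> of a cube carry at most a fraction
  \<open>\<beta> < 1\<close> of its mass, for every \<open>\<alpha>\<close>. Decay, the reverse Hoelder inequality and both doubling
  properties follow from it. Weights are positive at every point here, which costs only a change on a
  null set.
\<close>

definition A_inf :: "(real ^ 'n \<Rightarrow> real) \<Rightarrow> bool" where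
  "A_inf w \<longleftrightarrow> w \<in> borel_measurable lebesgue \<and> (\<forall>x. 0 < w x) \<and>
     (\<forall>a l. 0 < l \<longrightarrow> emeasure (weighted w) (hcube a l) < \<infinity>) \<and>
     (\<forall>\<alpha>>0. \<alpha> < 1 \<longrightarrow> (\<exists>\<beta>. 0 < \<beta> \<and> \<beta> < 1 \<and> (\<forall>a l E. 0 < l \<longrightarrow> E \<in> sets lebesgue \<longrightarrow> E \<subseteq> hcube a l \<longrightarrow>
        emeasure lebesgue E \<le> ennreal \<alpha> * emeasure lebesgue (hcube a l) \<longrightarrow>
        emeasure (weighted w) E \<le> ennreal \<beta> * emeasure (weighted w) (hcube a l))))"

lemma A_infD:
  assumes "A_inf w"
  shows "w \<in> borel_measurable lebesgue" "\<And>x. 0 < w x"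
    "\<And>a l. 0 < l \<Longrightarrow> emeasure (weighted w) (hcube a l) < \<infinity>"
  using assms by (auto simp: A_inf_def)

lemma A_inf_thin:
  assumes "A_inf (w :: real ^ 'n \<Rightarrow> real)" "0 < \<alpha>" "\<alpha> < 1"
  obtains \<beta> where "0 < \<beta>" "\<beta> < 1"
    "\<And>a l E. 0 < l \<Longrightarrow> E \<in> sets lebesgue \<Longrightarrow> E \<subseteq> hcube a l \<Longrightarrow>
        emeasure lebesgue E \<le> ennreal \<alpha> * emeasure lebesgue (hcube a l) \<Longrightarrow>
        emeasure (weighted w) E \<le> ennreal \<beta> * emeasure (weighted w) (hcube a l)"
  using assms unfolding A_inf_def by metis

lemma A_inf_level_decay:
  fixes w :: "real ^ 'n \<Rightarrow> real"
  assumes "A_inf w"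
  obtains \<beta> where "0 < \<beta>" "\<beta> < 1"
    "\<And>f a l t j. f \<in> borel_measurable lebesgue \<Longrightarrow> 0 < l \<Longrightarrow> 0 < t \<Longrightarrow>
       emeasure (density lebesgue f) (hcube a l) \<le> ennreal t * emeasure lebesgue (hcube a l) \<Longrightarrow>
       emeasure (weighted w) {x \<in> hcube a l. ennreal ((2 * 2 ^ CARD('n)) ^ j * t) < f x}
         \<le> ennreal (\<beta> ^ j) * emeasure (weighted w) (hcube a l)"
proof -
  have half_less: "1 / 2 < (1::real)" by simp
  obtain \<beta> where \<beta>: "0 < \<beta>" "\<beta> < 1"
    "\<And>a l E. 0 < l \<Longrightarrow> E \<in> sets lebesgue \<Longrightarrow> E \<subseteq> hcube a l \<Longrightarrow>
        emeasure lebesgue E \<le> ennreal (1/2) * emeasure lebesgue (hcube a l) \<Longrightarrow>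
        emeasure (weighted w) E \<le> ennreal \<beta> * emeasure (weighted w) (hcube a l)"
    by (rule A_inf_thin[OF assms half_gt_zero[OF zero_less_one] half_less]) (rule that)
  note [measurable] = A_infD(1)[OF assms]
  let ?K = "2 * 2 ^ CARD('n) :: real"
  show ?thesis
  proof (rule that[OF \<beta>(1,2)])
    fix f :: "real ^ 'n \<Rightarrow> ennreal" and a :: "real ^ 'n" and l t :: real and j
    assume [measurable]: "f \<in> borel_measurable lebesgue" and l: "0 < l" and t: "0 < t"
      and avg: "emeasure (density lebesgue f) (hcube a l) \<le> ennreal t * emeasure lebesgue (hcube a l)"
    define P where "P = (\<lambda>\<mu> a l. ennreal \<mu> * emeasure lebesgue (hcube a l) < emeasure (density lebesgue f) (hcube a l))"
    have stops: "emeasure (weighted w) (stops (P (?K ^ j * t)) N a l) \<le> ennreal (\<beta> ^ j) * emeasure (weighted w) (hcube a l)" for N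
    proof (induction j)
      case 0
      show ?case using emeasure_mono[OF stops_subset[OF l, of "P t" N a], of "weighted w"] by simp
    next
      case (Suc j)
      have "emeasure (density lebesgue f) (hcube a l) \<le> ennreal (2 ^ CARD('n) * (?K ^ j * t)) * emeasure lebesgue (hcube a l)"
      proof (rule order_trans[OF avg mult_right_mono[OF ennreal_leI]])
        have "1 \<le> (2 :: real) ^ CARD('n)" by simp
        moreover from this have "1 \<le> ?K ^ j" by (intro one_le_power) linarith
        ultimately have "1 \<le> 2 ^ CARD('n) * ?K ^ j" by (rule mult_ge1_I)
        then show "t \<le> 2 ^ CARD('n) * (?K ^ j * t)" using t by (simp add: mult.assoc[symmetric])
      qed simp
      then have "emeasure (weighted w) (stops (P (?K * (?K ^ j * t))) N a l) \<le> ennreal \<beta> * emeasure (weighted w) (stops (P (?K ^ j * t)) N a l)"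
        unfolding P_def using t l \<beta>
        by (intro stops_decay[where \<alpha> = "1/2"]) auto
      also have "\<dots> \<le> ennreal \<beta> * (ennreal (\<beta> ^ j) * emeasure (weighted w) (hcube a l))"
        by (intro mult_left_mono Suc) simp
      finally show ?case using \<beta> by (simp add: ennreal_mult[symmetric] mult.assoc[symmetric])
    qed
    have "emeasure (weighted w) {x \<in> hcube a l. ennreal (?K ^ j * t) < f x}
        \<le> emeasure (weighted w) (\<Union>N. stops (P (?K ^ j * t)) N a l)"
    proof (rule emeasure_mono_AE)
      show "AE x in weighted w. x \<in> {x \<in> hcube a l. ennreal (?K ^ j * t) < f x} \<longrightarrow> x \<in> (\<Union>N. stops (P (?K ^ j * t)) N a l)"
        using stops_exhaust[of f l "?K ^ j * t" a] l t
        by (subst AE_density) (auto simp: P_def elim!: eventually_mono)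
    qed auto
    also have "\<dots> = (SUP N. emeasure (weighted w) (stops (P (?K ^ j * t)) N a l))"
      by (intro SUP_emeasure_incseq[symmetric]) (auto intro!: incseq_SucI stops_mono[OF l] simp del: stops.simps)
    also have "\<dots> \<le> ennreal (\<beta> ^ j) * emeasure (weighted w) (hcube a l)"
      by (intro SUP_least stops)
    finally show "emeasure (weighted w) {x \<in> hcube a l. ennreal (?K ^ j * t) < f x}
         \<le> ennreal (\<beta> ^ j) * emeasure (weighted w) (hcube a l)" .
  qed
qed

text \<open>
  The set where \<open>f\<close> exceeds \<open>s\<close> times its average has \<open>w\<close>-measure of order \<open>s\<^sup>-\<^sup>\<epsilon>\<close>, for an arbitrary \<open>f\<close>.
  Two cases are used below: \<open>f\<close> the other weight, and \<open>f = w\<close> itself, which is the reverse Hoelder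
  inequality.
\<close>

lemma A_inf_decay:
  fixes w :: "real ^ 'n \<Rightarrow> real"
  assumes "A_inf w"
  obtains C \<epsilon> where "0 < C" "0 < \<epsilon>"
    "\<And>f a l t s. f \<in> borel_measurable lebesgue \<Longrightarrow> 0 < l \<Longrightarrow> 0 < t \<Longrightarrow> 0 < s \<Longrightarrow>
       emeasure (density lebesgue f) (hcube a l) \<le> ennreal t * emeasure lebesgue (hcube a l) \<Longrightarrow>
       emeasure (weighted w) {x \<in> hcube a l. ennreal (s * t) < f x}
         \<le> ennreal (C * s powr - \<epsilon>) * emeasure (weighted w) (hcube a l)"
proof -
  obtain \<beta> where \<beta>: "0 < \<beta>" "\<beta> < 1"
    and decay: "\<And>f a l t j. f \<in> borel_measurable lebesgue \<Longrightarrow> 0 < l \<Longrightarrow> 0 < t \<Longrightarrow>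
       emeasure (density lebesgue f) (hcube a l) \<le> ennreal t * emeasure lebesgue (hcube a l) \<Longrightarrow>
       emeasure (weighted w) {x \<in> hcube a l. ennreal ((2 * 2 ^ CARD('n)) ^ j * t) < f x}
         \<le> ennreal (\<beta> ^ j) * emeasure (weighted w) (hcube a l)"
    by (rule A_inf_level_decay[OF assms]) (rule that)
  note [measurable] = A_infD(1)[OF assms]
  define K :: real where "K = 2 * 2 ^ CARD('n)"
  have K: "1 < K" unfolding K_def using one_le_power[of "2::real" "CARD('n)"] by linarith
  define \<epsilon> where "\<epsilon> = - log K \<beta>"
  have \<epsilon>: "0 < \<epsilon>" unfolding \<epsilon>_def using \<beta> K by simp
  show ?thesis
  proof (rule that[of "1/\<beta>" \<epsilon>])
    fix f :: "real ^ 'n \<Rightarrow> ennreal" and a :: "real ^ 'n" and l t s :: real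
    assume f[measurable]: "f \<in> borel_measurable lebesgue" and l: "0 < l" and t: "0 < t" and s: "0 < s"
      and avg: "emeasure (density lebesgue f) (hcube a l) \<le> ennreal t * emeasure lebesgue (hcube a l)"
    show "emeasure (weighted w) {x \<in> hcube a l. ennreal (s * t) < f x}
         \<le> ennreal (1 / \<beta> * s powr - \<epsilon>) * emeasure (weighted w) (hcube a l)"
    proof (cases "s < 1")
      case True
      have "emeasure (weighted w) {x \<in> hcube a l. ennreal (s * t) < f x} \<le> 1 * emeasure (weighted w) (hcube a l)"
        by (auto intro!: emeasure_mono)
      also have "\<dots> \<le> ennreal (1 / \<beta> * s powr - \<epsilon>) * emeasure (weighted w) (hcube a l)"
      proof (intro mult_right_mono)
        have "1 \<le> s powr - \<epsilon>" using powr_mono'[of "-\<epsilon>" 0 s] True s \<epsilon> by simp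
        moreover have "1 \<le> 1 / \<beta>" using \<beta> by simp
        ultimately have "1 \<le> 1 / \<beta> * s powr - \<epsilon>" by (rule mult_ge1_I[rotated]) 
        then show "1 \<le> ennreal (1 / \<beta> * s powr - \<epsilon>)" by (simp add: ennreal_leI flip: ennreal_1)
      qed simp
      finally show ?thesis .
    next
      case False
      define j where "j = nat \<lfloor>log K s\<rfloor>"
      have "0 \<le> log K s" using False K by simp
      then have j: "real j \<le> log K s" "log K s - 1 \<le> real j" unfolding j_def by linarith+
      have "K ^ j \<le> s" using j(1) K s by (simp add: powr_realpow[symmetric] le_log_iff)
      then have "emeasure (weighted w) {x \<in> hcube a l. ennreal (s * t) < f x} \<le>
          emeasure (weighted w) {x \<in> hcube a l. ennreal (K ^ j * t) < f x}"
        using t by (intro emeasure_mono)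
         (auto elim!: le_less_trans[rotated] intro!: ennreal_leI)
      also have "\<dots> \<le> ennreal (\<beta> ^ j) * emeasure (weighted w) (hcube a l)"
        unfolding K_def by (intro decay f l t avg)
      also have "\<dots> \<le> ennreal (1 / \<beta> * s powr - \<epsilon>) * emeasure (weighted w) (hcube a l)"
      proof (intro mult_right_mono ennreal_leI)
        have "\<beta> ^ j = \<beta> powr real j" using \<beta> by (simp add: powr_realpow)
        also have "\<dots> \<le> \<beta> powr (log K s - 1)" using \<beta> j by (intro powr_mono') auto
        also have "\<dots> = 1 / \<beta> * \<beta> powr (log K s)" using \<beta> by (simp add: powr_diff)
        also have "\<beta> powr (log K s) = s powr - \<epsilon>"
          unfolding \<epsilon>_def using \<beta> s K by (simp add: powr_def log_def)
        finally show "\<beta> ^ j \<le> 1 / \<beta> * s powr - \<epsilon>" .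
      qed simp
      finally show ?thesis .
    qed
  qed (use \<beta> \<epsilon> in auto)
qed

text \<open>
  If the average of \<open>f\<close> is \<open>\<rho>L\<close> with \<open>\<rho> \<le> 1\<close>, then truncation at \<open>L\<close> gains a power of \<open>\<rho>\<close>. This gain makes the
  sum over cubes of all scales converge.
\<close>

lemma A_inf_truncated:
  fixes u :: "real ^ 'n \<Rightarrow> real"
  assumes "A_inf u"
  obtains C \<epsilon> where "0 < C" "0 < \<epsilon>"
    "\<And>f a l L \<rho>. f \<in> borel_measurable lebesgue \<Longrightarrow> 0 < l \<Longrightarrow> 0 < L \<Longrightarrow> 0 < \<rho> \<Longrightarrow> \<rho> \<le> 1 \<Longrightarrow>
       emeasure (density lebesgue f) (hcube a l) \<le> ennreal (\<rho> * L) * emeasure lebesgue (hcube a l) \<Longrightarrow>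
       (\<integral>\<^sup>+x\<in>hcube a l. min (f x) (ennreal L) \<partial>weighted u)
         \<le> ennreal (C * \<rho> powr \<epsilon> * L) * emeasure (weighted u) (hcube a l)"
proof -
  obtain C \<epsilon> where C: "0 < C" "0 < \<epsilon>"
    and decay: "\<And>f a l t s. f \<in> borel_measurable lebesgue \<Longrightarrow> 0 < l \<Longrightarrow> 0 < t \<Longrightarrow> 0 < s \<Longrightarrow>
       emeasure (density lebesgue f) (hcube a l) \<le> ennreal t * emeasure lebesgue (hcube a l) \<Longrightarrow>
       emeasure (weighted u) {x \<in> hcube a l. ennreal (s * t) < f x}
         \<le> ennreal (C * s powr - \<epsilon>) * emeasure (weighted u) (hcube a l)"
    by (rule A_inf_decay[OF assms]) (rule that)
  note [measurable] = A_infD(1)[OF assms]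
  define \<epsilon>' where "\<epsilon>' = min (\<epsilon> / 2) (1 / 2)"
  show ?thesis
  proof (rule that[of "C + 1" \<epsilon>'])
    fix f :: "real ^ 'n \<Rightarrow> ennreal" and a :: "real ^ 'n" and l L \<rho> :: real
    assume f[measurable]: "f \<in> borel_measurable lebesgue" and l: "0 < l" and L: "0 < L" and \<rho>: "0 < \<rho>" "\<rho> \<le> 1"
      and avg: "emeasure (density lebesgue f) (hcube a l) \<le> ennreal (\<rho> * L) * emeasure lebesgue (hcube a l)"
    let ?U = "emeasure (weighted u)"
    let ?S = "{x \<in> hcube a l. ennreal (\<rho> powr (-1/2) * (\<rho> * L)) < f x}"
    have eq: "\<rho> powr (-1/2) * (\<rho> * L) = \<rho> powr (1/2) * L"
      using \<rho> powr_add[of \<rho> "-1/2" 1] by simp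
    define c where "c = \<rho> powr (1/2) * L"
    define S where "S = {x \<in> hcube a l. ennreal c < f x}"
    have S: "?S = S" unfolding S_def c_def eq ..
    have "{x \<in> space lebesgue. ennreal c < f x} \<inter> hcube a l \<in> sets lebesgue"
      by measurable
    also have "{x \<in> space lebesgue. ennreal c < f x} \<inter> hcube a l = S" by (auto simp: S_def)
    finally have S_sets: "S \<in> sets lebesgue" .
    have "(\<integral>\<^sup>+x\<in>hcube a l. min (f x) (ennreal L) \<partial>weighted u) \<le>
      (\<integral>\<^sup>+x. ennreal L * indicator S x + ennreal c * indicator (hcube a l) x \<partial>weighted u)"
    proof (rule nn_integral_mono)
      fix x
      show "min (f x) (ennreal L) * indicator (hcube a l) x \<le>
          ennreal L * indicator S x + ennreal c * indicator (hcube a l) x"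
      proof (cases "x \<in> S")
        case True
        have "min (f x) (ennreal L) \<le> ennreal L + ennreal c"
          by (rule order_trans[OF min.cobounded2]) simp
        then show ?thesis using True by (simp add: S_def)
      next
        case False
        have "min (f x) (ennreal L) \<le> ennreal c" if "x \<in> hcube a l"
          using False that by (intro order_trans[OF min.cobounded1]) (simp add: S_def)
        then show ?thesis using False by (cases "x \<in> hcube a l") auto
      qed
    qed
    also have "\<dots> = ennreal L * ?U S + ennreal c * ?U (hcube a l)"
      using S_sets by (subst nn_integral_add) (simp_all add: nn_integral_cmult_indicator)
    also have "\<dots> = ennreal L * ?U ?S + ennreal (\<rho> powr (1/2) * L) * ?U (hcube a l)"
      unfolding S c_def ..
    also have "?U ?S \<le> ennreal (C * (\<rho> powr (-1/2)) powr - \<epsilon>) * ?U (hcube a l)"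
      using \<rho> L l avg by (intro decay) auto
    also have "(\<rho> powr (-1/2)) powr - \<epsilon> = \<rho> powr (\<epsilon>/2)" by (simp add: powr_powr)
    also have "ennreal L * (ennreal (C * \<rho> powr (\<epsilon>/2)) * ?U (hcube a l)) + ennreal (\<rho> powr (1/2) * L) * ?U (hcube a l)
      = ennreal (L * (C * \<rho> powr (\<epsilon>/2)) + \<rho> powr (1/2) * L) * ?U (hcube a l)"
      using L C by (simp add: ennreal_mult[symmetric] mult.assoc[symmetric] distrib_right[symmetric] ennreal_plus[symmetric] del: ennreal_plus)
    also have "\<dots> \<le> ennreal ((C + 1) * \<rho> powr \<epsilon>' * L) * ?U (hcube a l)"
    proof (intro mult_right_mono ennreal_leI)
      have "\<rho> powr (\<epsilon>/2) \<le> \<rho> powr \<epsilon>'" "\<rho> powr (1/2) \<le> \<rho> powr \<epsilon>'"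
        using \<rho> by (auto simp: \<epsilon>'_def intro!: powr_mono')
      then have "C * \<rho> powr (\<epsilon>/2) + \<rho> powr (1/2) \<le> C * \<rho> powr \<epsilon>' + \<rho> powr \<epsilon>'"
        using C by (intro add_mono mult_left_mono) auto
      then have "(C * \<rho> powr (\<epsilon>/2) + \<rho> powr (1/2)) * L \<le> (C * \<rho> powr \<epsilon>' + \<rho> powr \<epsilon>') * L"
        using L by (intro mult_right_mono) auto
      then show "L * (C * \<rho> powr (\<epsilon>/2)) + \<rho> powr (1/2) * L \<le> (C + 1) * \<rho> powr \<epsilon>' * L"
        by (simp add: algebra_simps)
    qed simp
    finally show "(\<integral>\<^sup>+x\<in>hcube a l. min (f x) (ennreal L) \<partial>weighted u)
         \<le> ennreal ((C + 1) * \<rho> powr \<epsilon>' * L) * ?U (hcube a l)"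
      by (auto simp: mult_left_mono add_mono)
  qed (use C in \<open>auto simp: \<epsilon>'_def\<close>)
qed

text \<open>
  The real value of \<open>w(Q)\<close>, meaningful where this is finite.
\<close>

definition wmass :: "(real ^ 'n \<Rightarrow> real) \<Rightarrow> real ^ 'n \<Rightarrow> real \<Rightarrow> real" where
  "wmass w a l = enn2real (emeasure (weighted w) (hcube a l))"

lemma weighted_pos:
  fixes a :: "real ^ 'n"
  assumes [measurable]: "w \<in> borel_measurable lebesgue" and pos: "\<And>x. 0 < w x" and l: "0 < l"
  shows "0 < emeasure (weighted w) (hcube a l)"
proof (rule ccontr)
  assume "\<not> 0 < emeasure (weighted w) (hcube a l)"
  then have "hcube a l \<in> null_sets (weighted w)" by auto
  then have "AE x in lebesgue. x \<in> hcube a l \<longrightarrow> w x \<le> 0"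
    using null_sets_density_iff[of "\<lambda>x. ennreal (w x)" lebesgue "hcube a l"] 
    by (simp add: ennreal_eq_0_iff)
  then have "AE x in lebesgue. x \<notin> hcube a l"
    by eventually_elim (use pos in \<open>auto simp: not_le[symmetric]\<close>)
  then have "emeasure lebesgue (hcube a l) = 0"
    by (simp add: AE_iff_null_sets null_setsD1)
  then have "l ^ CARD('n) \<le> 0" using l by (simp add: emeasure_hcube ennreal_eq_0_iff del: power_le_zero_eq)
  with zero_less_power[OF l, of "CARD('n)"] show False by linarith
qed

lemma A_inf_wmass:
  assumes "A_inf w" "0 < l"
  shows "emeasure (weighted w) (hcube a l) = ennreal (wmass w a l)" "0 < wmass w a l"
proof -
  note D = A_infD[OF assms(1)]
  have "0 < emeasure (weighted w) (hcube a l)" by (intro weighted_pos D assms)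
  with D(3)[OF assms(2), of a]
  show "emeasure (weighted w) (hcube a l) = ennreal (wmass w a l)" "0 < wmass w a l"
    by (auto simp: wmass_def enn2real_positive_iff)
qed

text \<open>
  A subcube of half the side fills the fraction \<open>2\<^sup>-\<^sup>n\<close>, so its complement is a thin subset.
\<close>

lemma A_inf_doubling:
  fixes w :: "real ^ 'n \<Rightarrow> real"
  assumes w: "A_inf w"
  obtains D where "1 \<le> D"
    "\<And>a b l. 0 < l \<Longrightarrow> hcube b l \<subseteq> hcube a (2 * l) \<Longrightarrow> wmass w a (2 * l) \<le> D * wmass w b l"
proof -
  define \<alpha> :: real where "\<alpha> = 1 - 1 / 2 ^ CARD('n)"
  have "(1::real) < 2 ^ CARD('n)" by simp
  then have \<alpha>: "0 < \<alpha>" "\<alpha> < 1" by (auto simp: \<alpha>_def)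
  obtain \<beta> where \<beta>: "0 < \<beta>" "\<beta> < 1"
    "\<And>a l E. 0 < l \<Longrightarrow> E \<in> sets lebesgue \<Longrightarrow> E \<subseteq> hcube a l \<Longrightarrow>
        emeasure lebesgue E \<le> ennreal \<alpha> * emeasure lebesgue (hcube a l) \<Longrightarrow>
        emeasure (weighted w) E \<le> ennreal \<beta> * emeasure (weighted w) (hcube a l)"
    by (rule A_inf_thin[OF w \<alpha>]) (rule that)
  show ?thesis
  proof (rule that[of "1 / (1 - \<beta>)"])
    show "1 \<le> 1 / (1 - \<beta>)" using \<beta> by simp
    fix a b :: "real ^ 'n" and l :: real
    assume l: "0 < l" and sub: "hcube b l \<subseteq> hcube a (2 * l)"
    have "emeasure lebesgue (hcube a (2 * l) - hcube b l)
        = emeasure lebesgue (hcube a (2 * l)) - emeasure lebesgue (hcube b l)"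
      using l sub by (intro emeasure_Diff) (auto simp: emeasure_hcube)
    also have "\<dots> = ennreal ((2 * l) ^ CARD('n) - l ^ CARD('n))"
      using l by (simp add: emeasure_hcube ennreal_minus)
    also have "(2 * l) ^ CARD('n) - l ^ CARD('n) = \<alpha> * (2 * l) ^ CARD('n)"
      by (simp add: \<alpha>_def left_diff_distrib power_mult_distrib)
    finally have "emeasure (weighted w) (hcube a (2 * l) - hcube b l)
        \<le> ennreal \<beta> * emeasure (weighted w) (hcube a (2 * l))"
      using l \<alpha> by (intro \<beta>(3)) (auto simp: emeasure_hcube ennreal_mult[symmetric])
    then have "emeasure (weighted w) (hcube a (2 * l))
        \<le> ennreal \<beta> * emeasure (weighted w) (hcube a (2 * l)) + emeasure (weighted w) (hcube b l)"
      using emeasure_subadditive[of "hcube a (2 * l) - hcube b l" "weighted w" "hcube b l"] sub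
      by (auto simp: Un_absorb2 intro: order_trans add_right_mono)
    then have "wmass w a (2 * l) \<le> \<beta> * wmass w a (2 * l) + wmass w b l"
      using l \<beta> A_inf_wmass[OF w, of "2 * l" a] A_inf_wmass[OF w, of l b]
      by (simp add: ennreal_mult[symmetric] ennreal_plus[symmetric] ennreal_le_iff del: ennreal_plus)
    then show "wmass w a (2 * l) \<le> 1 / (1 - \<beta>) * wmass w b l"
      using \<beta> by (simp add: field_simps)
  qed
qed

text \<open>
  A subcube of half the side is itself a thin subset, of fraction \<open>2\<^sup>-\<^sup>n \<le> 1/2\<close>.
\<close>

lemma A_inf_reverse_doubling:
  fixes w :: "real ^ 'n \<Rightarrow> real"
  assumes w: "A_inf w"
  obtains \<beta> where "0 < \<beta>" "\<beta> < 1"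
    "\<And>a b l. 0 < l \<Longrightarrow> hcube b l \<subseteq> hcube a (2 * l) \<Longrightarrow> wmass w b l \<le> \<beta> * wmass w a (2 * l)"
proof -
  have half_less: "1 / 2 < (1::real)" by simp
  obtain \<beta> where \<beta>: "0 < \<beta>" "\<beta> < 1"
    "\<And>a l E. 0 < l \<Longrightarrow> E \<in> sets lebesgue \<Longrightarrow> E \<subseteq> hcube a l \<Longrightarrow>
        emeasure lebesgue E \<le> ennreal (1/2) * emeasure lebesgue (hcube a l) \<Longrightarrow>
        emeasure (weighted w) E \<le> ennreal \<beta> * emeasure (weighted w) (hcube a l)"
    by (rule A_inf_thin[OF w half_gt_zero[OF zero_less_one] half_less]) (rule that)
  show ?thesis
  proof (rule that[OF \<beta>(1,2)])
    fix a b :: "real ^ 'n" and l :: real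
    assume l: "0 < l" and sub: "hcube b l \<subseteq> hcube a (2 * l)"
    have "(2::real) ^ 1 \<le> 2 ^ CARD('n)" by (intro power_increasing) auto
    then have "l ^ CARD('n) \<le> 1/2 * (2 * l) ^ CARD('n)"
      using l by (simp add: power_mult_distrib)
    then have "ennreal (l ^ CARD('n)) \<le> ennreal (1/2) * ennreal ((2 * l) ^ CARD('n))"
      using l by (subst ennreal_mult[symmetric]) (auto intro: ennreal_leI)
    then have "emeasure (weighted w) (hcube b l) \<le> ennreal \<beta> * emeasure (weighted w) (hcube a (2 * l))"
      using l sub by (intro \<beta>(3)) (simp_all only: emeasure_hcube hcube_lebesgue)
    then show "wmass w b l \<le> \<beta> * wmass w a (2 * l)"
      using l \<beta> A_inf_wmass[OF w, of "2 * l" a] A_inf_wmass[OF w, of l b]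
      by (simp add: ennreal_mult[symmetric] ennreal_le_iff)
  qed
qed

lemma powr_le_dyadic_sum:
  fixes y e :: real
  assumes "0 < e" "0 \<le> y"
  shows "ennreal (y powr e) \<le> 1 + (\<Sum>j. ennreal (2 powr (e * (j + 1))) * indicator {y. 2 ^ j < y} y)"
proof (cases "y \<le> 1")
  case True
  then have "y powr e \<le> 1" using assms by (auto intro: powr_le1)
  then have "ennreal (y powr e) \<le> 1" using ennreal_leI by fastforce
  then show ?thesis by (rule add_increasing2[rotated]) simp
next
  case False
  define j where "j = nat (\<lceil>log 2 y\<rceil> - 1)"
  have "0 < log 2 y" using False by simp
  then have j: "real j < log 2 y" "log 2 y \<le> real j + 1" unfolding j_def by linarith+
  have "2 ^ j < y" using j(1) False by (simp add: powr_realpow[symmetric] less_log_iff)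
  have "y = 2 powr (log 2 y)" using False by simp
  also have "\<dots> \<le> 2 powr (real j + 1)" using j by simp
  finally have "y powr e \<le> (2 powr (real j + 1)) powr e" using assms by (intro powr_mono2) auto
  also have "(2 powr (real j + 1)) powr e = 2 powr (e * real (j + 1))" by (simp add: powr_powr ac_simps)
  finally have "y powr e \<le> 2 powr (e * real (j + 1))" .
  then have "ennreal (y powr e) \<le> ennreal (2 powr (e * real (j + 1))) * indicator {y. 2 ^ j < y} y"
    using \<open>2 ^ j < y\<close> by (simp add: ennreal_leI add.commute)
  also have "\<dots> \<le> (\<Sum>j. ennreal (2 powr (e * (j + 1))) * indicator {y. 2 ^ j < y} y)"
  proof -
    define g where "g = (\<lambda>j. ennreal (2 powr (e * real (j + 1))) * indicator {y. 2 ^ j < y} y)"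
    have "sum g {j} \<le> suminf g" by (rule sum_le_suminf) auto
    then have "g j \<le> suminf g" by simp
    then show ?thesis unfolding g_def .
  qed
  finally show ?thesis by (rule add_increasing[rotated]) simp
qed

text \<open>
  The layer-cake formula over the levels \<open>2\<^sup>j L\<close>, with the decay of \<open>w\<close> with respect to its own measure.
  The normalisation by any \<open>L\<close> above the average, in place of the average, is the form needed for
  \<open>L = (M\<^sub>\<eta> v(x))\<^sup>q\<close>.
\<close>

lemma A_inf_reverse_Hoelder:
  fixes w :: "real ^ 'n \<Rightarrow> real"
  assumes w: "A_inf w"
  obtains C e where "0 < C" "0 < e"
    "\<And>a l L. 0 < l \<Longrightarrow> 0 < L \<Longrightarrow>
       emeasure (weighted w) (hcube a l) \<le> ennreal L * emeasure lebesgue (hcube a l) \<Longrightarrow>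
       (\<integral>\<^sup>+x\<in>hcube a l. ennreal ((w x / L) powr (1 + e)) \<partial>lebesgue) \<le> ennreal C * emeasure lebesgue (hcube a l)"
proof -
  obtain C \<epsilon> where C: "0 < C" "0 < \<epsilon>"
    and decay: "\<And>f a l t s. f \<in> borel_measurable lebesgue \<Longrightarrow> 0 < l \<Longrightarrow> 0 < t \<Longrightarrow> 0 < s \<Longrightarrow>
       emeasure (density lebesgue f) (hcube a l) \<le> ennreal t * emeasure lebesgue (hcube a l) \<Longrightarrow>
       emeasure (weighted w) {x \<in> hcube a l. ennreal (s * t) < f x}
         \<le> ennreal (C * s powr - \<epsilon>) * emeasure (weighted w) (hcube a l)"
    by (rule A_inf_decay[OF w]) (rule that)
  note [measurable] = A_infD(1)[OF w]
  note wpos = A_infD(2)[OF w]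
  define e where "e = \<epsilon> / 2"
  have e: "0 < e" "\<epsilon> = 2 * e" using C by (auto simp: e_def)
  define \<theta> :: real where "\<theta> = 2 powr - e"
  have \<theta>: "0 < \<theta>" "\<theta> < 1" using e by (auto simp: \<theta>_def powr_less_one)
  define C' where "C' = 1 + C * 2 powr e / (1 - \<theta>)"
  show ?thesis
  proof (rule that[of C' e])
    show "0 < C'" using C \<theta> unfolding C'_def by (intro add_pos_nonneg divide_nonneg_pos) auto
    show "0 < e" by fact
    fix a :: "real ^ 'n" and l L :: real
    assume l: "0 < l" and L: "0 < L"
      and avg: "emeasure (weighted w) (hcube a l) \<le> ennreal L * emeasure lebesgue (hcube a l)"
    let ?W = "emeasure (weighted w)"
    define S where "S = (\<lambda>j::nat. {x \<in> hcube a l. ennreal (2 ^ j * L) < ennreal (w x)})"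
    have S_sets: "S j \<in> sets lebesgue" for j
    proof -
      have "{x \<in> space lebesgue. ennreal (2 ^ j * L) < ennreal (w x)} \<inter> hcube a l \<in> sets lebesgue"
        by measurable
      also have "{x \<in> space lebesgue. ennreal (2 ^ j * L) < ennreal (w x)} \<inter> hcube a l = S j"
        by (auto simp: S_def)
      finally show ?thesis .
    qed
    have S_mem: "x \<in> S j \<longleftrightarrow> x \<in> hcube a l \<and> 2 ^ j < w x / L" for x j
      using L wpos[of x] by (simp add: S_def ennreal_less_iff pos_less_divide_eq)
    have "(\<integral>\<^sup>+x\<in>hcube a l. ennreal ((w x / L) powr (1 + e)) \<partial>lebesgue)
      = (\<integral>\<^sup>+x. ennreal (w x) * (ennreal (1 / L) * (ennreal ((w x / L) powr e) * indicator (hcube a l) x)) \<partial>lebesgue)"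
    proof (rule nn_integral_cong)
      fix x
      have "(w x / L) powr (1 + e) = w x * (1 / L * (w x / L) powr e)"
        using wpos[of x] L by (simp add: powr_add)
      then show "ennreal ((w x / L) powr (1 + e)) * indicator (hcube a l) x =
          ennreal (w x) * (ennreal (1 / L) * (ennreal ((w x / L) powr e) * indicator (hcube a l) x))"
        using wpos[of x] L by (simp add: ennreal_mult'[symmetric] mult.assoc[symmetric] less_imp_le)
    qed
    also have "\<dots> = (\<integral>\<^sup>+x. ennreal (1 / L) * (ennreal ((w x / L) powr e) * indicator (hcube a l) x) \<partial>weighted w)"
      by (subst nn_integral_density) auto
    also have "\<dots> = ennreal (1 / L) * (\<integral>\<^sup>+x. ennreal ((w x / L) powr e) * indicator (hcube a l) x \<partial>weighted w)"
      by (rule nn_integral_cmult) auto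
    also have "(\<integral>\<^sup>+x. ennreal ((w x / L) powr e) * indicator (hcube a l) x \<partial>weighted w)
       \<le> (\<integral>\<^sup>+x. indicator (hcube a l) x + (\<Sum>j. ennreal (2 powr (e * (j + 1))) * indicator (S j) x) \<partial>weighted w)"
    proof (rule nn_integral_mono)
      fix x
      show "ennreal ((w x / L) powr e) * indicator (hcube a l) x
         \<le> indicator (hcube a l) x + (\<Sum>j. ennreal (2 powr (e * (j + 1))) * indicator (S j) x)"
      proof (cases "x \<in> hcube a l")
        case True
        have "indicator (S j) x = (indicator {y. 2 ^ j < y} (w x / L) :: ennreal)" for j
          using True by (simp add: S_mem indicator_def)
        then show ?thesis
          using powr_le_dyadic_sum[of e "w x / L"] e L wpos[of x] True by (simp add: less_imp_le)
      qed simp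
    qed
    also have "\<dots> = ?W (hcube a l) + (\<Sum>j. ennreal (2 powr (e * (j + 1))) * ?W (S j))"
      using S_sets by (simp add: nn_integral_add nn_integral_suminf nn_integral_cmult_indicator)
    also have "\<dots> \<le> ?W (hcube a l) + (\<Sum>j. ennreal (C * 2 powr e * \<theta> ^ j) * ?W (hcube a l))"
    proof (intro add_left_mono suminf_le)
      fix j :: nat
      have "?W (S j) \<le> ennreal (C * (2 ^ j) powr - \<epsilon>) * ?W (hcube a l)"
        unfolding S_def using l L avg by (intro decay) auto
      then have "ennreal (2 powr (e * (j + 1))) * ?W (S j) \<le>
          ennreal (2 powr (e * (j + 1))) * (ennreal (C * (2 ^ j) powr - \<epsilon>) * ?W (hcube a l))"
        by (intro mult_left_mono) auto
      also have "\<dots> = ennreal (2 powr (e * (j + 1)) * (C * (2 ^ j) powr - \<epsilon>)) * ?W (hcube a l)"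
        using C by (simp add: ennreal_mult mult.assoc)
      also have "2 powr (e * (j + 1)) * (C * (2 ^ j) powr - \<epsilon>) = C * 2 powr e * \<theta> ^ j"
      proof -
        have "2 powr (e * (j + 1)) * ((2 ^ j) powr - \<epsilon>) = 2 powr (e * (j + 1) + j * (- \<epsilon>))"
          by (simp add: powr_realpow[symmetric] powr_powr powr_add[symmetric])
        also have "\<dots> = 2 powr e * \<theta> ^ j"
          unfolding \<theta>_def e(2) by (simp add: powr_realpow[symmetric] powr_powr powr_add[symmetric] algebra_simps)
        finally show ?thesis by (simp add: algebra_simps)
      qed
      finally show "ennreal (2 powr (e * (j + 1))) * ?W (S j) \<le> ennreal (C * 2 powr e * \<theta> ^ j) * ?W (hcube a l)" .
    qed auto
    also have "(\<Sum>j. ennreal (C * 2 powr e * \<theta> ^ j) * ?W (hcube a l)) = (\<Sum>j. ennreal (C * 2 powr e * \<theta> ^ j)) * ?W (hcube a l)"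
      by (rule ennreal_suminf_multc)
    also have "(\<Sum>j. ennreal (C * 2 powr e * \<theta> ^ j)) = ennreal (C * 2 powr e / (1 - \<theta>))"
    proof -
      have "(\<lambda>j. C * 2 powr e * \<theta> ^ j) sums (C * 2 powr e * (1 / (1 - \<theta>)))"
        using \<theta> by (intro sums_mult geometric_sums) auto
      then show ?thesis using C \<theta> by (subst suminf_ennreal_eq) auto
    qed
    also have "?W (hcube a l) + ennreal (C * 2 powr e / (1 - \<theta>)) * ?W (hcube a l) = ennreal C' * ?W (hcube a l)"
      using C \<theta> unfolding C'_def by (subst ennreal_plus) (auto simp: distrib_right)
    also have "ennreal (1 / L) * (ennreal C' * ?W (hcube a l)) \<le> ennreal (1 / L) * (ennreal C' * (ennreal L * emeasure lebesgue (hcube a l)))"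
      by (intro mult_left_mono avg) auto
    also have "\<dots> = ennreal (1 / L * C' * L) * emeasure lebesgue (hcube a l)"
      using ennreal_mult[of "1 / L * C'" L] ennreal_mult[of "1 / L" C'] L \<open>0 < C'\<close>
      by (simp only: mult.assoc less_imp_le zero_le_divide_1_iff mult_nonneg_nonneg)
    also have "1 / L * C' * L = C'" using L by simp
    finally show "(\<integral>\<^sup>+x\<in>hcube a l. ennreal ((w x / L) powr (1 + e)) \<partial>lebesgue) \<le> ennreal C' * emeasure lebesgue (hcube a l)"
      by (simp add: mult_left_mono)
  qed
qed

section \<open>Muckenhoupt weights\<close>

text \<open>
  A representative that is positive everywhere, so that powers and quotients obey their usual laws at
  every point.
\<close>

definition positive_version :: "('a \<Rightarrow> real) \<Rightarrow> 'a \<Rightarrow> real" where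
  "positive_version w x = (if 0 < w x then w x else 1)"

text \<open>
  If \<open>w\<close> is far below its average only on a small part of each cube, then a set \<open>S\<close> of relative
  measure at least \<open>1 - \<alpha>\<close> carries a fixed fraction of \<open>w(Q)\<close>, which is thus missing from the complement
  of \<open>S\<close>. This hypothesis is the common consequence of \<open>A\<^sub>1\<close> and \<open>A\<^sub>s\<close>.
\<close>

lemma A_inf_if_level_sets_small:
  fixes w :: "real ^ 'n \<Rightarrow> real"
  assumes w[measurable]: "w \<in> borel_measurable lebesgue" and pos: "\<And>x. 0 < w x"
    and fin: "\<And>a l. 0 < l \<Longrightarrow> emeasure (weighted w) (hcube a l) < \<infinity>"
    and small: "\<And>\<kappa>. 0 < \<kappa> \<Longrightarrow> \<kappa> < 1 \<Longrightarrow> \<exists>\<zeta>>0. \<forall>a l. 0 < l \<longrightarrow>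
      emeasure lebesgue {x \<in> hcube a l. w x * l ^ CARD('n) < \<zeta> * wmass w a l} \<le> ennreal (\<kappa> * l ^ CARD('n))"
  shows "A_inf w"
  unfolding A_inf_def
proof (intro conjI allI impI)
  fix \<alpha> :: real assume \<alpha>: "0 < \<alpha>" "\<alpha> < 1"
  define \<kappa> where "\<kappa> = (1 - \<alpha>) / 2"
  have \<kappa>: "0 < \<kappa>" "\<kappa> < 1" using \<alpha> by (auto simp: \<kappa>_def)
  obtain \<zeta> where \<zeta>: "0 < \<zeta>"
    and bad: "\<And>a l. 0 < l \<Longrightarrow> emeasure lebesgue {x \<in> hcube a l. w x * l ^ CARD('n) < \<zeta> * wmass w a l} \<le> ennreal (\<kappa> * l ^ CARD('n))"
    using small[OF \<kappa>] by blast
  have "emeasure (weighted w) E \<le> ennreal (max (1 - \<zeta> * \<kappa>) (1/2)) * emeasure (weighted w) (hcube a l)"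
    if l: "0 < l" and E[measurable]: "E \<in> sets lebesgue" and sub: "E \<subseteq> hcube a l"
      and thin: "emeasure lebesgue E \<le> ennreal \<alpha> * emeasure lebesgue (hcube a l)" for a l E
  proof -
    define V where "V = l ^ CARD('n)"
    have V: "0 < V" using l by (simp add: V_def)
    define W where "W = wmass w a l"
    have W: "emeasure (weighted w) (hcube a l) = ennreal W" "0 < W"
      using fin[OF l, of a] weighted_pos[OF w pos l, of a] by (auto simp: W_def wmass_def enn2real_positive_iff)
    define B where "B = {x \<in> hcube a l. w x * V < \<zeta> * W}"
    have "{x \<in> space lebesgue. w x * V < \<zeta> * W} \<inter> hcube a l \<in> sets lebesgue" by measurable
    also have "{x \<in> space lebesgue. w x * V < \<zeta> * W} \<inter> hcube a l = B" by (auto simp: B_def)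
    finally have B[measurable]: "B \<in> sets lebesgue" .
    have B_le: "emeasure lebesgue B \<le> ennreal (\<kappa> * V)" unfolding B_def V_def W_def by (rule bad[OF l])
    define S where "S = hcube a l - E - B"
    have S[measurable]: "S \<in> sets lebesgue" by (simp add: S_def)
    have E_le: "emeasure lebesgue E \<le> ennreal (\<alpha> * V)"
      using thin l \<alpha> by (simp add: emeasure_hcube V_def ennreal_mult)
    have "ennreal V = emeasure lebesgue (hcube a l)" using l by (simp add: emeasure_hcube V_def)
    also have "\<dots> \<le> emeasure lebesgue (E \<union> B \<union> S)"
      by (intro emeasure_mono) (auto simp: S_def)
    also have "\<dots> \<le> emeasure lebesgue E + emeasure lebesgue B + emeasure lebesgue S"
      by (intro order_trans[OF emeasure_subadditive] add_right_mono emeasure_subadditive) auto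
    also have "\<dots> \<le> ennreal (\<alpha> * V) + ennreal (\<kappa> * V) + emeasure lebesgue S"
      by (intro add_mono E_le B_le order_refl)
    finally have "ennreal V \<le> ennreal ((\<alpha> + \<kappa>) * V) + emeasure lebesgue S"
      using \<alpha> \<kappa> V by (simp add: distrib_right)
    moreover have "emeasure lebesgue S < \<infinity>"
      by (rule le_less_trans[OF emeasure_mono[of S "hcube a l"]]) (use l in \<open>auto simp: S_def emeasure_hcube\<close>)
    then obtain m where m: "emeasure lebesgue S = ennreal m" "0 \<le> m" by (cases "emeasure lebesgue S") auto
    ultimately have "V \<le> (\<alpha> + \<kappa>) * V + m"
      using \<alpha> \<kappa> V by (simp add: ennreal_plus[symmetric] ennreal_le_iff del: ennreal_plus)
    then have m_ge: "\<kappa> * V \<le> m" by (simp add: \<kappa>_def field_simps)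
    have "ennreal (\<zeta> * W / V) * emeasure lebesgue S = (\<integral>\<^sup>+x. ennreal (\<zeta> * W / V) * indicator S x \<partial>lebesgue)"
      by (simp add: nn_integral_cmult_indicator)
    also have "\<dots> \<le> (\<integral>\<^sup>+x. ennreal (w x) * indicator S x \<partial>lebesgue)"
    proof (rule nn_integral_mono)
      fix x
      show "ennreal (\<zeta> * W / V) * indicator S x \<le> ennreal (w x) * indicator S x"
        using V by (cases "x \<in> S") (auto simp: S_def B_def not_less divide_le_eq intro!: ennreal_leI)
    qed
    also have "\<dots> = emeasure (weighted w) S" by (simp add: emeasure_density)
    finally have S_mass: "ennreal (\<zeta> * W / V * m) \<le> emeasure (weighted w) S"
      using m \<zeta> W V ennreal_mult[of "\<zeta> * W / V" m] by simp
    have "\<zeta> * \<kappa> * W = \<zeta> * W / V * (\<kappa> * V)" using V by simp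
    also have "\<dots> \<le> \<zeta> * W / V * m" using m_ge \<zeta> W V by (intro mult_left_mono) auto
    finally have "ennreal (\<zeta> * \<kappa> * W) \<le> emeasure (weighted w) S"
      using S_mass by (meson ennreal_leI order_trans)
    then have "emeasure (weighted w) E + ennreal (\<zeta> * \<kappa> * W) \<le> emeasure (weighted w) E + emeasure (weighted w) S"
      by (intro add_left_mono)
    also have "\<dots> = emeasure (weighted w) (E \<union> S)"
      by (intro plus_emeasure) (auto simp: S_def)
    also have "\<dots> \<le> ennreal W"
      unfolding W(1)[symmetric] using sub by (intro emeasure_mono) (auto simp: S_def)
    finally have le: "emeasure (weighted w) E + ennreal (\<zeta> * \<kappa> * W) \<le> ennreal W" .
    have "emeasure (weighted w) E < \<infinity>"
      using order_trans[OF add_increasing2[OF zero_le order_refl] le] by (auto intro: le_less_trans)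
    then obtain e where e: "emeasure (weighted w) E = ennreal e" "0 \<le> e"
      by (cases "emeasure (weighted w) E") auto
    then have "e + \<zeta> * \<kappa> * W \<le> W"
      using le \<zeta> \<kappa> W by (simp add: ennreal_plus[symmetric] ennreal_le_iff del: ennreal_plus)
    then have "e \<le> (1 - \<zeta> * \<kappa>) * W" by (simp add: algebra_simps)
    also have "\<dots> \<le> max (1 - \<zeta> * \<kappa>) (1/2) * W" using W by (intro mult_right_mono) auto
    finally show ?thesis unfolding e W using W by (simp add: ennreal_mult[symmetric] ennreal_leI)
  qed
  then show "\<exists>\<beta>>0. \<beta> < 1 \<and> (\<forall>a l E. 0 < l \<longrightarrow> E \<in> sets lebesgue \<longrightarrow> E \<subseteq> hcube a l \<longrightarrow>
        emeasure lebesgue E \<le> ennreal \<alpha> * emeasure lebesgue (hcube a l) \<longrightarrow>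
        emeasure (weighted w) E \<le> ennreal \<beta> * emeasure (weighted w) (hcube a l))"
    using \<zeta> \<kappa> by (intro exI[of _ "max (1 - \<zeta> * \<kappa>) (1/2)"]) auto
qed (use assms in auto)

lemma locally_integrable_measurable:
  fixes w :: "real ^ 'n \<Rightarrow> real"
  assumes "locally_integrable w"
  shows "w \<in> borel_measurable lebesgue"
proof (rule borel_measurable_LIMSEQ_real)
  show "(\<lambda>x. indicator (cball 0 (real k)) x *\<^sub>R w x) \<in> borel_measurable lebesgue" for k :: nat
    using assms unfolding locally_integrable_def set_integrable_def
    by (auto dest!: spec[of _ "cball 0 (real k)"])
  show "(\<lambda>k. indicator (cball 0 (real k)) x *\<^sub>R w x) \<longlonglongrightarrow> w x" for x
  proof (rule tendsto_eventually)
    obtain k0 :: nat where "norm x \<le> real k0" using real_arch_simple by blast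
    then show "\<forall>\<^sub>F k in sequentially. indicator (cball 0 (real k)) x *\<^sub>R w x = w x"
      by (intro eventually_sequentiallyI[of k0]) (auto simp: indicator_def)
  qed
qed

text \<open>
  Passing to half-open cubes and to the positive representative does not change masses.
\<close>

lemma weightD:
  fixes w :: "real ^ 'n \<Rightarrow> real"
  assumes "weight w"
  defines "w' \<equiv> positive_version w"
  shows "w' \<in> borel_measurable lebesgue" "\<And>x. 0 < w' x" "AE x in lebesgue. w' x = w x"
    "\<And>a l. emeasure (weighted w') (hcube a l) < \<infinity>"
    "\<And>a l. mass w (cbox a (\<chi> i. a $ i + l)) = emeasure (weighted w') (hcube a l)"
proof -
  have li: "locally_integrable w" and pos: "AE x in lebesgue. 0 < w x"
    using assms by (auto simp: weight_def)
  have w[measurable]: "w \<in> borel_measurable lebesgue" by (rule locally_integrable_measurable[OF li])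
  show w'[measurable]: "w' \<in> borel_measurable lebesgue" unfolding w'_def positive_version_def by measurable
  show "\<And>x. 0 < w' x" by (simp add: w'_def positive_version_def)
  show eq: "AE x in lebesgue. w' x = w x"
    using pos by eventually_elim (simp add: w'_def positive_version_def)
  show mass: "mass w (cbox a (\<chi> i. a $ i + l)) = emeasure (weighted w') (hcube a l)" for a l
  proof -
    have "mass w (cbox a (\<chi> i. a $ i + l)) = (\<integral>\<^sup>+x. ennreal (w' x) * indicator (hcube a l) x \<partial>lebesgue)"
      unfolding mass_def
    proof (rule nn_integral_cong_AE)
      show "AE x in lebesgue. ennreal (w x) * indicator (cbox a (\<chi> i. a $ i + l)) x =
          ennreal (w' x) * indicator (hcube a l) x"
        using eq AE_hcube_eq_cbox[of a l] by eventually_elim (auto simp: indicator_def)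
    qed
    then show ?thesis by (simp add: emeasure_density)
  qed
  show "emeasure (weighted w') (hcube a l) < \<infinity>" for a l
  proof -
    have "integrable lebesgue (\<lambda>x. indicator (cbox a (\<chi> i. a $ i + l)) x *\<^sub>R w x)"
      using li by (auto simp: locally_integrable_def set_integrable_def)
    then have "(\<integral>\<^sup>+x. ennreal (norm (indicator (cbox a (\<chi> i. a $ i + l)) x *\<^sub>R w x)) \<partial>lebesgue) < \<infinity>"
      by (simp add: integrable_iff_bounded)
    moreover have "mass w (cbox a (\<chi> i. a $ i + l)) \<le>
        (\<integral>\<^sup>+x. ennreal (norm (indicator (cbox a (\<chi> i. a $ i + l)) x *\<^sub>R w x)) \<partial>lebesgue)"
      unfolding mass_def by (intro nn_integral_mono) (auto simp: indicator_def intro!: ennreal_leI)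
    ultimately show ?thesis unfolding mass[symmetric] by (rule le_less_trans[rotated])
  qed
qed

lemma average_eq:
  fixes w :: "real ^ 'n \<Rightarrow> real"
  assumes "weight w" "0 < l"
  shows "average (cbox a (\<chi> i. a $ i + l)) w = ennreal (wmass (positive_version w) a l / l ^ CARD('n))"
    "0 < wmass (positive_version w) a l"
proof -
  note W = weightD[OF assms(1)]
  have fin: "emeasure (weighted (positive_version w)) (hcube a l) = ennreal (wmass (positive_version w) a l)"
    "0 \<le> wmass (positive_version w) a l"
    using W(4)[of a l] by (simp_all add: wmass_def)
  then show "average (cbox a (\<chi> i. a $ i + l)) w = ennreal (wmass (positive_version w) a l / l ^ CARD('n))"
    unfolding average_def using assms(2)
    by (simp add: W(5) emeasure_cube divide_ennreal)
  show "0 < wmass (positive_version w) a l"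
    using weighted_pos[OF W(1,2) assms(2), of a] W(4)[of a l] by (simp add: wmass_def enn2real_positive_iff)
qed

text \<open>
  The essential infimum is a supremum of lower bounds and need not be attained by construction; the
  factor \<open>2\<close> leaves room for choosing one of these bounds.
\<close>

lemma muckenhoupt_one_bound:
  fixes w :: "real ^ 'n \<Rightarrow> real"
  assumes "muckenhoupt_one w"
  obtains C where "0 < C"
    "\<And>a l. 0 < l \<Longrightarrow> AE x in lebesgue. x \<in> hcube a l \<longrightarrow>
       wmass (positive_version w) a l / l ^ CARD('n) \<le> C * positive_version w x"
proof -
  from assms obtain C where w: "weight w" and C: "0 < C"
    and A1: "\<And>Q. cube Q \<Longrightarrow> average Q w \<le> ennreal C * essinf_on Q w"
    by (auto simp: muckenhoupt_one_def)
  note W = weightD[OF w]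
  show ?thesis
  proof (rule that[of "2 * C"])
    show "0 < 2 * C" using C by simp
    fix a :: "real ^ 'n" and l :: real assume l: "0 < l"
    define A where "A = wmass (positive_version w) a l / l ^ CARD('n)"
    have A: "0 < A" using average_eq(2)[OF w l] l by (simp add: A_def)
    let ?Q = "cbox a (\<chi> i. a $ i + l)"
    have "ennreal A \<le> ennreal C * essinf_on ?Q w"
      using A1[of ?Q] average_eq(1)[OF w l, of a] l unfolding cube_def A_def by auto
    have "ennreal (A / (2 * C)) < essinf_on ?Q w"
    proof (rule ccontr)
      assume "\<not> ennreal (A / (2 * C)) < essinf_on ?Q w"
      then have "ennreal C * essinf_on ?Q w \<le> ennreal C * ennreal (A / (2 * C))"
        by (intro mult_left_mono) auto
      with \<open>ennreal A \<le> _\<close> have "ennreal A \<le> ennreal (C * (A / (2 * C)))"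
        using C A by (subst ennreal_mult) auto
      then show False using A C by (simp add: ennreal_le_iff)
    qed
    then obtain c where c: "ennreal (A / (2 * C)) < c" "AE x in lebesgue. x \<in> ?Q \<longrightarrow> c \<le> ennreal (w x)"
      unfolding essinf_on_def less_Sup_iff by blast
    show "AE x in lebesgue. x \<in> hcube a l \<longrightarrow> wmass (positive_version w) a l / l ^ CARD('n) \<le> 2 * C * positive_version w x"
      using c(2) W(3)
    proof eventually_elim
      case (elim x)
      show ?case
      proof
        assume "x \<in> hcube a l"
        then have "ennreal (A / (2 * C)) < ennreal (positive_version w x)"
          using hcube_sandwich(2)[of a l] elim c(1) by (auto intro: less_le_trans)
        then have "A / (2 * C) < positive_version w x" using A C by (simp add: ennreal_less_iff)
        then show "wmass (positive_version w) a l / l ^ CARD('n) \<le> 2 * C * positive_version w x"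
          using C unfolding A_def[symmetric] by (simp add: field_simps)
      qed
    qed
  qed
qed

lemma A_inf_if_muckenhoupt_one:
  fixes w :: "real ^ 'n \<Rightarrow> real"
  assumes "muckenhoupt_one w"
  shows "A_inf (positive_version w)"
proof -
  have w: "weight w" using assms by (simp add: muckenhoupt_one_def)
  obtain C where C: "0 < C" "\<And>a l. 0 < l \<Longrightarrow> AE x in lebesgue. x \<in> hcube a l \<longrightarrow>
       wmass (positive_version w) a l / l ^ CARD('n) \<le> C * positive_version w x"
    by (rule muckenhoupt_one_bound[OF assms]) (rule that)
  note W = weightD[OF w]
  show ?thesis
  proof (rule A_inf_if_level_sets_small[OF W(1,2,4)])
    fix \<kappa> :: real assume "0 < \<kappa>"
    have "emeasure lebesgue {x \<in> hcube a l. positive_version w x * l ^ CARD('n) < 1 / C * wmass (positive_version w) a l} = 0"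
      if l: "0 < l" for a :: "real ^ 'n" and l
    proof -
      have "AE x in lebesgue. \<not> (x \<in> hcube a l \<and> positive_version w x * l ^ CARD('n) < 1 / C * wmass (positive_version w) a l)"
        using C(2)[OF l, of a] by eventually_elim (use C l in \<open>auto simp: field_simps\<close>)
      from emeasure_eq_0_AE[OF this] show ?thesis by simp
    qed
    then show "\<exists>\<zeta>>0. \<forall>a l. 0 < l \<longrightarrow> emeasure lebesgue
        {x \<in> hcube a l. positive_version w x * l ^ CARD('n) < \<zeta> * wmass (positive_version w) a l} \<le> ennreal (\<kappa> * l ^ CARD('n))"
      using C by (intro exI[of _ "1 / C"]) auto
  qed
qed

text \<open>
  Chebyshev's inequality for \<open>w\<^sup>-\<^sup>\<tau>\<close> with \<open>\<tau> = s' - 1 = 1/(s - 1)\<close>: the \<open>A\<^sub>s\<close> condition bounds the average of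
  \<open>w\<^sup>-\<^sup>\<tau>\<close>, so \<open>w\<close> cannot be small on a large part of a cube.
\<close>

lemma A_inf_if_muckenhoupt:
  fixes w :: "real ^ 'n \<Rightarrow> real"
  assumes "1 < s" "muckenhoupt s w"
  shows "A_inf (positive_version w)"
proof -
  define \<tau> where "\<tau> = 1 / (s - 1)"
  have \<tau>: "0 < \<tau>" "\<tau> * (s - 1) = 1" "1 - s / (s - 1) = - \<tau>"
    using assms(1) by (auto simp: \<tau>_def field_simps)
  from assms(2) obtain C where w: "weight w" and C: "0 < C"
    and As: "\<And>Q. cube Q \<Longrightarrow> average Q w * extend_infinity (\<lambda>a. a powr (s - 1)) (average Q (\<lambda>x. w x powr - \<tau>)) \<le> ennreal C"
    by (auto simp: muckenhoupt_def Let_def \<tau>)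
  note W = weightD[OF w]
  note [measurable] = W(1)
  let ?w = "positive_version w"
  show ?thesis
  proof (rule A_inf_if_level_sets_small[OF W(1,2,4)])
    fix \<kappa> :: real assume \<kappa>: "0 < \<kappa>"
    define \<zeta> where "\<zeta> = \<kappa> powr (s - 1) / C"
    have \<zeta>: "0 < \<zeta>" using \<kappa> C by (simp add: \<zeta>_def)
    have "emeasure lebesgue {x \<in> hcube a l. ?w x * l ^ CARD('n) < \<zeta> * wmass ?w a l} \<le> ennreal (\<kappa> * l ^ CARD('n))"
      if l: "0 < l" for a :: "real ^ 'n" and l
    proof -
      let ?Q = "cbox a (\<chi> i. a $ i + l)"
      define V where "V = l ^ CARD('n)"
      have V: "0 < V" using l by (simp add: V_def)
      define X where "X = wmass ?w a l / V"
      have X: "0 < X" "average ?Q w = ennreal X"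
        using average_eq[OF w l, of a] V by (auto simp: X_def V_def)
      have eQ: "emeasure lebesgue ?Q = ennreal V"
        using l by (simp add: emeasure_cube V_def)
      define J where "J = mass (\<lambda>x. w x powr - \<tau>) ?Q"
      have J: "J = (\<integral>\<^sup>+x. ennreal (?w x powr - \<tau>) * indicator (hcube a l) x \<partial>lebesgue)"
        unfolding J_def mass_def
      proof (rule nn_integral_cong_AE)
        show "AE x in lebesgue. ennreal (w x powr - \<tau>) * indicator ?Q x =
            ennreal (?w x powr - \<tau>) * indicator (hcube a l) x"
          using W(3) AE_hcube_eq_cbox[of a l] by eventually_elim (auto simp: indicator_def)
      qed
      define Y where "Y = average ?Q (\<lambda>x. w x powr - \<tau>)"
      have Y: "Y = J / ennreal V" by (simp add: Y_def average_def J_def eQ)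
      have le: "ennreal X * extend_infinity (\<lambda>a. a powr (s - 1)) Y \<le> ennreal C"
        using As[of ?Q] l unfolding X Y_def cube_def by auto
      have "Y \<noteq> \<infinity>"
      proof
        assume "Y = \<infinity>"
        then show False using le X by (simp add: extend_infinity_def ennreal_mult_top top_unique)
      qed
      then obtain y where y: "Y = ennreal y" "0 \<le> y" by (cases Y) auto
      have Xy: "X * y powr (s - 1) \<le> C"
        using le X y C by (simp add: extend_infinity_def ennreal_mult[symmetric] ennreal_le_iff)
      have Jy: "J = ennreal (V * y)"
      proof -
        have "J = J / ennreal V * ennreal V"
          using V by (simp add: ennreal_divide_times mult_divide_eq_ennreal)
        then show ?thesis using y V unfolding Y[symmetric] by (simp add: ennreal_mult mult.commute)
      qed
      define B where "B = {x \<in> hcube a l. ?w x * V < \<zeta> * wmass ?w a l}"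
      have "{x \<in> space lebesgue. ?w x * V < \<zeta> * wmass ?w a l} \<inter> hcube a l \<in> sets lebesgue" by measurable
      also have "{x \<in> space lebesgue. ?w x * V < \<zeta> * wmass ?w a l} \<inter> hcube a l = B" by (auto simp: B_def)
      finally have B: "B \<in> sets lebesgue" .
      have "ennreal ((\<zeta> * X) powr - \<tau>) * emeasure lebesgue B = (\<integral>\<^sup>+x. ennreal ((\<zeta> * X) powr - \<tau>) * indicator B x \<partial>lebesgue)"
        using B by (simp add: nn_integral_cmult_indicator)
      also have "\<dots> \<le> J" unfolding J
      proof (rule nn_integral_mono)
        fix x
        show "ennreal ((\<zeta> * X) powr - \<tau>) * indicator B x \<le> ennreal (?w x powr - \<tau>) * indicator (hcube a l) x"
        proof (cases "x \<in> B")
          case True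
          then have "?w x \<le> \<zeta> * X" using V by (simp add: B_def X_def field_simps)
          then have "(\<zeta> * X) powr - \<tau> \<le> ?w x powr - \<tau>" using \<tau> W(2)[of x] by (intro powr_mono2') auto
          then show ?thesis using True by (simp add: B_def ennreal_leI)
        qed simp
      qed
      finally have le_J: "ennreal ((\<zeta> * X) powr - \<tau>) * emeasure lebesgue B \<le> ennreal (V * y)" unfolding Jy .
      have y_le: "y \<le> \<kappa> * (\<zeta> * X) powr - \<tau>"
      proof -
        have "X * y powr (s - 1) \<le> C" by fact
        then have "(y powr (s - 1)) \<le> C / X" using X by (simp add: field_simps)
        then have "(y powr (s - 1)) powr \<tau> \<le> (C / X) powr \<tau>" using \<tau> by (intro powr_mono2) auto
        then have "y \<le> (C / X) powr \<tau>" using y \<tau>(2) by (simp add: powr_powr mult.commute)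
        also have "(C / X) powr \<tau> = \<kappa> * (\<zeta> * X) powr - \<tau>"
        proof -
          have "(\<zeta> * X) powr - \<tau> = (\<kappa> powr (s - 1) * (X / C)) powr - \<tau>" by (simp add: \<zeta>_def)
          also have "\<dots> = (\<kappa> powr (s - 1)) powr - \<tau> * (X / C) powr - \<tau>" by (rule powr_mult)
          also have "(\<kappa> powr (s - 1)) powr - \<tau> = inverse \<kappa>"
            using \<kappa> \<tau>(2) by (simp add: powr_powr mult.commute powr_minus)
          also have "(X / C) powr - \<tau> = (C / X) powr \<tau>" using X C by (simp add: powr_minus powr_divide)
          finally show ?thesis using \<kappa> by simp
        qed
        finally show ?thesis .
      qed
      have "ennreal ((\<zeta> * X) powr - \<tau>) * emeasure lebesgue B \<le> ennreal ((\<zeta> * X) powr - \<tau>) * ennreal (\<kappa> * V)"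
      proof (rule order_trans[OF le_J])
        have "V * y \<le> (\<zeta> * X) powr - \<tau> * (\<kappa> * V)" using mult_left_mono[OF y_le, of V] V by (simp add: ac_simps)
        then show "ennreal (V * y) \<le> ennreal ((\<zeta> * X) powr - \<tau>) * ennreal (\<kappa> * V)"
          using \<kappa> V by (simp add: ennreal_mult[symmetric] ennreal_leI)
      qed
      then have "emeasure lebesgue B \<le> ennreal (\<kappa> * V)"
        using \<zeta> X by (subst (asm) ennreal_mult_le_mult_iff) auto
      then show ?thesis unfolding B_def V_def .
    qed
    then show "\<exists>\<zeta>>0. \<forall>a l. 0 < l \<longrightarrow> emeasure lebesgue
        {x \<in> hcube a l. ?w x * l ^ CARD('n) < \<zeta> * wmass ?w a l} \<le> ennreal (\<kappa> * l ^ CARD('n))"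
      using \<zeta> by blast
  qed
qed

lemma A_inf_if_muckenhoupt_infinity:
  "muckenhoupt_infinity w \<Longrightarrow> A_inf (positive_version w)"
  using A_inf_if_muckenhoupt_one A_inf_if_muckenhoupt by (auto simp: muckenhoupt_infinity_def)

section \<open>A countable family of cubes\<close>

text \<open>
  The cubes with corners in \<open>2\<^sup>k \<int>\<^sup>n\<close> and side \<open>2 \<sqdot> 2\<^sup>k\<close>. They overlap, but only boundedly often at each
  scale, and every cube lies in one of comparable size, so one such family suffices.
\<close>

definition grid_corner :: "int \<Rightarrow> ('n \<Rightarrow> int) \<Rightarrow> real ^ 'n" where
  "grid_corner k z = (\<chi> i. 2 powi k * real_of_int (z i))"

abbreviation grid_side :: "int \<Rightarrow> real" where
  "grid_side k \<equiv> 2 * 2 powi k"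

abbreviation grid_cube :: "int \<Rightarrow> ('n \<Rightarrow> int) \<Rightarrow> (real ^ 'n) set" where
  "grid_cube k z \<equiv> hcube (grid_corner k z) (grid_side k)"

lemma cube_subset_grid_cube:
  fixes a :: "real ^ 'n"
  assumes "0 < l"
  obtains k z where "cbox a (\<chi> i. a $ i + l) \<subseteq> grid_cube k z" "l \<le> grid_side k" "grid_side k \<le> 4 * l"
proof -
  define k where "k = \<lceil>log 2 l\<rceil>"
  have eq: "2 powi k = 2 powr real_of_int k" by (simp add: powr_real_of_int')
  have "l = 2 powr log 2 l" using assms by simp
  also have "\<dots> \<le> 2 powr real_of_int k" by (intro powr_mono) (auto simp: k_def)
  finally have 1: "l \<le> 2 powi k" unfolding eq .
  have "2 powr real_of_int k \<le> 2 powr (log 2 l + 1)"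
    by (intro powr_mono) (auto simp: k_def less_imp_le ceiling_correct)
  also have "\<dots> = 2 * l" using assms by (simp add: powr_add)
  finally have 2: "2 powi k \<le> 2 * l" unfolding eq .
  define s :: real where "s = 2 powi k"
  have s: "0 < s" by (simp add: s_def)
  define z where "z = (\<lambda>i. \<lfloor>a $ i / s\<rfloor>)"
  have "cbox a (\<chi> i. a $ i + l) \<subseteq> grid_cube k z"
  proof
    fix x assume "x \<in> cbox a (\<chi> i. a $ i + l)"
    then have x: "a $ i \<le> x $ i" "x $ i \<le> a $ i + l" for i by (auto simp: mem_box_cart)
    have "s * real_of_int (z i) \<le> a $ i \<and> a $ i < s * real_of_int (z i) + s" for i
    proof -
      have "real_of_int (z i) \<le> a $ i / s" "a $ i / s < real_of_int (z i) + 1" unfolding z_def by linarith+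
      then show ?thesis using s by (simp add: field_simps)
    qed
    then have "s * real_of_int (z i) \<le> x $ i \<and> x $ i < s * real_of_int (z i) + 2 * s" for i
      using x[of i] 1 unfolding s_def[symmetric] by (smt (verit))
    then show "x \<in> grid_cube k z" by (simp add: hcube_def grid_corner_def s_def)
  qed
  with that 1 2 assms show ?thesis by force
qed

lemma grid_cubes_overlap:
  fixes x :: "real ^ 'n"
  shows "finite {z. x \<in> grid_cube k z}" "card {z. x \<in> grid_cube k z} \<le> 2 ^ CARD('n)"
proof -
  define s :: real where "s = 2 powi k"
  have s: "0 < s" by (simp add: s_def)
  let ?S = "\<lambda>i. {\<lfloor>x $ i / s\<rfloor> - 1, \<lfloor>x $ i / s\<rfloor>}"
  have sub: "{z. x \<in> grid_cube k z} \<subseteq> PiE UNIV ?S"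
  proof
    fix z assume "z \<in> {z. x \<in> grid_cube k z}"
    then have "s * real_of_int (z i) \<le> x $ i \<and> x $ i < s * real_of_int (z i) + 2 * s" for i
      by (auto simp: hcube_def grid_corner_def s_def)
    then have "real_of_int (z i) \<le> x $ i / s \<and> x $ i / s < real_of_int (z i) + 2" for i
      using s by (simp add: field_simps)
    then have "z i \<le> \<lfloor>x $ i / s\<rfloor> \<and> \<lfloor>x $ i / s\<rfloor> < z i + 2" for i
      by (simp add: le_floor_iff floor_less_iff)
    then have range: "z i = \<lfloor>x $ i / s\<rfloor> - 1 \<or> z i = \<lfloor>x $ i / s\<rfloor>" for i
      by (smt (verit))
    then show "z \<in> PiE UNIV ?S" by auto
  qed
  have fin: "finite (PiE UNIV ?S)" by (intro finite_PiE) auto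
  then show "finite {z. x \<in> grid_cube k z}" using sub by (rule finite_subset[rotated])
  have "card {z. x \<in> grid_cube k z} \<le> card (PiE UNIV ?S)" by (rule card_mono[OF fin sub])
  also have "\<dots> = 2 ^ CARD('n)" by (simp add: card_PiE numeral_2_eq_2)
  finally show "card {z. x \<in> grid_cube k z} \<le> 2 ^ CARD('n)" .
qed

text \<open>
  The mass of a cube centred at \<open>x\<close> containing every grid cube of scale \<open>k\<close> around \<open>x\<close>. Unlike the grid
  cubes, these centred cubes are nested, which makes their masses geometric in \<open>k\<close>.
\<close>

definition reach_mass :: "(real ^ 'n \<Rightarrow> real) \<Rightarrow> real ^ 'n \<Rightarrow> int \<Rightarrow> real" where
  "reach_mass w x k = wmass w (\<chi> i. x $ i - grid_side k) (2 * grid_side k)"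

lemma grid_cube_subset_reach:
  assumes "x \<in> grid_cube k z"
  shows "grid_cube k z \<subseteq> hcube (\<chi> i. x $ i - grid_side k) (2 * grid_side k)"
proof
  fix y assume y: "y \<in> grid_cube k z"
  have "grid_corner k z $ i \<le> x $ i" "x $ i < grid_corner k z $ i + grid_side k"
     "grid_corner k z $ i \<le> y $ i" "y $ i < grid_corner k z $ i + grid_side k" for i
    using assms y by (auto simp: hcube_def)
  then show "y \<in> hcube (\<chi> i. x $ i - grid_side k) (2 * grid_side k)"
    unfolding hcube_def by (simp, smt (verit))
qed

lemma wmass_mono:
  assumes "A_inf w" "0 < l" "0 < l'" "hcube a l \<subseteq> hcube a' l'"
  shows "wmass w a l \<le> wmass w a' l'"
proof -
  have "emeasure (weighted w) (hcube a l) \<le> emeasure (weighted w) (hcube a' l')"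
    using assms(4) by (intro emeasure_mono) auto
  then show ?thesis using A_inf_wmass[OF assms(1,2), of a] A_inf_wmass[OF assms(1,3), of a']
    by (simp add: ennreal_le_iff)
qed

lemma sum_powers_nat_image_le:
  fixes \<theta> :: real and g :: "int \<Rightarrow> nat"
  assumes "0 \<le> \<theta>" "\<theta> < 1" "finite A" "inj_on g A"
  shows "(\<Sum>k\<in>A. \<theta> ^ g k) \<le> 1 / (1 - \<theta>)"
proof -
  have "(\<Sum>k\<in>A. \<theta> ^ g k) = (\<Sum>j\<in>g ` A. \<theta> ^ j)" using assms by (simp add: sum.reindex)
  also have "\<dots> \<le> (\<Sum>j. \<theta> ^ j)" using assms by (intro sum_le_suminf) (auto simp: summable_geometric)
  also have "\<dots> = 1 / (1 - \<theta>)" using assms by (intro suminf_geometric) auto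
  finally show ?thesis .
qed

text \<open>
  A sequence growing at least geometrically meets the level \<open>1\<close> once; to either side of it the terms are
  dominated by a geometric series.
\<close>

lemma sum_min_geometric_le:
  fixes y :: "int \<Rightarrow> real"
  assumes \<beta>: "0 < \<beta>" "\<beta> < 1" and \<epsilon>: "0 < \<epsilon>" and y: "\<And>k. 0 < y k" "\<And>k. y k \<le> \<beta> * y (k + 1)" and S: "finite S"
  shows "(\<Sum>k\<in>S. min (y k powr \<epsilon>) (y k powr - \<epsilon>)) \<le> 2 / (1 - \<beta> powr \<epsilon>)"
proof -
  define \<theta> where "\<theta> = \<beta> powr \<epsilon>"
  have \<theta>: "0 < \<theta>" "\<theta> < 1" using \<beta> \<epsilon> by (auto simp: \<theta>_def powr01_less_one)
  have chain: "y j \<le> \<beta> ^ nat (k - j) * y k" if "j \<le> k" for j k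
    using that
  proof (induction k rule: int_ge_induct)
    case (step k)
    have "y j \<le> \<beta> ^ nat (k - j) * y k" by fact
    also have "\<dots> \<le> \<beta> ^ nat (k - j) * (\<beta> * y (k + 1))" using \<beta> y(2)[of k] by (intro mult_left_mono) auto
    also have "\<dots> = \<beta> ^ Suc (nat (k - j)) * y (k + 1)" by simp
    also have "Suc (nat (k - j)) = nat (k + 1 - j)" using step by simp
    finally show ?case .
  qed simp
  have pow: "(\<beta> ^ j) powr \<epsilon> = \<theta> ^ j" for j
    using \<beta> unfolding \<theta>_def by (simp add: powr_realpow[symmetric] powr_powr mult.commute)
  define A where "A = {k \<in> S. y k \<le> 1}"
  define B where "B = {k \<in> S. 1 < y k}"
  have fin: "finite A" "finite B" using S by (auto simp: A_def B_def)
  have "(\<Sum>k\<in>A. min (y k powr \<epsilon>) (y k powr - \<epsilon>)) \<le> (\<Sum>k\<in>A. \<theta> ^ nat (Max A - k))"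
  proof (rule sum_mono)
    fix k assume k: "k \<in> A"
    then have "Max A \<in> A" using fin by (intro Max_in) auto
    then have "y (Max A) \<le> 1" by (simp add: A_def)
    have "y k \<le> \<beta> ^ nat (Max A - k) * y (Max A)" using k fin by (intro chain) auto
    also have "\<dots> \<le> \<beta> ^ nat (Max A - k)" using \<open>y (Max A) \<le> 1\<close> \<beta> by (intro mult_left_le) auto
    finally have "y k powr \<epsilon> \<le> \<theta> ^ nat (Max A - k)"
      unfolding pow[symmetric] using y(1)[of k] \<epsilon> by (intro powr_mono2) auto
    then show "min (y k powr \<epsilon>) (y k powr - \<epsilon>) \<le> \<theta> ^ nat (Max A - k)" by simp
  qed
  also have "\<dots> \<le> 1 / (1 - \<theta>)"
  proof (intro sum_powers_nat_image_le)
    show "inj_on (\<lambda>k. nat (Max A - k)) A"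
      using Max_ge[OF fin(1)] by (intro inj_onI) (smt (verit) nat_eq_iff)
  qed (use \<theta> fin in auto)
  finally have sA: "(\<Sum>k\<in>A. min (y k powr \<epsilon>) (y k powr - \<epsilon>)) \<le> 1 / (1 - \<theta>)" .
  have "(\<Sum>k\<in>B. min (y k powr \<epsilon>) (y k powr - \<epsilon>)) \<le> (\<Sum>k\<in>B. \<theta> ^ nat (k - Min B))"
  proof (rule sum_mono)
    fix k assume k: "k \<in> B"
    then have "Min B \<in> B" using fin by (intro Min_in) auto
    then have "1 < y (Min B)" by (simp add: B_def)
    also have "\<dots> \<le> \<beta> ^ nat (k - Min B) * y k" using k fin by (intro chain) auto
    finally have "1 / y k \<le> \<beta> ^ nat (k - Min B)" using y(1)[of k] by (simp add: field_simps)
    then have "(1 / y k) powr \<epsilon> \<le> \<theta> ^ nat (k - Min B)"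
      unfolding pow[symmetric] using y(1)[of k] \<epsilon> by (intro powr_mono2) auto
    moreover have "(1 / y k) powr \<epsilon> = y k powr - \<epsilon>" using y(1)[of k] by (simp add: powr_divide powr_minus_divide)
    ultimately show "min (y k powr \<epsilon>) (y k powr - \<epsilon>) \<le> \<theta> ^ nat (k - Min B)" by simp
  qed
  also have "\<dots> \<le> 1 / (1 - \<theta>)"
  proof (intro sum_powers_nat_image_le)
    show "inj_on (\<lambda>k. nat (k - Min B)) B"
      using Min_le[OF fin(2)] by (intro inj_onI) (smt (verit) nat_eq_iff)
  qed (use \<theta> fin in auto)
  finally have sB: "(\<Sum>k\<in>B. min (y k powr \<epsilon>) (y k powr - \<epsilon>)) \<le> 1 / (1 - \<theta>)" .
  have "S = A \<union> B" "A \<inter> B = {}" by (auto simp: A_def B_def)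
  then have "(\<Sum>k\<in>S. min (y k powr \<epsilon>) (y k powr - \<epsilon>)) =
     (\<Sum>k\<in>A. min (y k powr \<epsilon>) (y k powr - \<epsilon>)) + (\<Sum>k\<in>B. min (y k powr \<epsilon>) (y k powr - \<epsilon>))"
    using fin by (simp add: sum.union_disjoint)
  then show ?thesis using sA sB unfolding \<theta>_def by simp
qed

lemma nn_integral_count_space_le_if_sums_le:
  fixes f :: "'a :: countable \<Rightarrow> ennreal"
  assumes inf: "infinite (UNIV :: 'a set)" and le: "\<And>F. finite F \<Longrightarrow> sum f F \<le> c"
  shows "(\<integral>\<^sup>+i. f i \<partial>count_space UNIV) \<le> c"
proof -
  let ?g = "from_nat_into (UNIV :: 'a set)"
  have bij: "bij_betw ?g UNIV UNIV" using inf by (intro bij_betw_from_nat_into) auto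
  have "(\<integral>\<^sup>+i. f i \<partial>count_space UNIV) = (\<integral>\<^sup>+n. f (?g n) \<partial>count_space UNIV)"
    by (rule nn_integral_bij_count_space[OF bij, symmetric])
  also have "\<dots> = (\<Sum>n. f (?g n))" by (rule nn_integral_count_space_nat)
  also have "\<dots> \<le> c"
  proof (rule suminf_le_const)
    fix N
    have "(\<Sum>n<N. f (?g n)) = sum f (?g ` {..<N})"
      using bij by (subst sum.reindex) (auto simp: bij_betw_def inj_on_def)
    then show "(\<Sum>n<N. f (?g n)) \<le> c" using le by simp
  qed simp
  finally show ?thesis .
qed

text \<open>
  At each scale at most \<open>2\<^sup>n\<close> grid cubes contain \<open>x\<close>, and by reverse doubling the numbers
  \<open>b w(R)\<close>, with \<open>R\<close> the centred cubes, grow geometrically with the scale.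
\<close>

lemma grid_sum_bound:
  fixes w :: "real ^ 'n \<Rightarrow> real"
  assumes w: "A_inf w" and \<epsilon>: "0 < \<epsilon>"
  obtains K where "0 < K"
    "\<And>(c :: int \<times> ('n \<Rightarrow> int) \<Rightarrow> real) x b M. 0 < b \<Longrightarrow> 0 \<le> M \<Longrightarrow>
      \<forall>k z. x \<in> grid_cube k z \<longrightarrow> 0 \<le> c (k, z) \<and>
         c (k, z) \<le> M * min ((b * reach_mass w x k) powr \<epsilon>) ((b * reach_mass w x k) powr - \<epsilon>) \<Longrightarrow>
      (\<integral>\<^sup>+i. ennreal (c i) * indicator (grid_cube (fst i) (snd i)) x \<partial>count_space UNIV) \<le> ennreal (K * M)"
proof -
  obtain \<beta> where \<beta>: "0 < \<beta>" "\<beta> < 1"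
    "\<And>a b l. 0 < l \<Longrightarrow> hcube b l \<subseteq> hcube a (2 * l) \<Longrightarrow> wmass w b l \<le> \<beta> * wmass w a (2 * l)"
    by (rule A_inf_reverse_doubling[OF w]) (rule that)
  have "\<beta> powr \<epsilon> < 1" using \<beta> \<epsilon> by (simp add: powr01_less_one)
  define K where "K = 2 ^ CARD('n) * (2 / (1 - \<beta> powr \<epsilon>))"
  show ?thesis
  proof (rule that[of K])
    show "0 < K" using \<open>\<beta> powr \<epsilon> < 1\<close> by (simp add: K_def)
    fix c :: "int \<times> ('n \<Rightarrow> int) \<Rightarrow> real" and x :: "real ^ 'n" and b M :: real
    assume b: "0 < b" and M: "0 \<le> M" and c': "\<forall>k z. x \<in> grid_cube k z \<longrightarrow> 0 \<le> c (k, z) \<and>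
         c (k, z) \<le> M * min ((b * reach_mass w x k) powr \<epsilon>) ((b * reach_mass w x k) powr - \<epsilon>)"
    note c = c'[rule_format]
    define y where "y = (\<lambda>k. b * reach_mass w x k)"
    define m where "m = (\<lambda>k. min (y k powr \<epsilon>) (y k powr - \<epsilon>))"
    have y: "0 < y k" for k unfolding y_def reach_mass_def using b A_inf_wmass(2)[OF w] by simp
    have y_step: "y k \<le> \<beta> * y (k + 1)" for k
    proof -
      have "reach_mass w x k \<le> \<beta> * wmass w (\<chi> i. x $ i - grid_side (k + 1)) (2 * (2 * grid_side k))"
        unfolding reach_mass_def
      proof (rule \<beta>(3))
        have "0 < (2::real) powi k" by simp
        then show "hcube (\<chi> i. x $ i - grid_side k) (2 * grid_side k) \<subseteq> hcube (\<chi> i. x $ i - grid_side (k + 1)) (2 * (2 * grid_side k))"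
          unfolding hcube_def by (auto simp: power_int_add) (smt (verit))+
      qed simp
      also have "2 * (2 * grid_side k) = 2 * grid_side (k + 1)" by (simp add: power_int_add)
      finally have "reach_mass w x k \<le> \<beta> * reach_mass w x (k + 1)" unfolding reach_mass_def .
      from mult_left_mono[OF this, of b] b show ?thesis by (simp add: y_def ac_simps)
    qed
    have m0: "0 \<le> m k" for k by (simp add: m_def)
    show "(\<integral>\<^sup>+i. ennreal (c i) * indicator (grid_cube (fst i) (snd i)) x \<partial>count_space UNIV) \<le> ennreal (K * M)"
    proof (rule nn_integral_count_space_le_if_sums_le)
      show "infinite (UNIV :: (int \<times> ('n \<Rightarrow> int)) set)"
        by (auto simp: finite_prod infinite_UNIV_int)
      fix F :: "(int \<times> ('n \<Rightarrow> int)) set" assume F: "finite F"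
      define G where "G = {i \<in> F. x \<in> grid_cube (fst i) (snd i)}"
      have G: "finite G" using F by (simp add: G_def)
      have "(\<Sum>i\<in>F. ennreal (c i) * indicator (grid_cube (fst i) (snd i)) x) = (\<Sum>i\<in>G. ennreal (c i))"
        unfolding G_def by (rule sum.mono_neutral_cong_right[OF F]) auto
      also have "\<dots> = ennreal (\<Sum>i\<in>G. c i)" using c by (intro sum_ennreal) (auto simp: G_def)
      also have "\<dots> \<le> ennreal (K * M)"
      proof (rule ennreal_leI)
        let ?Z = "\<lambda>k. {z. x \<in> grid_cube k z}"
        have "(\<Sum>i\<in>G. c i) \<le> (\<Sum>i\<in>G. M * m (fst i))"
          using c by (intro sum_mono) (auto simp: G_def m_def y_def)
        also have "\<dots> \<le> (\<Sum>i\<in>Sigma (fst ` G) ?Z. M * m (fst i))"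
          using G M m0 grid_cubes_overlap(1)
          by (intro sum_mono2) (auto simp: G_def intro!: finite_SigmaI image_eqI)
        also have "\<dots> = (\<Sum>k\<in>fst ` G. \<Sum>z\<in>?Z k. M * m k)"
          using G grid_cubes_overlap(1) by (subst sum.Sigma) (auto intro!: sum.cong)
        also have "\<dots> = (\<Sum>k\<in>fst ` G. real (card (?Z k)) * (M * m k))" by simp
        also have "\<dots> \<le> (\<Sum>k\<in>fst ` G. 2 ^ CARD('n) * (M * m k))"
        proof (intro sum_mono mult_right_mono)
          fix k
          show "real (card (?Z k)) \<le> 2 ^ CARD('n)"
            using grid_cubes_overlap(2)[of x k] by (metis of_nat_le_iff of_nat_numeral of_nat_power)
        qed (use M m0 in auto)
        also have "\<dots> = 2 ^ CARD('n) * M * (\<Sum>k\<in>fst ` G. m k)" by (simp add: sum_distrib_left mult.assoc)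
        also have "\<dots> \<le> 2 ^ CARD('n) * M * (2 / (1 - \<beta> powr \<epsilon>))"
          unfolding m_def using M G \<beta> \<epsilon> y y_step by (intro mult_left_mono sum_min_geometric_le) auto
        also have "\<dots> = K * M" by (simp add: K_def)
        finally show "(\<Sum>i\<in>G. c i) \<le> K * M" .
      qed
      finally show "(\<Sum>i\<in>F. ennreal (c i) * indicator (grid_cube (fst i) (snd i)) x) \<le> ennreal (K * M)" .
    qed
  qed
qed

section \<open>Mixed mass of a set covered by cubes\<close>

text \<open>
  Exponent bookkeeping for one cube. Let \<open>y\<^sub>0 = u W/B\<^sup>p\<close>. The left-hand side equals, up to constants,
  \<open>B\<^sup>p\<^sup>-\<^sup>1 (A/u)\<^sup>\<tau>\<^sup>+\<^sup>\<epsilon> y\<^sub>0\<^sup>\<epsilon>\<close>. The bound on \<open>A/u\<close> makes this small for small \<open>y\<^sub>0\<close>; writing it as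
  \<open>B\<^sup>p\<^sup>-\<^sup>1 (A W/B\<^sup>p)\<^sup>\<tau>\<^sup>+\<^sup>\<epsilon> y\<^sub>0\<^sup>-\<^sup>\<tau>\<close>, the bound on \<open>A W\<close> makes it small for large \<open>y\<^sub>0\<close>. The number \<open>y\<close> is a
  value comparable to \<open>y\<^sub>0\<close>.
\<close>

lemma coefficient_bound:
  fixes A W u B y D K p \<epsilon> \<tau> s :: real
  assumes pos: "0 < A" "0 < W" "0 < u" "0 < B" "0 < y" "0 < D" "0 < K"
    and exps: "0 < p" "0 < \<epsilon>" "\<epsilon> \<le> \<tau>" "\<tau> = 1 / (2 * p)" "s = 1 - 1 / p - \<epsilon>"
    and A1: "A \<le> K\<^sup>2 * u" and AW: "A * W \<le> K * B powr p"
    and y: "u * W / B powr p \<le> y" "y \<le> D * (u * W / B powr p)"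
  shows "A powr (1 - \<tau>) * (K * B powr p / A) powr s * W powr \<epsilon> * u powr - \<tau>
    \<le> (K powr s * ((K\<^sup>2) powr (\<tau> + \<epsilon>) + K powr (\<tau> + \<epsilon>) * D powr \<tau>)) * B powr (p - 1) * min (y powr \<epsilon>) (y powr - \<epsilon>)"
proof -
  define y0 where "y0 = u * W / B powr p"
  have y0: "0 < y0" using pos by (simp add: y0_def)
  have id1: "A powr (1 - \<tau>) * (K * B powr p / A) powr s * W powr \<epsilon> * u powr - \<tau>
     = K powr s * B powr (p - 1) * ((A / u) powr (\<tau> + \<epsilon>) * y0 powr \<epsilon>)"
  proof -
    \<comment> \<open>In exponential coordinates the identity is a polynomial identity between exponents.\<close>
    obtain a where a: "A = exp a" using pos by (metis exp_ln)
    obtain b where b: "B = exp b" using pos by (metis exp_ln)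
    obtain c where c: "u = exp c" using pos by (metis exp_ln)
    obtain d where d: "W = exp d" using pos by (metis exp_ln)
    obtain k where k: "K = exp k" using pos by (metis exp_ln)
    show ?thesis
      unfolding y0_def a b c d k exp_powr_real exp_add[symmetric] exp_diff[symmetric]
    proof (rule arg_cong[where f = exp])
      have "p * s = p - 1 - p * \<epsilon>" using exps by (simp add: field_simps)
      moreover have "s + \<epsilon> + 2 * \<tau> = 1" by (simp add: exps(4,5))
      ultimately show "a * (1 - \<tau>) + (k + b * p - a) * s + d * \<epsilon> + c * - \<tau> =
          k * s + b * (p - 1) + ((a - c) * (\<tau> + \<epsilon>) + (c + d - b * p) * \<epsilon>)"
        by algebra
    qed
  qed
  have id2: "(A / u) powr (\<tau> + \<epsilon>) * y0 powr \<epsilon> = (A * W / B powr p) powr (\<tau> + \<epsilon>) * y0 powr - \<tau>"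
  proof -
    have "A * W / B powr p = A / u * y0" using pos by (simp add: y0_def)
    then have "(A * W / B powr p) powr (\<tau> + \<epsilon>) * y0 powr - \<tau> = (A / u) powr (\<tau> + \<epsilon>) * (y0 powr (\<tau> + \<epsilon>) * y0 powr - \<tau>)"
      by (simp only: powr_mult mult.assoc)
    then show ?thesis by (simp add: powr_add[symmetric])
  qed
  have \<tau>: "0 < \<tau>" using exps by simp
  have "(A / u) powr (\<tau> + \<epsilon>) * y0 powr \<epsilon> \<le> ((K\<^sup>2) powr (\<tau> + \<epsilon>) + K powr (\<tau> + \<epsilon>) * D powr \<tau>) * min (y powr \<epsilon>) (y powr - \<epsilon>)"
  proof (cases "y < 1")
    case True
    have m: "min (y powr \<epsilon>) (y powr - \<epsilon>) = y powr \<epsilon>"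
      using True pos exps powr_mono'[of "-\<epsilon>" \<epsilon> y] by simp
    have "(A / u) powr (\<tau> + \<epsilon>) \<le> (K\<^sup>2) powr (\<tau> + \<epsilon>)"
      using A1 pos exps \<tau> by (intro powr_mono2) (auto simp: field_simps)
    moreover have "y0 powr \<epsilon> \<le> y powr \<epsilon>" using y y0 exps by (intro powr_mono2) (auto simp: y0_def)
    ultimately have "(A / u) powr (\<tau> + \<epsilon>) * y0 powr \<epsilon> \<le> (K\<^sup>2) powr (\<tau> + \<epsilon>) * y powr \<epsilon>"
      by (intro mult_mono) auto
    also have "\<dots> \<le> ((K\<^sup>2) powr (\<tau> + \<epsilon>) + K powr (\<tau> + \<epsilon>) * D powr \<tau>) * y powr \<epsilon>"
      by (intro mult_right_mono) auto
    finally show ?thesis unfolding m .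
  next
    case False
    have m: "min (y powr \<epsilon>) (y powr - \<epsilon>) = y powr - \<epsilon>"
      using False pos exps powr_mono[of "-\<epsilon>" \<epsilon> y] by simp
    have 1: "(A * W / B powr p) powr (\<tau> + \<epsilon>) \<le> K powr (\<tau> + \<epsilon>)"
      using AW pos exps \<tau> by (intro powr_mono2) (auto simp: field_simps)
    have "y / D \<le> y0" using y pos by (simp add: y0_def field_simps)
    then have "y0 powr - \<tau> \<le> (y / D) powr - \<tau>" using pos \<tau> by (intro powr_mono2') auto
    also have "\<dots> = D powr \<tau> * y powr - \<tau>" using pos by (simp add: powr_divide powr_minus field_simps)
    also have "\<dots> \<le> D powr \<tau> * y powr - \<epsilon>" using False exps by (intro mult_left_mono powr_mono) auto
    finally have "(A * W / B powr p) powr (\<tau> + \<epsilon>) * y0 powr - \<tau> \<le> K powr (\<tau> + \<epsilon>) * (D powr \<tau> * y powr - \<epsilon>)"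
      using 1 by (intro mult_mono) auto
    also have "\<dots> \<le> ((K\<^sup>2) powr (\<tau> + \<epsilon>) + K powr (\<tau> + \<epsilon>) * D powr \<tau>) * y powr - \<epsilon>"
      unfolding mult.assoc[symmetric] by (intro mult_right_mono) auto
    finally show ?thesis unfolding m id2 .
  qed
  then have "K powr s * B powr (p - 1) * ((A / u) powr (\<tau> + \<epsilon>) * y0 powr \<epsilon>) \<le>
    K powr s * B powr (p - 1) * (((K\<^sup>2) powr (\<tau> + \<epsilon>) + K powr (\<tau> + \<epsilon>) * D powr \<tau>) * min (y powr \<epsilon>) (y powr - \<epsilon>))"
    by (intro mult_left_mono) auto
  then show ?thesis unfolding id1 by (simp only: ac_simps)
qed

text \<open>
  The assumption on \<open>u\<close> is the \<open>A\<^sub>1\<close> condition; its constant is written \<open>K\<^sup>2\<close> because \<open>K\<close> is the constant that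
  appears in \<open>A Z \<le> K B\<^sup>p\<close>.
\<close>

locale mixed_weights =
  fixes u w :: "real ^ 'n \<Rightarrow> real" and K p :: real
  assumes u: "A_inf u" and w: "A_inf w" and K: "0 < K" and p: "1 < p"
    and A1: "\<And>a l. 0 < l \<Longrightarrow> AE x in lebesgue. x \<in> hcube a l \<longrightarrow> wmass u a l / l ^ CARD('n) \<le> K\<^sup>2 * u x"
begin

definition avg_u :: "real ^ 'n \<Rightarrow> real \<Rightarrow> real" where
  "avg_u a l = wmass u a l / l ^ CARD('n)"

text \<open>
  Half of the exponent \<open>1/p\<close> of \<open>u\<close>. One half of \<open>u\<^sup>1\<^sup>/\<^sup>p\<close> is spent on the absorption of logarithms and of the
  ratio between \<open>u\<close> and its average, the other half on the summation over large cubes.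
\<close>

definition \<tau> :: real where "\<tau> = 1 / (2 * p)"

text \<open>
  For \<open>h = F (uw)\<^sup>1\<^sup>/\<^sup>p\<close> this is \<open>\<integral>\<^sub>Q F w\<^sup>1\<^sup>/\<^sup>p u\<^sup>\<tau>\<close>; multiplied by the power \<open>-\<tau>\<close> of the average of \<open>u\<close> it
  replaces \<open>\<integral>\<^sub>Q F w\<^sup>1\<^sup>/\<^sup>p\<close>.
\<close>

definition tilted :: "(real ^ 'n \<Rightarrow> real) \<Rightarrow> real ^ 'n \<Rightarrow> real \<Rightarrow> ennreal" where
  "tilted h a l = (\<integral>\<^sup>+x\<in>hcube a l. ennreal (h x * u x powr - \<tau>) \<partial>lebesgue)"

text \<open>
  The coefficient with which a cube enters the sum, after all factors but one have been bounded in terms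
  of \<open>B\<close>.
\<close>

definition term_weight :: "real \<Rightarrow> real \<Rightarrow> real ^ 'n \<Rightarrow> real \<Rightarrow> real" where
  "term_weight \<epsilon> B a l =
     avg_u a l powr (1 - \<tau>) * (K * B powr p / avg_u a l) powr (1 - 1 / p - \<epsilon>) * wmass w a l powr \<epsilon>"

text \<open>
  The number \<open>Z\<close> bounds \<open>L\<bar>Q\<bar>\<close> for all levels \<open>L\<close> admissible on \<open>Q\<close>; if it is at least \<open>w(Q)\<close>, then the part of
  the \<open>uw\<close>-mass of \<open>Q\<close> below the level \<open>Z/\<bar>Q\<bar>\<close> is controlled.
\<close>

definition cube_level :: "real \<Rightarrow> real \<Rightarrow> (real ^ 'n \<Rightarrow> real) \<Rightarrow> real \<Rightarrow> real ^ 'n \<Rightarrow> real \<Rightarrow> real \<Rightarrow> bool" where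
  "cube_level C \<epsilon> h B a l Z \<longleftrightarrow>
     (\<forall>L>0. ennreal ((L * l ^ CARD('n)) powr (1 / p)) \<le> ennreal (avg_u a l powr - \<tau>) * tilted h a l \<longrightarrow>
        L * l ^ CARD('n) \<le> Z) \<and>
     (wmass w a l \<le> Z \<longrightarrow> avg_u a l * wmass w a l \<le> K * B powr p \<and>
        (\<integral>\<^sup>+x\<in>hcube a l. min (ennreal (w x)) (ennreal (Z / l ^ CARD('n))) \<partial>weighted u)
          \<le> ennreal (C * term_weight \<epsilon> B a l) * tilted h a l)"

definition covered :: "(real ^ 'n \<Rightarrow> real) \<Rightarrow> real ^ 'n \<Rightarrow> bool" where
  "covered h x \<longleftrightarrow> (\<exists>k z L. x \<in> grid_cube k z \<and> 0 < L \<and> w x \<le> L \<and>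
     wmass w (grid_corner k z) (grid_side k) \<le> L * grid_side k ^ CARD('n) \<and>
     ennreal ((L * grid_side k ^ CARD('n)) powr (1 / p)) \<le>
       ennreal (avg_u (grid_corner k z) (grid_side k) powr - \<tau>) * tilted h (grid_corner k z) (grid_side k))"

lemma avg_u_pos: "0 < l \<Longrightarrow> 0 < avg_u a l"
  unfolding avg_u_def using A_inf_wmass(2)[OF u] by simp

lemma tilted_le:
  assumes l: "0 < l" and h: "\<And>x. 0 \<le> h x" and B: "0 \<le> B" and le: "(\<integral>\<^sup>+x. ennreal (h x) \<partial>lebesgue) \<le> ennreal B"
    and [measurable]: "h \<in> borel_measurable lebesgue"
  shows "tilted h a l \<le> ennreal ((K\<^sup>2 / avg_u a l) powr \<tau> * B)"
proof -
  have "0 < \<tau>" using p by (simp add: \<tau>_def)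
  have "tilted h a l \<le> (\<integral>\<^sup>+x. ennreal ((K\<^sup>2 / avg_u a l) powr \<tau>) * ennreal (h x) \<partial>lebesgue)"
    unfolding tilted_def
  proof (rule nn_integral_mono_AE)
    show "AE x in lebesgue. ennreal (h x * u x powr - \<tau>) * indicator (hcube a l) x \<le>
        ennreal ((K\<^sup>2 / avg_u a l) powr \<tau>) * ennreal (h x)"
      using A1[OF l, of a]
    proof eventually_elim
      case (elim x)
      show ?case
      proof (cases "x \<in> hcube a l")
        case True
        then have "avg_u a l \<le> K\<^sup>2 * u x" using elim by (simp add: avg_u_def)
        then have "avg_u a l / K\<^sup>2 \<le> u x" using K by (simp add: field_simps)
        then have "u x powr - \<tau> \<le> (avg_u a l / K\<^sup>2) powr - \<tau>"
          using avg_u_pos[OF l, of a] K \<open>0 < \<tau>\<close> by (intro powr_mono2') auto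
        also have "\<dots> = (K\<^sup>2 / avg_u a l) powr \<tau>"
          using avg_u_pos[OF l, of a] K by (simp add: powr_divide powr_minus field_simps)
        finally have "h x * u x powr - \<tau> \<le> (K\<^sup>2 / avg_u a l) powr \<tau> * h x"
          using h[of x] by (metis mult.commute mult_left_mono)
        then show ?thesis using True h by (simp add: ennreal_mult[symmetric] ennreal_leI)
      qed simp
    qed
  qed
  also have "\<dots> = ennreal ((K\<^sup>2 / avg_u a l) powr \<tau>) * (\<integral>\<^sup>+x. ennreal (h x) \<partial>lebesgue)"
    by (rule nn_integral_cmult) measurable
  also have "\<dots> \<le> ennreal ((K\<^sup>2 / avg_u a l) powr \<tau>) * ennreal B" by (intro mult_left_mono le) simp
  also have "\<dots> = ennreal ((K\<^sup>2 / avg_u a l) powr \<tau> * B)" using B by (simp add: ennreal_mult)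
  finally show ?thesis .
qed

text \<open>
  The number \<open>Z\<close> is the \<open>p\<close>-th power of the right-hand side of the condition on \<open>L\<close>, so it bounds all
  admissible \<open>L\<bar>Q\<bar>\<close> at once. One factor \<open>Z\<^sup>1\<^sup>/\<^sup>p\<close> of the resulting estimate is kept as the integral
  \<open>tilted h a l\<close>, and the others are bounded through \<open>A Z \<le> K B\<^sup>p\<close>. The condition \<open>\<epsilon> \<le> 1 - 1/p\<close> keeps
  the exponent of \<open>Z\<close> nonnegative; here \<open>p > 1\<close> enters.
\<close>

lemma cube_contribution:
  obtains C \<epsilon> where "0 < C" "0 < \<epsilon>" "\<epsilon> \<le> \<tau>" "\<epsilon> \<le> 1 - 1 / p"
    "\<And>a l h B. 0 < l \<Longrightarrow> h \<in> borel_measurable lebesgue \<Longrightarrow> \<forall>x. 0 \<le> h x \<Longrightarrow> 0 < B \<Longrightarrow>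
      (\<integral>\<^sup>+x. ennreal (h x) \<partial>lebesgue) \<le> ennreal B \<Longrightarrow>
      \<exists>Z. cube_level C \<epsilon> h B a l Z"
proof -
  obtain C \<epsilon>0 where C: "0 < C" "0 < \<epsilon>0"
    and trunc: "\<And>f a l L \<rho>. f \<in> borel_measurable lebesgue \<Longrightarrow> 0 < l \<Longrightarrow> 0 < L \<Longrightarrow> 0 < \<rho> \<Longrightarrow> \<rho> \<le> 1 \<Longrightarrow>
       emeasure (density lebesgue f) (hcube a l) \<le> ennreal (\<rho> * L) * emeasure lebesgue (hcube a l) \<Longrightarrow>
       (\<integral>\<^sup>+x\<in>hcube a l. min (f x) (ennreal L) \<partial>weighted u)
         \<le> ennreal (C * \<rho> powr \<epsilon>0 * L) * emeasure (weighted u) (hcube a l)"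
    by (rule A_inf_truncated[OF u]) (rule that)
  note [measurable] = A_infD(1)[OF w]
  define \<epsilon> where "\<epsilon> = Min {\<epsilon>0, \<tau>, 1 - 1 / p}"
  have \<tau>: "0 < \<tau>" "1 / p = 2 * \<tau>" using p by (auto simp: \<tau>_def)
  have \<epsilon>: "0 < \<epsilon>" "\<epsilon> \<le> \<tau>" "\<epsilon> \<le> 1 - 1 / p" "\<epsilon> \<le> \<epsilon>0" using C \<tau>(1) p by (auto simp: \<epsilon>_def)
  show ?thesis
  proof (rule that[of C \<epsilon>])
    fix a :: "real ^ 'n" and l :: real and h :: "real ^ 'n \<Rightarrow> real" and B :: real
    assume l: "0 < l" and h[measurable]: "h \<in> borel_measurable lebesgue" and "\<forall>x. 0 \<le> h x" and B: "0 < B"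
      and hB: "(\<integral>\<^sup>+x. ennreal (h x) \<partial>lebesgue) \<le> ennreal B"
    then have h0: "0 \<le> h x" for x by blast
    define V where "V = l ^ CARD('n)"
    define A where "A = avg_u a l"
    define W where "W = wmass w a l"
    have V: "0 < V" using l by (simp add: V_def)
    have A: "0 < A" using avg_u_pos[OF l] by (simp add: A_def)
    have W: "0 < W" "emeasure (weighted w) (hcube a l) = ennreal W"
      using A_inf_wmass[OF w l, of a] by (auto simp: W_def)
    have T: "tilted h a l \<le> ennreal ((K\<^sup>2 / A) powr \<tau> * B)"
      unfolding A_def using l h0 h B hB by (intro tilted_le) auto
    then obtain J where J: "tilted h a l = ennreal J" "0 \<le> J" by (cases "tilted h a l") (auto simp: top_unique)
    have J_le: "J \<le> (K\<^sup>2 / A) powr \<tau> * B" using T J B by (simp add: ennreal_le_iff)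
    define Z where "Z = (A powr - \<tau> * J) powr p"
    have root: "Z powr (1 / p) = A powr - \<tau> * J" using p J A by (simp add: Z_def powr_powr)
    have Z_le: "A * Z \<le> K * B powr p"
    proof -
      have "A powr - \<tau> * J \<le> A powr - \<tau> * ((K\<^sup>2 / A) powr \<tau> * B)" using J_le by (intro mult_left_mono) auto
      then have "Z \<le> (A powr - \<tau> * ((K\<^sup>2 / A) powr \<tau> * B)) powr p"
        unfolding Z_def using J p by (intro powr_mono2) auto
      also have "\<dots> = K * B powr p / A"
      proof -
        obtain a' where a: "A = exp a'" using A by (metis exp_ln)
        obtain b where b: "B = exp b" using B by (metis exp_ln)
        obtain k where k: "K = exp k" using K by (metis exp_ln)
        show ?thesis
          unfolding a b k exp_powr_real exp_add[symmetric] exp_diff[symmetric] power2_eq_square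
          using p by (simp add: \<tau>_def field_simps)
      qed
      finally show ?thesis using A by (simp add: field_simps)
    qed
    have "L * V \<le> Z" if L: "0 < L" and le: "ennreal ((L * V) powr (1 / p)) \<le> ennreal (A powr - \<tau>) * tilted h a l" for L
    proof -
      have "(L * V) powr (1 / p) \<le> A powr - \<tau> * J"
        using le J A by (simp add: ennreal_mult[symmetric] ennreal_le_iff)
      then have "((L * V) powr (1 / p)) powr p \<le> Z" unfolding Z_def using p by (intro powr_mono2) auto
      then show ?thesis using L V p by (simp add: powr_powr)
    qed
    moreover have "A * W \<le> K * B powr p \<and> (\<integral>\<^sup>+x\<in>hcube a l. min (ennreal (w x)) (ennreal (Z / V)) \<partial>weighted u) \<le>
        ennreal (C * (A powr (1 - \<tau>) * (K * B powr p / A) powr (1 - 1 / p - \<epsilon>) * W powr \<epsilon>)) * tilted h a l"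
      if WZ: "W \<le> Z"
    proof
      have Z: "0 < Z" using W WZ by linarith
      show "A * W \<le> K * B powr p" using mult_left_mono[OF WZ, of A] A Z_le by linarith
      have "(\<integral>\<^sup>+x\<in>hcube a l. min (ennreal (w x)) (ennreal (Z / V)) \<partial>weighted u)
          \<le> ennreal (C * (W / Z) powr \<epsilon>0 * (Z / V)) * emeasure (weighted u) (hcube a l)"
      proof (rule trunc)
        have "ennreal W = ennreal (W / Z * (Z / V)) * ennreal V"
          using W Z V by (subst ennreal_mult[symmetric]) auto
        then show "emeasure (weighted w) (hcube a l) \<le> ennreal (W / Z * (Z / V)) * emeasure lebesgue (hcube a l)"
          using W l by (simp add: emeasure_hcube V_def)
      qed (use l Z V W WZ in auto)
      also have "\<dots> = ennreal (C * (W / Z) powr \<epsilon>0 * (Z / V) * (A * V))"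
      proof -
        have "emeasure (weighted u) (hcube a l) = ennreal (A * V)"
          using A_inf_wmass[OF u l, of a] V l by (simp add: A_def avg_u_def V_def)
        then show ?thesis using C Z V A by (simp only:) (subst ennreal_mult, auto)
      qed
      also have "\<dots> \<le> ennreal (C * (A powr (1 - \<tau>) * (K * B powr p / A) powr (1 - 1 / p - \<epsilon>) * W powr \<epsilon>) * J)"
      proof (rule ennreal_leI)
        have "(W / Z) powr \<epsilon>0 \<le> (W / Z) powr \<epsilon>" using W Z WZ \<epsilon> by (intro powr_mono') auto
        then have "C * (W / Z) powr \<epsilon>0 * (Z / V) * (A * V) \<le> C * (W / Z) powr \<epsilon> * (Z / V) * (A * V)"
          using C Z V A by (intro mult_left_mono mult_right_mono) auto
        also have "\<dots> = C * A * W powr \<epsilon> * (Z powr (1 / p) * Z powr (1 - 1 / p - \<epsilon>))"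
        proof -
          have "(W / Z) powr \<epsilon> * Z = W powr \<epsilon> * (Z powr (1 / p) * Z powr (1 - 1 / p - \<epsilon>))"
          proof -
            obtain b where b: "W = exp b" using W by (metis exp_ln)
            obtain k where k: "Z = exp k" using Z by (metis exp_ln)
            show ?thesis
              unfolding b k exp_powr_real exp_add[symmetric] exp_diff[symmetric]
              by (simp add: algebra_simps)
          qed
          moreover have "C * (W / Z) powr \<epsilon> * (Z / V) * (A * V) = C * A * ((W / Z) powr \<epsilon> * Z)"
            using V by simp
          ultimately show ?thesis by simp
        qed
        also have "\<dots> \<le> C * A * W powr \<epsilon> * (Z powr (1 / p) * (K * B powr p / A) powr (1 - 1 / p - \<epsilon>))"
        proof -
          have "Z powr (1 - 1 / p - \<epsilon>) \<le> (K * B powr p / A) powr (1 - 1 / p - \<epsilon>)"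
            using Z_le Z A \<epsilon> by (intro powr_mono2) (auto simp: field_simps)
          then show ?thesis using C A by (intro mult_left_mono) auto
        qed
        also have "\<dots> = C * (A powr (1 - \<tau>) * (K * B powr p / A) powr (1 - 1 / p - \<epsilon>) * W powr \<epsilon>) * J"
          unfolding root using A powr_add[of A 1 "-\<tau>"] by simp
        finally show "C * (W / Z) powr \<epsilon>0 * (Z / V) * (A * V) \<le>
            C * (A powr (1 - \<tau>) * (K * B powr p / A) powr (1 - 1 / p - \<epsilon>) * W powr \<epsilon>) * J" .
      qed
      also have "\<dots> = ennreal (C * (A powr (1 - \<tau>) * (K * B powr p / A) powr (1 - 1 / p - \<epsilon>) * W powr \<epsilon>)) * tilted h a l"
        unfolding J using C J by (intro ennreal_mult) auto
      finally show "(\<integral>\<^sup>+x\<in>hcube a l. min (ennreal (w x)) (ennreal (Z / V)) \<partial>weighted u) \<le>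
        ennreal (C * (A powr (1 - \<tau>) * (K * B powr p / A) powr (1 - 1 / p - \<epsilon>) * W powr \<epsilon>)) * tilted h a l" .
    qed
    ultimately show "\<exists>Z. cube_level C \<epsilon> h B a l Z"
      unfolding cube_level_def term_weight_def V_def[symmetric] A_def[symmetric] W_def[symmetric]
      by (intro exI[of _ Z]) blast
  qed (use C \<epsilon> in auto)
qed

text \<open>
  The union bound over all grid cubes: a point of \<open>E\<close> with its cube \<open>Q\<close> and its level \<open>L\<close> satisfies
  \<open>w(x) \<le> L \<le> Z/\<bar>Q\<bar>\<close> and \<open>w(Q) \<le> Z\<close>, so that the single term of \<open>Q\<close> already dominates \<open>u(x) w(x)\<close>.
\<close>

lemma mixed_mass_bound:
  obtains C where "0 < C"
    "\<And>h B E. h \<in> borel_measurable lebesgue \<Longrightarrow> \<forall>x. 0 \<le> h x \<Longrightarrow> 0 < B \<Longrightarrow>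
      (\<integral>\<^sup>+x. ennreal (h x) \<partial>lebesgue) \<le> ennreal B \<Longrightarrow>
      AE x in lebesgue. x \<in> E \<longrightarrow> covered h x \<Longrightarrow>
      (\<integral>\<^sup>+x\<in>E. ennreal (u x * w x) \<partial>lebesgue) \<le> ennreal (C * B powr p)"
proof -
  obtain C \<epsilon> where C: "0 < C" and \<epsilon>: "0 < \<epsilon>" "\<epsilon> \<le> \<tau>" "\<epsilon> \<le> 1 - 1 / p"
    and contrib: "\<And>a l h B. 0 < l \<Longrightarrow> h \<in> borel_measurable lebesgue \<Longrightarrow> \<forall>x. 0 \<le> h x \<Longrightarrow> 0 < B \<Longrightarrow>
      (\<integral>\<^sup>+x. ennreal (h x) \<partial>lebesgue) \<le> ennreal B \<Longrightarrow>
      \<exists>Z. cube_level C \<epsilon> h B a l Z"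
    by (rule cube_contribution) (rule that)
  obtain D where D: "1 \<le> D"
    "\<And>a b l. 0 < l \<Longrightarrow> hcube b l \<subseteq> hcube a (2 * l) \<Longrightarrow> wmass w a (2 * l) \<le> D * wmass w b l"
    by (rule A_inf_doubling[OF w]) (rule that)
  obtain G where G: "0 < G"
    "\<And>(c :: int \<times> ('n \<Rightarrow> int) \<Rightarrow> real) x b M. 0 < b \<Longrightarrow> 0 \<le> M \<Longrightarrow>
      \<forall>k z. x \<in> grid_cube k z \<longrightarrow> 0 \<le> c (k, z) \<and>
         c (k, z) \<le> M * min ((b * reach_mass w x k) powr \<epsilon>) ((b * reach_mass w x k) powr - \<epsilon>) \<Longrightarrow>
      (\<integral>\<^sup>+i. ennreal (c i) * indicator (grid_cube (fst i) (snd i)) x \<partial>count_space UNIV) \<le> ennreal (G * M)"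
    by (rule grid_sum_bound[OF w \<epsilon>(1)]) (rule that)
  note [measurable] = A_infD(1)[OF w] A_infD(1)[OF u]
  note upos = A_infD(2)[OF u] and wpos = A_infD(2)[OF w]
  define s where "s = 1 - 1 / p - \<epsilon>"
  define C2 where "C2 = K powr s * ((K\<^sup>2) powr (\<tau> + \<epsilon>) + K powr (\<tau> + \<epsilon>) * D powr \<tau>)"
  have C2: "0 < C2" using K D by (auto simp: C2_def intro!: mult_pos_pos add_pos_pos)
  show ?thesis
  proof (rule that[of "G * (C * C2)"])
    show "0 < G * (C * C2)" using G C C2 by simp
    fix h :: "real ^ 'n \<Rightarrow> real" and B :: real and E :: "(real ^ 'n) set"
    assume h[measurable]: "h \<in> borel_measurable lebesgue" and h0': "\<forall>x. 0 \<le> h x" and B: "0 < B"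
      and hB: "(\<integral>\<^sup>+x. ennreal (h x) \<partial>lebesgue) \<le> ennreal B"
      and E: "AE x in lebesgue. x \<in> E \<longrightarrow> covered h x"
    have h0: "0 \<le> h x" for x using h0' by blast
    let ?I = "UNIV :: (int \<times> ('n \<Rightarrow> int)) set"
    define Q where "Q = (\<lambda>i :: int \<times> ('n \<Rightarrow> int). grid_cube (fst i) (snd i))"
    define V where "V = (\<lambda>i :: int \<times> ('n \<Rightarrow> int). grid_side (fst i) ^ CARD('n))"
    define W where "W = (\<lambda>i :: int \<times> ('n \<Rightarrow> int). wmass w (grid_corner (fst i) (snd i)) (grid_side (fst i)))"
    define A where "A = (\<lambda>i :: int \<times> ('n \<Rightarrow> int). avg_u (grid_corner (fst i) (snd i)) (grid_side (fst i)))"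
    define J where "J = (\<lambda>i :: int \<times> ('n \<Rightarrow> int). tilted h (grid_corner (fst i) (snd i)) (grid_side (fst i)))"
    have Q[measurable]: "Q i \<in> sets lebesgue" for i by (simp add: Q_def)
    have V: "0 < V i" for i by (simp add: V_def)
    have W: "0 < W i" for i unfolding W_def by (intro A_inf_wmass(2)[OF w]) simp
    have A: "0 < A i" for i unfolding A_def by (intro avg_u_pos) simp
    have "\<forall>i. \<exists>Z. cube_level C \<epsilon> h B (grid_corner (fst i) (snd i)) (grid_side (fst i)) Z"
      using h h0 B hB by (intro allI contrib) auto
    from choice[OF this] obtain Z where
      Z: "\<forall>i. cube_level C \<epsilon> h B (grid_corner (fst i) (snd i)) (grid_side (fst i)) (Z i)" ..
    have Z1: "\<And>i L. 0 < L \<Longrightarrow> ennreal ((L * V i) powr (1 / p)) \<le> ennreal (A i powr - \<tau>) * J i \<Longrightarrow> L * V i \<le> Z i"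
      and Z2: "\<And>i. W i \<le> Z i \<Longrightarrow> A i * W i \<le> K * B powr p"
      and Z3: "\<And>i. W i \<le> Z i \<Longrightarrow> (\<integral>\<^sup>+x\<in>Q i. min (ennreal (w x)) (ennreal (Z i / V i)) \<partial>weighted u) \<le>
          ennreal (C * (A i powr (1 - \<tau>) * (K * B powr p / A i) powr s * W i powr \<epsilon>)) * J i"
      using Z unfolding cube_level_def term_weight_def Q_def V_def W_def A_def J_def s_def by blast+
    define c where "c = (\<lambda>i. if W i \<le> Z i then C * (A i powr (1 - \<tau>) * (K * B powr p / A i) powr s * W i powr \<epsilon>) else 0)"
    have c0: "0 \<le> c i" for i using C by (simp add: c_def)
    \<comment> \<open>Only cubes with \<open>w(Q) \<le> Z\<close> can carry points of \<open>E\<close>; for the others there is no gain from the truncation.\<close>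
    define f where "f = (\<lambda>i x. if W i \<le> Z i then ennreal (u x) * (min (ennreal (w x)) (ennreal (Z i / V i)) * indicator (Q i) x) else 0)"
    have f[measurable]: "f i \<in> borel_measurable lebesgue" for i unfolding f_def by measurable
    have "(\<integral>\<^sup>+x\<in>E. ennreal (u x * w x) \<partial>lebesgue) \<le> (\<integral>\<^sup>+x. \<integral>\<^sup>+i. f i x \<partial>count_space ?I \<partial>lebesgue)"
    proof (rule nn_integral_mono_AE)
      show "AE x in lebesgue. ennreal (u x * w x) * indicator E x \<le> (\<integral>\<^sup>+i. f i x \<partial>count_space ?I)"
        using E
      proof eventually_elim
        case (elim x)
        show ?case
        proof (cases "x \<in> E")
          case True
          then obtain k z L where kzL: "x \<in> grid_cube k z" "0 < L" "w x \<le> L"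
            "wmass w (grid_corner k z) (grid_side k) \<le> L * grid_side k ^ CARD('n)"
            "ennreal ((L * grid_side k ^ CARD('n)) powr (1 / p)) \<le>
              ennreal (avg_u (grid_corner k z) (grid_side k) powr - \<tau>) * tilted h (grid_corner k z) (grid_side k)"
            using elim unfolding covered_def by blast
          define i where "i = (k, z)"
          have i: "x \<in> Q i" "W i \<le> L * V i" "ennreal ((L * V i) powr (1 / p)) \<le> ennreal (A i powr - \<tau>) * J i"
            using kzL by (simp_all add: i_def Q_def W_def V_def A_def J_def)
          have LZ: "L * V i \<le> Z i" using Z1[OF kzL(2) i(3)] .
          then have "L \<le> Z i / V i" using V[of i] by (simp add: field_simps)
          then have "w x \<le> Z i / V i" using kzL by linarith
          then have "ennreal (u x * w x) * indicator E x = f i x"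
            using True i LZ upos[of x] wpos[of x]
            by (simp add: f_def min_def ennreal_mult ennreal_leI)
          also have "\<dots> \<le> (\<integral>\<^sup>+i. f i x \<partial>count_space ?I)"
            by (rule nn_integral_ge_point) simp
          finally show ?thesis .
        qed simp
      qed
    qed
    also have "\<dots> = (\<integral>\<^sup>+i. \<integral>\<^sup>+x. f i x \<partial>lebesgue \<partial>count_space ?I)"
      by (rule nn_integral_count_space_nn_integral) auto
    also have "\<dots> \<le> (\<integral>\<^sup>+i. \<integral>\<^sup>+x. ennreal (c i) * (ennreal (h x * u x powr - \<tau>) * indicator (Q i) x) \<partial>lebesgue \<partial>count_space ?I)"
    proof (rule nn_integral_mono)
      fix i
      have "(\<integral>\<^sup>+x. f i x \<partial>lebesgue) \<le> ennreal (c i) * J i"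
      proof (cases "W i \<le> Z i")
        case True
        have "(\<integral>\<^sup>+x. f i x \<partial>lebesgue) = (\<integral>\<^sup>+x\<in>Q i. min (ennreal (w x)) (ennreal (Z i / V i)) \<partial>weighted u)"
          using True by (subst nn_integral_density) (auto simp: f_def)
        also have "\<dots> \<le> ennreal (c i) * J i" using Z3[OF True] True by (simp add: c_def)
        finally show ?thesis .
      qed (simp add: f_def)
      also have "ennreal (c i) * J i = (\<integral>\<^sup>+x. ennreal (c i) * (ennreal (h x * u x powr - \<tau>) * indicator (Q i) x) \<partial>lebesgue)"
      proof -
        have "J i = (\<integral>\<^sup>+x. ennreal (h x * u x powr - \<tau>) * indicator (Q i) x \<partial>lebesgue)"
          by (simp add: J_def tilted_def Q_def)
        then show ?thesis by (simp only:) (rule nn_integral_cmult[symmetric], measurable)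
      qed
      finally show "(\<integral>\<^sup>+x. f i x \<partial>lebesgue) \<le> (\<integral>\<^sup>+x. ennreal (c i) * (ennreal (h x * u x powr - \<tau>) * indicator (Q i) x) \<partial>lebesgue)" .
    qed
    also have "\<dots> = (\<integral>\<^sup>+x. \<integral>\<^sup>+i. ennreal (c i) * (ennreal (h x * u x powr - \<tau>) * indicator (Q i) x) \<partial>count_space ?I \<partial>lebesgue)"
      by (rule nn_integral_count_space_nn_integral[symmetric]) auto
    also have "\<dots> = (\<integral>\<^sup>+x. ennreal (h x) * (\<integral>\<^sup>+i. ennreal (c i * u x powr - \<tau>) * indicator (Q i) x \<partial>count_space ?I) \<partial>lebesgue)"
    proof (rule nn_integral_cong)
      fix x
      have "ennreal (c i) * (ennreal (h x * u x powr - \<tau>) * indicator (Q i) x) =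
          ennreal (h x) * (ennreal (c i * u x powr - \<tau>) * indicator (Q i) x)" for i
        using h0[of x] c0[of i] by (simp add: ennreal_mult ac_simps)
      then show "(\<integral>\<^sup>+i. ennreal (c i) * (ennreal (h x * u x powr - \<tau>) * indicator (Q i) x) \<partial>count_space ?I) =
          ennreal (h x) * (\<integral>\<^sup>+i. ennreal (c i * u x powr - \<tau>) * indicator (Q i) x \<partial>count_space ?I)"
        by (simp add: nn_integral_cmult)
    qed
    also have "\<dots> \<le> (\<integral>\<^sup>+x. ennreal (h x) * ennreal (G * (C * C2 * B powr (p - 1))) \<partial>lebesgue)"
    proof (rule nn_integral_mono_AE)
      \<comment> \<open>Countability of the family gives one null set for the \<open>A\<^sub>1\<close> bounds of all cubes.\<close>
      have "AE x in lebesgue. \<forall>i. x \<in> Q i \<longrightarrow> A i \<le> K\<^sup>2 * u x"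
        unfolding AE_all_countable A_def avg_u_def Q_def by (intro allI A1) simp
      then show "AE x in lebesgue. ennreal (h x) * (\<integral>\<^sup>+i. ennreal (c i * u x powr - \<tau>) * indicator (Q i) x \<partial>count_space ?I)
          \<le> ennreal (h x) * ennreal (G * (C * C2 * B powr (p - 1)))"
      proof eventually_elim
        case (elim x)
        show ?case
          unfolding Q_def
        proof (intro mult_left_mono G(2)[where b = "u x / B powr p"] allI impI)
          show "0 < u x / B powr p" using upos[of x] B by simp
          show "0 \<le> C * C2 * B powr (p - 1)" using C C2 by simp
          fix k z assume x: "x \<in> grid_cube k z"
          define i where "i = (k, z)"
          define y where "y = u x / B powr p * reach_mass w x k"
          have "W i \<le> reach_mass w x k"
            unfolding W_def reach_mass_def i_def fst_conv snd_conv
            by (intro wmass_mono[OF w] grid_cube_subset_reach x) auto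
          moreover have "reach_mass w x k \<le> D * W i"
            unfolding W_def reach_mass_def i_def fst_conv snd_conv
            by (intro D(2) grid_cube_subset_reach x) auto
          ultimately have y: "u x * W i / B powr p \<le> y" "y \<le> D * (u x * W i / B powr p)"
            using upos[of x] B by (auto simp: y_def field_simps)
          have y0: "0 < y" using y(1) upos[of x] B W[of i] by (auto intro: less_le_trans[rotated])
          show "0 \<le> c (k, z) * u x powr - \<tau> \<and> c (k, z) * u x powr - \<tau> \<le> C * C2 * B powr (p - 1) *
              min ((u x / B powr p * reach_mass w x k) powr \<epsilon>) ((u x / B powr p * reach_mass w x k) powr - \<epsilon>)"
          proof
            show "0 \<le> c (k, z) * u x powr - \<tau>" using c0 by simp
            show "c (k, z) * u x powr - \<tau> \<le> C * C2 * B powr (p - 1) *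
              min ((u x / B powr p * reach_mass w x k) powr \<epsilon>) ((u x / B powr p * reach_mass w x k) powr - \<epsilon>)"
            proof (cases "W i \<le> Z i")
              case True
              have "A i powr (1 - \<tau>) * (K * B powr p / A i) powr s * W i powr \<epsilon> * u x powr - \<tau>
                  \<le> C2 * B powr (p - 1) * min (y powr \<epsilon>) (y powr - \<epsilon>)"
                unfolding C2_def
              proof (rule coefficient_bound)
                show "A i \<le> K\<^sup>2 * u x" using elim x by (auto simp: i_def Q_def)
                show "A i * W i \<le> K * B powr p" by (rule Z2[OF True])
              qed (use A W upos B y0 D K p \<epsilon> y in \<open>auto simp: \<tau>_def s_def\<close>)
              from mult_left_mono[OF this, of C] C True show ?thesis
                by (simp add: c_def i_def[symmetric] y_def mult.assoc)
            next
              case False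
              then show ?thesis using C C2 by (simp add: c_def i_def[symmetric])
            qed
          qed
        qed simp
      qed
    qed
    also have "\<dots> = (\<integral>\<^sup>+x. ennreal (h x) \<partial>lebesgue) * ennreal (G * (C * C2 * B powr (p - 1)))"
      by (rule nn_integral_multc) simp
    also have "\<dots> \<le> ennreal B * ennreal (G * (C * C2 * B powr (p - 1)))"
      by (intro mult_right_mono hB) simp
    also have "\<dots> = ennreal (G * (C * C2) * B powr p)"
    proof -
      have "B * (G * (C * C2 * B powr (p - 1))) = G * (C * C2) * B powr p"
        using B powr_add[of B 1 "p - 1"] by simp
      then show ?thesis using B G C C2 by (simp add: ennreal_mult[symmetric])
    qed
    finally show "(\<integral>\<^sup>+x\<in>E. ennreal (u x * w x) \<partial>lebesgue) \<le> ennreal (G * (C * C2) * B powr p)" .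
  qed
qed

end

section \<open>The logarithmic factor\<close>

definition logf :: "real \<Rightarrow> real" where
  "logf t = 1 + log_plus t"

lemma logf_ge_1: "1 \<le> logf t"
  by (simp add: logf_def log_plus_def)

lemma logf_pos [simp]: "0 < logf t"
  using logf_ge_1[of t] by linarith

lemma logf_ge_0 [simp]: "0 \<le> logf t"
  using logf_ge_1[of t] by linarith

lemma logf_le_1: "0 \<le> t \<Longrightarrow> t \<le> 1 \<Longrightarrow> logf t = 1"
  by (cases "t = 0") (auto simp: logf_def log_plus_def)

lemma logf_mono: "0 \<le> s \<Longrightarrow> s \<le> t \<Longrightarrow> logf s \<le> logf t"
  by (cases "s = 0") (auto simp: logf_def log_plus_def le_max_iff_disj)

lemma logf_mult: "0 \<le> a \<Longrightarrow> 0 \<le> b \<Longrightarrow> logf (a * b) \<le> logf a * logf b"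
proof (cases "a = 0 \<or> b = 0")
  case True
  then show ?thesis using logf_le_1[of 0] mult_mono[OF logf_ge_1 logf_ge_1, of a b] by auto
next
  case False
  assume "0 \<le> a" "0 \<le> b"
  then have "log_plus (a * b) \<le> log_plus a + log_plus b"
    using False by (auto simp: log_plus_def ln_mult)
  also have "\<dots> \<le> log_plus a + log_plus b + log_plus a * log_plus b"
    by (simp add: log_plus_def)
  finally show ?thesis by (simp add: logf_def algebra_simps)
qed

lemma logf_powr:
  assumes "0 \<le> t" "0 < c"
  shows "logf (t powr c) \<le> max 1 c * logf t"
proof -
  have "log_plus (t powr c) = c * log_plus t"
    using assms by (cases "t = 0") (simp_all add: log_plus_def ln_powr max_mult_distrib_left)
  also have "\<dots> \<le> max 1 c * log_plus t" by (intro mult_right_mono) (auto simp: log_plus_def)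
  finally show ?thesis by (simp add: logf_def distrib_left)
qed

text \<open>
  Powers of the logarithm are dominated by any positive power.
\<close>

lemma logf_powr_le_power:
  assumes "0 \<le> d" "0 < e"
  obtains C where "1 \<le> C" "\<And>t. 0 \<le> t \<Longrightarrow> logf t powr d \<le> C * max 1 t powr e"
proof -
  define e' where "e' = e / (d + 1)"
  have e': "0 < e'" "e' * d \<le> e" using assms by (auto simp: e'_def field_simps)
  show ?thesis
  proof (rule that[of "(1 + 1 / e') powr d"])
    show "1 \<le> (1 + 1 / e') powr d" using e' assms by (intro ge_one_powr_ge_zero) auto
    fix t :: real assume t: "0 \<le> t"
    define s where "s = max 1 t"
    have s: "1 \<le> s" by (simp add: s_def)
    have "logf t \<le> logf s" using t by (intro logf_mono) (auto simp: s_def)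
    also have "logf s = 1 + ln s" using s by (simp add: logf_def log_plus_def)
    also have "ln s = ln (s powr e') / e'" using s e' by (simp add: ln_powr)
    also have "\<dots> \<le> s powr e' / e'"
      using s e' ln_le_minus_one[of "s powr e'"] by (intro divide_right_mono) auto
    also have "1 + s powr e' / e' \<le> (1 + 1 / e') * s powr e'"
      using s e' ge_one_powr_ge_zero[of s e'] by (simp add: algebra_simps)
    finally have "logf t powr d \<le> ((1 + 1 / e') * s powr e') powr d"
      using assms by (intro powr_mono2) auto
    also have "\<dots> = (1 + 1 / e') powr d * s powr (e' * d)" by (simp add: powr_mult powr_powr)
    also have "\<dots> \<le> (1 + 1 / e') powr d * s powr e"
      using s e' by (intro mult_left_mono powr_mono) auto
    finally show "logf t powr d \<le> (1 + 1 / e') powr d * max 1 t powr e" by (simp add: s_def)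
  qed
qed

text \<open>
  The inequality bounds \<open>\<surd>b\<close> by a multiple of \<open>H\<close>, because \<open>\<Lambda>(b)\<^sup>\<delta>\<close> is at most a multiple of \<open>\<surd>b\<close> when
  \<open>b > 1\<close>; taking logarithms preserves comparability with \<open>H\<close>.
\<close>

lemma logf_absorb:
  assumes \<delta>: "0 \<le> \<delta>" and C: "0 < C"
  obtains C' where "0 < C'" "\<And>b H. 0 < b \<Longrightarrow> 0 < H \<Longrightarrow> b \<le> C * logf b powr \<delta> * H \<Longrightarrow> logf b powr \<delta> \<le> C' * logf H powr \<delta>"
proof -
  obtain G where G: "1 \<le> G" "\<And>t. 0 \<le> t \<Longrightarrow> logf t powr \<delta> \<le> G * max 1 t powr (1/2)"
    by (rule logf_powr_le_power[of \<delta> "1/2"]) (use \<delta> in auto)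
  define M where "M = (C * G)\<^sup>2"
  show ?thesis
  proof (rule that[of "(logf M * 2) powr \<delta>"])
    show "0 < (logf M * 2) powr \<delta>" using logf_ge_1[of M] by simp
    fix b H :: real assume b: "0 < b" and H: "0 < H" and le: "b \<le> C * logf b powr \<delta> * H"
    have "logf b \<le> logf M * 2 * logf H"
    proof (cases "b \<le> 1")
      case True
      then have "logf b = 1" using b by (intro logf_le_1) auto
      also have "\<dots> \<le> logf M * 2 * logf H"
        using mult_mono[OF logf_ge_1[of M] logf_ge_1[of H]] by simp
      finally show ?thesis .
    next
      case False
      have "b powr (1/2) * b powr (1/2) = b" using b by (simp add: powr_add[symmetric])
      also have "b \<le> C * (G * b powr (1/2)) * H"
        using le G(2)[of b] False C H b
        by (intro order_trans[OF le] mult_right_mono mult_left_mono) (auto simp: max_def)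
      finally have "b powr (1/2) * b powr (1/2) \<le> (C * G * H) * b powr (1/2)" by (simp add: ac_simps)
      then have "b powr (1/2) \<le> C * G * H" using b by simp
      then have "(b powr (1/2))\<^sup>2 \<le> (C * G * H)\<^sup>2" by (intro power_mono) auto
      also have "(b powr (1/2))\<^sup>2 = b" using b by (simp add: powr_half_sqrt)
      also have "(C * G * H)\<^sup>2 = M * H powr 2" using H by (simp add: M_def power_mult_distrib)
      finally have "logf b \<le> logf (M * H powr 2)" using b by (intro logf_mono) auto
      also have "\<dots> \<le> logf M * logf (H powr 2)" by (intro logf_mult) (auto simp: M_def)
      also have "\<dots> \<le> logf M * (2 * logf H)"
        using logf_powr[of H 2] H by (intro mult_left_mono) auto
      finally show ?thesis by simp
    qed
    then have "logf b powr \<delta> \<le> (logf M * 2 * logf H) powr \<delta>" using \<delta> by (intro powr_mono2) auto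
    then show "logf b powr \<delta> \<le> (logf M * 2) powr \<delta> * logf H powr \<delta>" by (simp only: powr_mult)
  qed
qed

text \<open>
  The hypothesis forces \<open>Y\<close> to be at most a multiple of a power of \<open>X' = max(1, X)\<close>: for \<open>Y > 1\<close> half of the
  surplus \<open>Y\<^sup>e\<close> pays for the logarithm of \<open>Y\<close>, and the other half is at most a multiple of \<open>X'\<^sup>2\<close>. The same
  then holds for \<open>X Y\<close>, and the logarithm turns powers into factors. Bounding \<open>\<Lambda>(XY)\<close> by \<open>\<Lambda>(X) \<Lambda>(Y)\<close> instead would produce a second
  logarithm of \<open>X\<close>.
\<close>

lemma logf_of_product:
  assumes \<delta>: "0 \<le> \<delta>" and e: "0 < e" and c: "0 < c"
  obtains C where "0 < C" "\<And>X Y. 0 \<le> X \<Longrightarrow> 0 < Y \<Longrightarrow>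
    c * Y powr (1 + e) < X * Y * logf (X * Y) powr \<delta> \<Longrightarrow> logf (X * Y) \<le> C * logf X"
proof -
  obtain G1 where G1: "1 \<le> G1" "\<And>t. 0 \<le> t \<Longrightarrow> logf t powr \<delta> \<le> G1 * max 1 t powr 1"
    by (rule logf_powr_le_power[of \<delta> 1]) (use \<delta> in auto)
  obtain G2 where G2: "1 \<le> G2" "\<And>t. 0 \<le> t \<Longrightarrow> logf t powr \<delta> \<le> G2 * max 1 t powr (e/2)"
    by (rule logf_powr_le_power[of \<delta> "e/2"]) (use \<delta> e in auto)
  define M where "M = (G1 * G2 / c) powr (2 / e)"
  define N where "N = 1 + 4 / e"
  have N: "1 \<le> N" using e by (simp add: N_def)
  show ?thesis
  proof (rule that[of "logf M * N"])
    show "0 < logf M * N" using N by simp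
    fix X Y :: real
    assume X: "0 \<le> X" and Y: "0 < Y" and big: "c * Y powr (1 + e) < X * Y * logf (X * Y) powr \<delta>"
    have CN: "1 \<le> logf M * N" using mult_mono[OF logf_ge_1[of M] N] by simp
    show "logf (X * Y) \<le> logf M * N * logf X"
    proof (cases "Y \<le> 1")
      case True
      then have "logf (X * Y) \<le> 1 * logf X" using X Y by (simp add: logf_mono mult_left_le)
      also have "\<dots> \<le> logf M * N * logf X" using CN by (intro mult_right_mono) auto
      finally show ?thesis .
    next
      case False
      define X' where "X' = max 1 X"
      have X': "1 \<le> X'" "X \<le> X'" by (auto simp: X'_def)
      have "logf (X * Y) powr \<delta> \<le> (logf X * logf Y) powr \<delta>"
        using X Y \<delta> by (intro powr_mono2 logf_mult) auto
      also have "\<dots> = logf X powr \<delta> * logf Y powr \<delta>" by (rule powr_mult)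
      also have "\<dots> \<le> (G1 * X') * (G2 * Y powr (e/2))"
        using G1(2)[of X] G2(2)[of Y] G1(1) X Y False by (intro mult_mono) (auto simp: X'_def max_def)
      finally have "X * Y * logf (X * Y) powr \<delta> \<le> X' * Y * ((G1 * X') * (G2 * Y powr (e/2)))"
        using X X' Y by (intro mult_mono) auto
      with big have "c * Y powr (1 + e) < X' * Y * ((G1 * X') * (G2 * Y powr (e/2)))" by linarith
      moreover have "Y powr (1 + e) = Y * (Y powr (e/2) * Y powr (e/2))"
        using Y by (simp add: powr_add[symmetric] powr_mult_base)
      ultimately have "(Y * Y powr (e/2)) * (c * Y powr (e/2)) < (Y * Y powr (e/2)) * (G1 * G2 * X' powr 2)"
        using X' by (simp add: ac_simps power2_eq_square)
      then have "c * Y powr (e/2) < G1 * G2 * X' powr 2"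
        using Y by (subst (asm) mult_less_cancel_left_pos) auto
      then have "Y powr (e/2) \<le> G1 * G2 / c * X' powr 2" using c by (simp add: field_simps)
      then have "(Y powr (e/2)) powr (2/e) \<le> (G1 * G2 / c * X' powr 2) powr (2/e)"
        using e by (intro powr_mono2) auto
      also have "(Y powr (e/2)) powr (2/e) = Y" using Y e by (simp add: powr_powr)
      also have "(G1 * G2 / c * X' powr 2) powr (2/e) = M * X' powr (4/e)"
        unfolding M_def powr_mult powr_powr by simp
      finally have "X * Y \<le> X' * (M * X' powr (4/e))" using X X' Y by (intro mult_mono) auto
      also have "\<dots> = M * X' powr N" using X' unfolding N_def powr_add by simp
      finally have "logf (X * Y) \<le> logf (M * X' powr N)" using X Y by (intro logf_mono) auto
      also have "\<dots> \<le> logf M * logf (X' powr N)" by (intro logf_mult) (auto simp: M_def)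
      also have "\<dots> \<le> logf M * (N * logf X')"
        using logf_powr[of X' N] X' N by (intro mult_left_mono) (auto simp: max_def)
      also have "logf X' = logf X" using X logf_le_1[of X] logf_le_1[of 1] by (auto simp: X'_def max_def)
      finally show ?thesis by simp
    qed
  qed
qed

text \<open>
  The factor \<open>\<Lambda>(U)\<^sup>\<delta>\<close> is replaced by \<open>U\<^sup>\<tau>\<close>, which is possible since \<open>U\<close> is bounded away from zero.
\<close>

lemma logf_factorization:
  assumes p: "1 < p" and \<delta>: "0 \<le> \<delta>" and e: "0 < e" and c: "0 < c" and K: "0 < K" and \<tau>: "0 < \<tau>"
  obtains C where "0 < C" "\<And>F Y U b m. 0 \<le> F \<Longrightarrow> 0 < Y \<Longrightarrow> 0 < U \<Longrightarrow> 0 < b \<Longrightarrow> 0 < m \<Longrightarrow> 1 \<le> K * U \<Longrightarrow>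
    c * Y powr (1 + e) < F * (U * b powr p / m) powr (1 - 1 / p) * Y * logf (F * (U * b powr p / m) powr (1 - 1 / p) * Y) powr \<delta> \<Longrightarrow>
    logf (F * (U * b powr p / m) powr (1 - 1 / p) * Y) powr \<delta> \<le> C * logf b powr \<delta> * (logf F powr \<delta> * logf (1 / m) powr \<delta>) * U powr \<tau>"
proof -
  obtain C1 where C1: "0 < C1" "\<And>X Y. 0 \<le> X \<Longrightarrow> 0 < Y \<Longrightarrow>
    c * Y powr (1 + e) < X * Y * logf (X * Y) powr \<delta> \<Longrightarrow> logf (X * Y) \<le> C1 * logf X"
    by (rule logf_of_product[OF \<delta> e c]) (rule that)
  obtain G where G: "1 \<le> G" "\<And>t. 0 \<le> t \<Longrightarrow> logf t powr \<delta> \<le> G * max 1 t powr \<tau>"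
    by (rule logf_powr_le_power[OF \<delta> \<tau>]) (rule that)
  define N where "N = max 1 K"
  show ?thesis
  proof (rule that[of "(C1 * p) powr \<delta> * (G * N powr \<tau>)"])
    show "0 < (C1 * p) powr \<delta> * (G * N powr \<tau>)" using C1 p G by (auto simp: N_def intro!: mult_pos_pos)
    fix F Y U b m :: real
    assume F: "0 \<le> F" and Y: "0 < Y" and U: "0 < U" and b: "0 < b" and m: "0 < m" and KU: "1 \<le> K * U"
      and big: "c * Y powr (1 + e) < F * (U * b powr p / m) powr (1 - 1 / p) * Y * logf (F * (U * b powr p / m) powr (1 - 1 / p) * Y) powr \<delta>"
    define X where "X = F * (U * b powr p / m) powr (1 - 1 / p)"
    have "logf X \<le> logf F * logf ((U * b powr p / m) powr (1 - 1 / p))"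
      unfolding X_def using F by (intro logf_mult) auto
    also have "\<dots> \<le> logf F * logf (U * b powr p / m)"
    proof (intro mult_left_mono)
      have "logf ((U * b powr p / m) powr (1 - 1 / p)) \<le> max 1 (1 - 1 / p) * logf (U * b powr p / m)"
        using U b m p by (intro logf_powr) auto
      also have "max 1 (1 - 1 / p) = 1" using p by simp
      finally show "logf ((U * b powr p / m) powr (1 - 1 / p)) \<le> logf (U * b powr p / m)" by simp
    qed simp
    also have "\<dots> \<le> logf F * ((logf U * (p * logf b)) * logf (1 / m))"
    proof (intro mult_left_mono)
      have "logf (U * b powr p / m) = logf (U * b powr p * (1 / m))" by simp
      also have "\<dots> \<le> logf (U * b powr p) * logf (1 / m)" using U m by (intro logf_mult) auto
      also have "\<dots> \<le> (logf U * logf (b powr p)) * logf (1 / m)" using U by (intro mult_right_mono logf_mult) auto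
      also have "\<dots> \<le> (logf U * (p * logf b)) * logf (1 / m)"
        using logf_powr[of b p] b p by (intro mult_right_mono mult_left_mono) (auto simp: max_def)
      finally show "logf (U * b powr p / m) \<le> (logf U * (p * logf b)) * logf (1 / m)" .
    qed simp
    finally have LX: "logf X \<le> logf F * ((logf U * (p * logf b)) * logf (1 / m))" .
    have "logf (X * Y) \<le> C1 * logf X"
      using big F Y unfolding X_def by (intro C1(2)) auto
    also have "\<dots> \<le> C1 * (logf F * ((logf U * (p * logf b)) * logf (1 / m)))"
      using LX C1 by (intro mult_left_mono) auto
    finally have "logf (X * Y) powr \<delta> \<le> (C1 * (logf F * ((logf U * (p * logf b)) * logf (1 / m)))) powr \<delta>"
      using \<delta> by (intro powr_mono2) auto
    also have "\<dots> = (C1 * p) powr \<delta> * logf b powr \<delta> * (logf F powr \<delta> * logf (1 / m) powr \<delta>) * logf U powr \<delta>"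
      by (simp only: powr_mult ac_simps)
    also have "\<dots> \<le> (C1 * p) powr \<delta> * logf b powr \<delta> * (logf F powr \<delta> * logf (1 / m) powr \<delta>) * (G * (N powr \<tau> * U powr \<tau>))"
    proof (intro mult_left_mono)
      have "max 1 U \<le> N * U"
      proof -
        have "1 * U \<le> N * U" using U by (intro mult_right_mono) (auto simp: N_def)
        moreover have "K * U \<le> N * U" using U by (intro mult_right_mono) (auto simp: N_def)
        ultimately show ?thesis using KU by simp
      qed
      then have "max 1 U powr \<tau> \<le> (N * U) powr \<tau>" using \<tau> by (intro powr_mono2) auto
      then have "G * max 1 U powr \<tau> \<le> G * (N powr \<tau> * U powr \<tau>)" using G by (simp add: powr_mult)
      with G(2)[of U] U show "logf U powr \<delta> \<le> G * (N powr \<tau> * U powr \<tau>)" by linarith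
    qed auto
    finally show "logf (F * (U * b powr p / m) powr (1 - 1 / p) * Y) powr \<delta> \<le>
      (C1 * p) powr \<delta> * (G * N powr \<tau>) * logf b powr \<delta> * (logf F powr \<delta> * logf (1 / m) powr \<delta>) * U powr \<tau>"
      unfolding X_def by (simp only: ac_simps)
  qed
qed

section \<open>Orlicz averages on one cube\<close>

context mixed_weights
begin

text \<open>
  The density that drives the estimate; for \<open>F = (\<bar>f\<bar>/t)\<^sup>r\<close> it is at most a multiple of
  \<open>\<Phi>\<^sub>\<gamma>(\<bar>f\<bar>/t) \<Psi>(u\<^sup>1\<^sup>/\<^sup>q v)\<close>.
\<close>

definition source :: "real \<Rightarrow> (real ^ 'n \<Rightarrow> real) \<Rightarrow> real ^ 'n \<Rightarrow> real" where
  "source \<delta> F x = F x * (u x * w x) powr (1 / p) * (logf (F x) powr \<delta> * logf (1 / (u x * w x)) powr \<delta>)"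

definition rescaled :: "(real ^ 'n \<Rightarrow> real) \<Rightarrow> real \<Rightarrow> real \<Rightarrow> real ^ 'n \<Rightarrow> real" where
  "rescaled F L l x = F x * (w x / L) powr (1 / p) * (l ^ CARD('n)) powr (1 - 1 / p)"

text \<open>
  For \<open>F = (\<bar>f\<bar>/t)\<^sup>r\<close> and \<open>L = (M\<^sub>\<eta> v(x))\<^sup>q\<close> this is the failure, up to the constant \<open>c\<close>, of the Luxemburg condition
  that would make the contribution of the cube to \<open>M\<^sub>\<gamma>\<^sub>,\<^sub>\<Phi>(fv)(x)\<close> at most \<open>t M\<^sub>\<eta> v(x)\<close>.
\<close>

definition orlicz_large :: "real \<Rightarrow> real \<Rightarrow> (real ^ 'n \<Rightarrow> real) \<Rightarrow> real \<Rightarrow> real ^ 'n \<Rightarrow> real \<Rightarrow> bool" where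
  "orlicz_large \<delta> c F L a l \<longleftrightarrow> ennreal (c * l ^ CARD('n)) <
     (\<integral>\<^sup>+x\<in>hcube a l. ennreal (rescaled F L l x * logf (rescaled F L l x) powr \<delta>) \<partial>lebesgue)"

definition concentrated :: "real \<Rightarrow> real \<Rightarrow> (real ^ 'n \<Rightarrow> real) \<Rightarrow> real ^ 'n \<Rightarrow> bool" where
  "concentrated \<delta> c F x \<longleftrightarrow> (\<exists>k z L. x \<in> grid_cube k z \<and> 0 < L \<and> w x \<le> L \<and>
     wmass w (grid_corner k z) (grid_side k) \<le> L * grid_side k ^ CARD('n) \<and>
     orlicz_large \<delta> c F L (grid_corner k z) (grid_side k))"

lemma source_nonneg: "0 \<le> F x \<Longrightarrow> 0 \<le> source \<delta> F x"
  by (simp add: source_def)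

lemma source_measurable:
  assumes [measurable]: "F \<in> borel_measurable lebesgue"
  shows "source \<delta> F \<in> borel_measurable lebesgue"
proof -
  note [measurable] = A_infD(1)[OF w] A_infD(1)[OF u]
  have [measurable]: "logf \<in> borel_measurable borel" unfolding logf_def log_plus_def by measurable
  show ?thesis unfolding source_def by measurable
qed

lemma tilted_cmult:
  assumes "0 \<le> c" "\<And>x. 0 \<le> h x" and [measurable]: "h \<in> borel_measurable lebesgue"
  shows "tilted (\<lambda>x. c * h x) a l = ennreal c * tilted h a l"
proof -
  note [measurable] = A_infD(1)[OF u]
  have "tilted (\<lambda>x. c * h x) a l = (\<integral>\<^sup>+x. ennreal c * (ennreal (h x * u x powr - \<tau>) * indicator (hcube a l) x) \<partial>lebesgue)"
    unfolding tilted_def using assms(1,2) by (intro nn_integral_cong) (simp add: ennreal_mult mult.assoc)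
  also have "\<dots> = ennreal c * tilted h a l"
    unfolding tilted_def by (rule nn_integral_cmult) measurable
  finally show ?thesis .
qed

text \<open>
  The function \<open>G \<Lambda>(G)\<^sup>\<delta>\<close> is bounded by \<open>c\<^sub>1 Y\<^sup>1\<^sup>+\<^sup>e\<close>, whose integral is at most half of the assumed lower bound
  by the reverse Hoelder inequality, plus \<open>\<Lambda>(b)\<^sup>\<delta>\<close> times the integrand of \<open>tilted\<close>. Applying the resulting
  inequality twice, once to replace \<open>\<Lambda>(b)\<close> by \<open>\<Lambda>(H)\<close> and once for the conclusion, closes the argument.
\<close>

lemma local_estimate:
  assumes \<delta>: "0 \<le> \<delta>" and c0: "0 < c0"
  obtains C where "0 < C"
    "\<And>F a l L H. F \<in> borel_measurable lebesgue \<Longrightarrow> \<forall>x. 0 \<le> F x \<Longrightarrow> 0 < l \<Longrightarrow> 0 < L \<Longrightarrow> 0 < H \<Longrightarrow>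
      wmass w a l \<le> L * l ^ CARD('n) \<Longrightarrow>
      orlicz_large \<delta> c0 F L a l \<Longrightarrow>
      (\<integral>\<^sup>+x. ennreal (source \<delta> F x) \<partial>lebesgue) \<le> ennreal H \<Longrightarrow>
      ennreal ((L * l ^ CARD('n)) powr (1 / p)) \<le>
        ennreal (avg_u a l powr - \<tau>) * tilted (\<lambda>x. C * logf H powr \<delta> * source \<delta> F x) a l"
proof -
  obtain C1 e where C1: "0 < C1" and e: "0 < e" and RH:
    "\<And>a l L. 0 < l \<Longrightarrow> 0 < L \<Longrightarrow>
       emeasure (weighted w) (hcube a l) \<le> ennreal L * emeasure lebesgue (hcube a l) \<Longrightarrow>
       (\<integral>\<^sup>+x\<in>hcube a l. ennreal ((w x / L) powr (1 + e)) \<partial>lebesgue) \<le> ennreal C1 * emeasure lebesgue (hcube a l)"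
    by (rule A_inf_reverse_Hoelder[OF w]) (rule that)
  have \<tau>: "0 < \<tau>" "1 / p = 2 * \<tau>" using p by (auto simp: \<tau>_def)
  define c1 where "c1 = c0 / (2 * C1)"
  have c1: "0 < c1" using c0 C1 by (simp add: c1_def)
  have K2: "0 < K\<^sup>2" using K by simp
  obtain C2 where C2: "0 < C2" and factor: "\<And>F Y U b m. 0 \<le> F \<Longrightarrow> 0 < Y \<Longrightarrow> 0 < U \<Longrightarrow> 0 < b \<Longrightarrow> 0 < m \<Longrightarrow> 1 \<le> K\<^sup>2 * U \<Longrightarrow>
    c1 * Y powr (1 + e) < F * (U * b powr p / m) powr (1 - 1 / p) * Y * logf (F * (U * b powr p / m) powr (1 - 1 / p) * Y) powr \<delta> \<Longrightarrow>
    logf (F * (U * b powr p / m) powr (1 - 1 / p) * Y) powr \<delta> \<le> C2 * logf b powr \<delta> * (logf F powr \<delta> * logf (1 / m) powr \<delta>) * U powr \<tau>"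
    by (rule logf_factorization[OF p \<delta> e c1 K2 \<tau>(1)]) (rule that)
  define C5 where "C5 = 2 * C2 / c0"
  have C5: "0 < C5" using C2 c0 by (simp add: C5_def)
  have C5K: "0 < C5 * (K\<^sup>2) powr \<tau>" using C5 K by simp
  obtain C6 where C6: "0 < C6" "\<And>b H. 0 < b \<Longrightarrow> 0 < H \<Longrightarrow> b \<le> C5 * (K\<^sup>2) powr \<tau> * logf b powr \<delta> * H \<Longrightarrow> logf b powr \<delta> \<le> C6 * logf H powr \<delta>"
    by (rule logf_absorb[OF \<delta> C5K]) (rule that)
  note [measurable] = A_infD(1)[OF w] A_infD(1)[OF u]
  have [measurable]: "logf \<in> borel_measurable borel" unfolding logf_def log_plus_def by measurable
  note upos = A_infD(2)[OF u] and wpos = A_infD(2)[OF w]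
  show ?thesis
  proof (rule that[of "C5 * C6"])
    show "0 < C5 * C6" using C5 C6 by simp
    fix F :: "real ^ 'n \<Rightarrow> real" and a :: "real ^ 'n" and l L H :: real
    assume F[measurable]: "F \<in> borel_measurable lebesgue" and F0': "\<forall>x. 0 \<le> F x" and l: "0 < l" and L: "0 < L"
      and H: "0 < H" and avg: "wmass w a l \<le> L * l ^ CARD('n)"
      and large: "orlicz_large \<delta> c0 F L a l"
      and HF: "(\<integral>\<^sup>+x. ennreal (source \<delta> F x) \<partial>lebesgue) \<le> ennreal H"
    have F0: "0 \<le> F x" for x using F0' by blast
    define G where G: "G = (\<lambda>x. F x * (w x / L) powr (1 / p) * (l ^ CARD('n)) powr (1 - 1 / p))"
    have big: "ennreal (c0 * l ^ CARD('n)) < (\<integral>\<^sup>+x\<in>hcube a l. ennreal (G x * logf (G x) powr \<delta>) \<partial>lebesgue)"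
      using large by (simp add: orlicz_large_def rescaled_def G)
    have [measurable]: "source \<delta> F \<in> borel_measurable lebesgue" by (rule source_measurable) measurable
    define V where "V = l ^ CARD('n)"
    define A where "A = avg_u a l"
    have V: "0 < V" using l by (simp add: V_def)
    have A: "0 < A" using avg_u_pos[OF l] by (simp add: A_def)
    define b where "b = (A * V * L) powr (1 / p)"
    have b: "0 < b" "b powr p = A * V * L" using A V L p by (auto simp: b_def powr_powr)
    define c2 where "c2 = C2 * logf b powr \<delta> * (L powr (- (1 / p)) * V powr (1 - 1 / p) * A powr - \<tau>)"
    have c2: "0 \<le> c2" using C2 by (simp add: c2_def)
    have G0: "0 \<le> G x" for x unfolding G using F0 by simp
    have pointwise: "G x * logf (G x) powr \<delta> \<le> c1 * (w x / L) powr (1 + e) + c2 * (source \<delta> F x * u x powr - \<tau>)"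
      if "A \<le> K\<^sup>2 * u x" for x
    proof (cases "G x * logf (G x) powr \<delta> \<le> c1 * (w x / L) powr (1 + e)")
      case True
      moreover have "0 \<le> c2 * (source \<delta> F x * u x powr - \<tau>)" using c2 F0 source_nonneg by simp
      ultimately show ?thesis by linarith
    next
      case False
      define Y where "Y = w x / L"
      define U where "U = u x / A"
      define m where "m = u x * w x"
      have Y: "0 < Y" and U: "0 < U" and m: "0 < m" using upos wpos L A by (auto simp: Y_def U_def m_def)
      have KU: "1 \<le> K\<^sup>2 * U" using that A by (simp add: U_def field_simps)
      have G_eq: "G x = F x * (U * b powr p / m) powr (1 - 1 / p) * Y"
      proof -
        have "U * b powr p / m = V / Y"
          using A upos[of x] by (simp add: U_def b(2) m_def Y_def)
        then have "(U * b powr p / m) powr (1 - 1 / p) * Y = (V / Y) powr (1 - 1 / p) * Y" by simp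
        also have "\<dots> = V powr (1 - 1 / p) * (Y powr (- (1 - 1 / p)) * Y powr 1)"
          unfolding powr_divide powr_minus_divide using Y by simp
        also have "\<dots> = V powr (1 - 1 / p) * Y powr (1 / p)"
          unfolding powr_add[symmetric] by simp
        finally show ?thesis by (simp add: G V_def Y_def ac_simps)
      qed
      have "logf (G x) powr \<delta> \<le> C2 * logf b powr \<delta> * (logf (F x) powr \<delta> * logf (1 / m) powr \<delta>) * U powr \<tau>"
        using False unfolding G_eq Y_def[symmetric]
        by (intro factor F0 Y U b m KU) simp
      then have "G x * logf (G x) powr \<delta> \<le> G x * (C2 * logf b powr \<delta> * (logf (F x) powr \<delta> * logf (1 / m) powr \<delta>) * U powr \<tau>)"
        using G0 by (intro mult_left_mono) auto
      also have "\<dots> = c2 * (source \<delta> F x * u x powr - \<tau>)"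
      proof -
        have "(w x / L) powr (1 / p) * U powr \<tau> = (u x * w x) powr (1 / p) * u x powr - \<tau> * (L powr (- (1 / p)) * A powr - \<tau>)"
        proof -
          obtain x1 where x1: "w x = exp x1" using wpos by (metis exp_ln)
          obtain x2 where x2: "u x = exp x2" using upos by (metis exp_ln)
          obtain x3 where x3: "L = exp x3" using L by (metis exp_ln)
          obtain x4 where x4: "A = exp x4" using A by (metis exp_ln)
          show ?thesis
            unfolding U_def x1 x2 x3 x4 exp_powr_real exp_add[symmetric] exp_diff[symmetric]
            unfolding \<tau>(2) by (simp add: algebra_simps)
        qed
        then show ?thesis
          unfolding G c2_def source_def V_def[symmetric] m_def[symmetric] by (simp add: ac_simps)
      qed
      finally show ?thesis using c1 by (simp add: add_increasing)
    qed
    have "ennreal (c0 * V) \<le> (\<integral>\<^sup>+x\<in>hcube a l. ennreal (G x * logf (G x) powr \<delta>) \<partial>lebesgue)"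
      using big by (simp add: V_def)
    also have "\<dots> \<le> (\<integral>\<^sup>+x. ennreal c1 * (ennreal ((w x / L) powr (1 + e)) * indicator (hcube a l) x) +
        ennreal c2 * (ennreal (source \<delta> F x * u x powr - \<tau>) * indicator (hcube a l) x) \<partial>lebesgue)"
    proof (rule nn_integral_mono_AE)
      show "AE x in lebesgue. ennreal (G x * logf (G x) powr \<delta>) * indicator (hcube a l) x \<le>
          ennreal c1 * (ennreal ((w x / L) powr (1 + e)) * indicator (hcube a l) x) +
          ennreal c2 * (ennreal (source \<delta> F x * u x powr - \<tau>) * indicator (hcube a l) x)"
        using A1[OF l, of a]
      proof eventually_elim
        case (elim x)
        show ?case
        proof (cases "x \<in> hcube a l")
          case True
          then have "A \<le> K\<^sup>2 * u x" using elim by (simp add: A_def avg_u_def)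
          from ennreal_leI[OF pointwise[OF this]] show ?thesis
            using True c1 c2 F0 source_nonneg[of F x \<delta>] by (simp add: ennreal_mult)
        qed simp
      qed
    qed
    also have "\<dots> = ennreal c1 * (\<integral>\<^sup>+x\<in>hcube a l. ennreal ((w x / L) powr (1 + e)) \<partial>lebesgue) +
        ennreal c2 * tilted (source \<delta> F) a l"
      unfolding tilted_def by (subst nn_integral_add) (auto simp: nn_integral_cmult)
    also have "\<dots> \<le> ennreal c1 * (ennreal C1 * emeasure lebesgue (hcube a l)) + ennreal c2 * tilted (source \<delta> F) a l"
    proof (intro add_right_mono mult_left_mono RH l L)
      show "emeasure (weighted w) (hcube a l) \<le> ennreal L * emeasure lebesgue (hcube a l)"
        using avg A_inf_wmass[OF w l, of a] l L by (simp add: emeasure_hcube ennreal_mult[symmetric] ennreal_leI)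
    qed simp
    also have "ennreal c1 * (ennreal C1 * emeasure lebesgue (hcube a l)) = ennreal (c0 * V / 2)"
      using c1 C1 V l by (simp add: emeasure_hcube V_def[symmetric] ennreal_mult[symmetric] c1_def)
    finally have le: "ennreal (c0 * V) \<le> ennreal (c0 * V / 2) + ennreal c2 * tilted (source \<delta> F) a l" .
    have T: "tilted (source \<delta> F) a l \<le> ennreal ((K\<^sup>2 / A) powr \<tau> * H)"
      unfolding A_def using l HF H F0 source_nonneg by (intro tilted_le) auto
    then obtain J where J: "tilted (source \<delta> F) a l = ennreal J" "0 \<le> J"
      by (cases "tilted (source \<delta> F) a l") (auto simp: top_unique)
    have J_le: "J \<le> (K\<^sup>2 / A) powr \<tau> * H" using T J H by (simp add: ennreal_le_iff)
    have "c0 * V \<le> c0 * V / 2 + c2 * J"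
      using le c0 V c2 J by (simp add: ennreal_mult[symmetric] ennreal_plus[symmetric] ennreal_le_iff del: ennreal_plus)
    then have cJ: "V \<le> 2 / c0 * c2 * J" using c0 by (simp add: field_simps)
    have root: "(L * V) powr (1 / p) \<le> C5 * logf b powr \<delta> * A powr - \<tau> * J"
    proof -
      have "(L * V) powr (1 / p) = L powr (1 / p) * V powr (1 / p - 1) * V"
        using V powr_add[of V "1 / p - 1" 1] by (simp add: powr_mult)
      also have "\<dots> \<le> L powr (1 / p) * V powr (1 / p - 1) * (2 / c0 * c2 * J)"
        using cJ by (intro mult_left_mono) auto
      also have "\<dots> = C5 * logf b powr \<delta> * A powr - \<tau> * J * ((L powr (1 / p) * L powr (- (1 / p))) * (V powr (1 / p - 1) * V powr (1 - 1 / p)))"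
        unfolding c2_def C5_def by (simp add: ac_simps)
      also have "(L powr (1 / p) * L powr (- (1 / p))) * (V powr (1 / p - 1) * V powr (1 - 1 / p)) = 1"
        using L V by (simp add: powr_add[symmetric])
      finally show ?thesis by simp
    qed
    have "logf b powr \<delta> \<le> C6 * logf H powr \<delta>"
    proof (rule C6(2)[OF b(1) H])
      have "b = A powr (1 / p) * (L * V) powr (1 / p)"
        unfolding b_def powr_mult[symmetric] by (simp add: ac_simps)
      also have "\<dots> \<le> A powr (1 / p) * (C5 * logf b powr \<delta> * A powr - \<tau> * ((K\<^sup>2 / A) powr \<tau> * H))"
        using root J_le C5 by (intro mult_left_mono order_trans[OF root]) auto
      also have "\<dots> = C5 * (K\<^sup>2) powr \<tau> * logf b powr \<delta> * H * (A powr (1 / p) * A powr - \<tau> * A powr - \<tau>)"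
        using A by (simp add: powr_divide powr_minus field_simps)
      also have "A powr (1 / p) * A powr - \<tau> * A powr - \<tau> = 1"
        unfolding \<tau>(2) using A by (simp add: powr_add[symmetric])
      finally show "b \<le> C5 * (K\<^sup>2) powr \<tau> * logf b powr \<delta> * H" by simp
    qed
    then have "C5 * logf b powr \<delta> * A powr - \<tau> * J \<le> C5 * (C6 * logf H powr \<delta>) * A powr - \<tau> * J"
      using C5 J by (intro mult_right_mono mult_left_mono) auto
    with root have "(L * V) powr (1 / p) \<le> A powr - \<tau> * (C5 * C6 * logf H powr \<delta> * J)"
      by (simp add: ac_simps)
    then have "ennreal ((L * V) powr (1 / p)) \<le> ennreal (A powr - \<tau>) * (ennreal (C5 * C6 * logf H powr \<delta>) * ennreal J)"
      using C5 C6 J by (simp add: ennreal_mult[symmetric] ennreal_leI)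
    also have "ennreal (C5 * C6 * logf H powr \<delta>) * ennreal J = tilted (\<lambda>x. C5 * C6 * logf H powr \<delta> * source \<delta> F x) a l"
      unfolding J(1)[symmetric] using C5 C6 F0 source_nonneg by (intro tilted_cmult[symmetric]) auto
    finally show "ennreal ((L * l ^ CARD('n)) powr (1 / p)) \<le>
        ennreal (avg_u a l powr - \<tau>) * tilted (\<lambda>x. C5 * C6 * logf H powr \<delta> * source \<delta> F x) a l"
      by (simp add: V_def A_def)
  qed
qed

text \<open>
  The logarithm \<open>\<Lambda>(H)\<^sup>\<delta>\<close> of the local estimate multiplies the density, which turns \<open>B\<^sup>p\<close> into
  \<open>(H \<Lambda>(H)\<^sup>\<delta>)\<^sup>p\<close>, the value \<open>\<phi>(H)\<close>.
\<close>

lemma level_set_mass_bound: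
  assumes \<delta>: "0 \<le> \<delta>" and c0: "0 < c0"
  obtains C where "0 < C"
    "\<And>F H E. F \<in> borel_measurable lebesgue \<Longrightarrow> \<forall>x. 0 \<le> F x \<Longrightarrow> 0 < H \<Longrightarrow>
      (\<integral>\<^sup>+x. ennreal (source \<delta> F x) \<partial>lebesgue) \<le> ennreal H \<Longrightarrow>
      AE x in lebesgue. x \<in> E \<longrightarrow> concentrated \<delta> c0 F x \<Longrightarrow>
      (\<integral>\<^sup>+x\<in>E. ennreal (u x * w x) \<partial>lebesgue) \<le> ennreal (C * (H * logf H powr \<delta>) powr p)"
proof -
  obtain C1 where C1: "0 < C1" and loc:
    "\<And>F a l L H. F \<in> borel_measurable lebesgue \<Longrightarrow> \<forall>x. 0 \<le> F x \<Longrightarrow> 0 < l \<Longrightarrow> 0 < L \<Longrightarrow> 0 < H \<Longrightarrow>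
      wmass w a l \<le> L * l ^ CARD('n) \<Longrightarrow>
      orlicz_large \<delta> c0 F L a l \<Longrightarrow>
      (\<integral>\<^sup>+x. ennreal (source \<delta> F x) \<partial>lebesgue) \<le> ennreal H \<Longrightarrow>
      ennreal ((L * l ^ CARD('n)) powr (1 / p)) \<le>
        ennreal (avg_u a l powr - \<tau>) * tilted (\<lambda>x. C1 * logf H powr \<delta> * source \<delta> F x) a l"
    by (rule local_estimate[OF \<delta> c0]) (rule that)
  obtain C2 where C2: "0 < C2" and glob:
    "\<And>h B E. h \<in> borel_measurable lebesgue \<Longrightarrow> \<forall>x. 0 \<le> h x \<Longrightarrow> 0 < B \<Longrightarrow>
      (\<integral>\<^sup>+x. ennreal (h x) \<partial>lebesgue) \<le> ennreal B \<Longrightarrow>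
      AE x in lebesgue. x \<in> E \<longrightarrow> covered h x \<Longrightarrow>
      (\<integral>\<^sup>+x\<in>E. ennreal (u x * w x) \<partial>lebesgue) \<le> ennreal (C2 * B powr p)"
    by (rule mixed_mass_bound) (rule that)
  show ?thesis
  proof (rule that[of "C2 * C1 powr p"])
    show "0 < C2 * C1 powr p" using C1 C2 by simp
    fix F :: "real ^ 'n \<Rightarrow> real" and H :: real and E :: "(real ^ 'n) set"
    assume F: "F \<in> borel_measurable lebesgue" "\<forall>x. 0 \<le> F x" and H: "0 < H"
      and HF: "(\<integral>\<^sup>+x. ennreal (source \<delta> F x) \<partial>lebesgue) \<le> ennreal H"
      and E: "AE x in lebesgue. x \<in> E \<longrightarrow> concentrated \<delta> c0 F x"
    have [measurable]: "source \<delta> F \<in> borel_measurable lebesgue" by (rule source_measurable[OF F(1)])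
    let ?c = "C1 * logf H powr \<delta>"
    have c: "0 < ?c" using C1 logf_pos[of H] by (auto intro!: mult_pos_pos simp del: logf_pos)
    have "(\<integral>\<^sup>+x\<in>E. ennreal (u x * w x) \<partial>lebesgue) \<le> ennreal (C2 * (?c * H) powr p)"
    proof (rule glob)
      show "(\<lambda>x. ?c * source \<delta> F x) \<in> borel_measurable lebesgue" by measurable
      show "\<forall>x. 0 \<le> ?c * source \<delta> F x" using less_imp_le[OF c] F(2) source_nonneg by (metis mult_nonneg_nonneg)
      show "0 < ?c * H" using c H by simp
      have "(\<integral>\<^sup>+x. ennreal (?c * source \<delta> F x) \<partial>lebesgue) = (\<integral>\<^sup>+x. ennreal ?c * ennreal (source \<delta> F x) \<partial>lebesgue)"
        using c F(2) by (intro nn_integral_cong ennreal_mult) (auto intro!: source_nonneg)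
      also have "\<dots> = ennreal ?c * (\<integral>\<^sup>+x. ennreal (source \<delta> F x) \<partial>lebesgue)"
        by (rule nn_integral_cmult) measurable
      also have "\<dots> \<le> ennreal ?c * ennreal H" by (intro mult_left_mono HF) simp
      also have "\<dots> = ennreal (?c * H)" using c H by (intro ennreal_mult[symmetric]) auto
      finally show "(\<integral>\<^sup>+x. ennreal (?c * source \<delta> F x) \<partial>lebesgue) \<le> ennreal (?c * H)" .
      show "AE x in lebesgue. x \<in> E \<longrightarrow> covered (\<lambda>x. ?c * source \<delta> F x) x"
        using E
      proof eventually_elim
        case (elim x)
        show ?case
        proof
          assume "x \<in> E"
          then obtain k z L where *: "x \<in> grid_cube k z" "0 < L" "w x \<le> L"
            "wmass w (grid_corner k z) (grid_side k) \<le> L * grid_side k ^ CARD('n)"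
            "orlicz_large \<delta> c0 F L (grid_corner k z) (grid_side k)"
            using elim unfolding concentrated_def by blast
          have side: "0 < grid_side k" by simp
          from loc[OF F side *(2) H *(4,5) HF] *(1-4)
          show "covered (\<lambda>x. ?c * source \<delta> F x) x" unfolding covered_def by blast
        qed
      qed
    qed
    also have "C2 * (?c * H) powr p = C2 * C1 powr p * (H * logf H powr \<delta>) powr p"
      by (simp only: powr_mult ac_simps)
    finally show "(\<integral>\<^sup>+x\<in>E. ennreal (u x * w x) \<partial>lebesgue) \<le> ennreal (C2 * C1 powr p * (H * logf H powr \<delta>) powr p)" .
  qed
qed

end

section \<open>Luxemburg averages and the level sets of the quotient\<close>

lemma luxemburg_lessD:
  assumes "luxemburg \<theta> Q f < ennreal c"
  obtains c' where "0 < c'" "c' < c" "average Q (\<lambda>y. \<theta> (\<bar>f y\<bar> / c')) \<le> 1"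
proof -
  from assms obtain c' where c': "0 < c'" "average Q (\<lambda>y. \<theta> (\<bar>f y\<bar> / c')) \<le> 1" "ennreal c' < ennreal c"
    unfolding luxemburg_def Inf_less_iff by blast
  moreover from c' have "c' < c" by (simp add: ennreal_less_iff)
  ultimately show ?thesis using that by blast
qed

lemma luxemburg_le:
  "0 < c \<Longrightarrow> average Q (\<lambda>y. \<theta> (\<bar>f y\<bar> / c)) \<le> 1 \<Longrightarrow> luxemburg \<theta> Q f \<le> ennreal c"
  unfolding luxemburg_def by (rule Inf_lower) blast

lemma average_le_1_iff:
  fixes a :: "real ^ 'n"
  assumes "0 < l"
  shows "average (cbox a (\<chi> i. a $ i + l)) g \<le> 1 \<longleftrightarrow> mass g (cbox a (\<chi> i. a $ i + l)) \<le> ennreal (l ^ CARD('n))"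
proof -
  have l: "0 < l ^ CARD('n)" using assms by simp
  have "x / ennreal (l ^ CARD('n)) \<le> 1 \<longleftrightarrow> x \<le> ennreal (l ^ CARD('n))" for x
  proof
    assume "x / ennreal (l ^ CARD('n)) \<le> 1"
    then have "x / ennreal (l ^ CARD('n)) * ennreal (l ^ CARD('n)) \<le> 1 * ennreal (l ^ CARD('n))"
      by (intro mult_right_mono) auto
    then show "x \<le> ennreal (l ^ CARD('n))" using assms by (simp add: ennreal_divide_times divide_ennreal)
  next
    assume "x \<le> ennreal (l ^ CARD('n))"
    then have "x / ennreal (l ^ CARD('n)) \<le> ennreal (l ^ CARD('n)) / ennreal (l ^ CARD('n))"
      by (rule divide_right_mono_ennreal)
    also have "\<dots> = 1" using assms by (simp add: divide_ennreal)
    finally show "x / ennreal (l ^ CARD('n)) \<le> 1" .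
  qed
  then show ?thesis unfolding average_def using assms by (simp add: emeasure_cube)
qed

text \<open>
  Since \<open>\<eta>\<close> dominates the power \<open>q\<close>, an admissible constant \<open>c'\<close> for the Luxemburg average bounds the
  \<open>L\<^sup>q\<close> average of \<open>v\<close>.
\<close>

lemma power_mass_le_if_maximal_less:
  fixes v :: "real ^ 'n \<Rightarrow> real"
  assumes v: "AE x in lebesgue. 0 < v x" "v \<in> borel_measurable lebesgue" and \<eta>: "\<And>t. 0 \<le> t \<Longrightarrow> t powr q \<le> \<eta> t" and q: "0 < q"
    and l: "0 < l" and x: "x \<in> cbox a (\<chi> i. a $ i + l)" and less: "maximal \<eta> v x < ennreal c"
  shows "mass (\<lambda>x. v x powr q) (cbox a (\<chi> i. a $ i + l)) \<le> ennreal (c powr q * l ^ CARD('n))"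
proof -
  note [measurable] = v(2)
  let ?Q = "cbox a (\<chi> i. a $ i + l)"
  have "luxemburg \<eta> ?Q v \<le> maximal \<eta> v x"
    unfolding maximal_def using x l by (intro SUP_upper) (auto simp: cube_def)
  then have "luxemburg \<eta> ?Q v < ennreal c" using less by (rule le_less_trans)
  then obtain c' where c': "0 < c'" "c' < c" "average ?Q (\<lambda>y. \<eta> (\<bar>v y\<bar> / c')) \<le> 1" by (rule luxemburg_lessD)
  then have le: "mass (\<lambda>y. \<eta> (\<bar>v y\<bar> / c')) ?Q \<le> ennreal (l ^ CARD('n))" using average_le_1_iff[OF l] by blast
  have "mass (\<lambda>x. v x powr q) ?Q \<le> (\<integral>\<^sup>+x. ennreal (c' powr q) * (ennreal ((\<bar>v x\<bar> / c') powr q) * indicator ?Q x) \<partial>lebesgue)"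
    unfolding mass_def
  proof (rule nn_integral_mono_AE)
    show "AE x in lebesgue. ennreal (v x powr q) * indicator ?Q x \<le> ennreal (c' powr q) * (ennreal ((\<bar>v x\<bar> / c') powr q) * indicator ?Q x)"
      using v(1)
    proof eventually_elim
      case (elim x)
      have "v x powr q = c' powr q * (\<bar>v x\<bar> / c') powr q"
        unfolding powr_mult[symmetric] using elim c' by simp
      then show ?case by (simp add: ennreal_mult mult.assoc)
    qed
  qed
  also have "\<dots> = ennreal (c' powr q) * (\<integral>\<^sup>+x\<in>?Q. ennreal ((\<bar>v x\<bar> / c') powr q) \<partial>lebesgue)"
  proof (rule nn_integral_cmult)
    have [measurable]: "?Q \<in> sets lebesgue" by simp
    show "(\<lambda>x. ennreal ((\<bar>v x\<bar> / c') powr q) * indicator ?Q x) \<in> borel_measurable lebesgue" by measurable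
  qed
  also have "\<dots> \<le> ennreal (c' powr q) * mass (\<lambda>y. \<eta> (\<bar>v y\<bar> / c')) ?Q"
    unfolding mass_def using \<eta> c' by (intro mult_left_mono nn_integral_mono mult_right_mono ennreal_leI) auto
  also have "\<dots> \<le> ennreal (c' powr q) * ennreal (l ^ CARD('n))" by (intro mult_left_mono le) simp
  also have "\<dots> = ennreal (c' powr q * l ^ CARD('n))" using l by (simp add: ennreal_mult)
  also have "\<dots> \<le> ennreal (c powr q * l ^ CARD('n))"
    using c' q l by (intro ennreal_leI mult_right_mono powr_mono2) auto
  finally show ?thesis .
qed

lemma power_mass_le_if_maximal_le:
  fixes v :: "real ^ 'n \<Rightarrow> real"
  assumes v: "AE x in lebesgue. 0 < v x" "v \<in> borel_measurable lebesgue" and \<eta>: "\<And>t. 0 \<le> t \<Longrightarrow> t powr q \<le> \<eta> t" and q: "0 < q"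
    and l: "0 < l" and x: "x \<in> cbox a (\<chi> i. a $ i + l)" and le: "maximal \<eta> v x \<le> ennreal c" and c: "0 \<le> c"
    and m: "mass (\<lambda>x. v x powr q) (cbox a (\<chi> i. a $ i + l)) = ennreal m" "0 < m"
  shows "m \<le> c powr q * l ^ CARD('n)" "0 < c"
proof -
  have V: "0 < l ^ CARD('n)" using l by simp
  have "(m / l ^ CARD('n)) powr (1 / q) \<le> c"
  proof (rule dense_ge)
    fix c' assume c': "c < c'"
    then have "maximal \<eta> v x < ennreal c'" using le c by (auto intro: le_less_trans simp: ennreal_less_iff)
    from power_mass_le_if_maximal_less[OF v \<eta> q l x this]
    have "m \<le> c' powr q * l ^ CARD('n)" using m l by (simp add: ennreal_le_iff)
    then have "(m / l ^ CARD('n)) powr (1 / q) \<le> (c' powr q) powr (1 / q)"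
      using m V q by (intro powr_mono2) (auto simp: field_simps)
    then show "(m / l ^ CARD('n)) powr (1 / q) \<le> c'" using q c c' by (simp add: powr_powr)
  qed
  moreover have "0 < (m / l ^ CARD('n)) powr (1 / q)" using m V l by simp
  ultimately show "0 < c" by linarith
  have "((m / l ^ CARD('n)) powr (1 / q)) powr q \<le> c powr q"
    using \<open>(m / l ^ CARD('n)) powr (1 / q) \<le> c\<close> q by (intro powr_mono2) auto
  then have "m / l ^ CARD('n) \<le> c powr q" using q m V l by (simp add: powr_powr)
  then show "m \<le> c powr q * l ^ CARD('n)" using V by (simp add: field_simps)
qed

text \<open>
  If the \<open>\<theta>\<close>-average of \<open>f/c\<close> were at most one for \<open>c = b\<bar>Q\<bar>\<^sup>-\<^sup>\<gamma>\<^sup>/\<^sup>n\<close>, then \<open>c\<close> would be admissible for the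
  Luxemburg average.
\<close>

lemma fractional_maximal_gtD:
  fixes x :: "real ^ 'n"
  assumes less: "ennreal b < fractional_maximal \<gamma> \<theta> f x" and b: "0 < b"
  obtains a l where "0 < l" "x \<in> cbox a (\<chi> i. a $ i + l)"
    "ennreal (l ^ CARD('n)) < mass (\<lambda>y. \<theta> (\<bar>f y\<bar> / (b / (l ^ CARD('n)) powr (\<gamma> / real CARD('n))))) (cbox a (\<chi> i. a $ i + l))"
proof -
  from less obtain Q where Q: "cube Q" "x \<in> Q"
    "ennreal b < ennreal (measure lebesgue Q powr (\<gamma> / real CARD('n))) * luxemburg \<theta> Q f"
    unfolding fractional_maximal_def less_SUP_iff by blast
  from Q(1) obtain a l where l: "0 < l" and Q_eq: "Q = cbox a (\<chi> i. a $ i + l)" by (auto simp: cube_def)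
  define s where "s = (l ^ CARD('n)) powr (\<gamma> / real CARD('n))"
  have s: "0 < s" using l by (simp add: s_def)
  have "measure lebesgue Q = l ^ CARD('n)" unfolding Q_eq measure_def using l by (simp add: emeasure_cube)
  then have less': "ennreal b < ennreal s * luxemburg \<theta> Q f" using Q(3) by (simp add: s_def)
  have "\<not> average Q (\<lambda>y. \<theta> (\<bar>f y\<bar> / (b / s))) \<le> 1"
  proof
    assume "average Q (\<lambda>y. \<theta> (\<bar>f y\<bar> / (b / s))) \<le> 1"
    then have "luxemburg \<theta> Q f \<le> ennreal (b / s)" using b s by (intro luxemburg_le) auto
    then have "ennreal s * luxemburg \<theta> Q f \<le> ennreal s * ennreal (b / s)" by (intro mult_left_mono) auto
    also have "\<dots> = ennreal b" using b s by (simp add: ennreal_mult[symmetric])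
    finally show False using less' by simp
  qed
  then have "ennreal (l ^ CARD('n)) < mass (\<lambda>y. \<theta> (\<bar>f y\<bar> / (b / s))) Q"
    unfolding Q_eq using average_le_1_iff[OF l] not_le by metis
  then show ?thesis using that[OF l] Q(2) unfolding Q_eq s_def by blast
qed

theorem theorem4:
  fixes u v :: "real ^ 'n \<Rightarrow> real"
    and n r \<delta> \<gamma> q :: real
    and \<Phi> \<eta> \<phi> \<Psi> \<Phi>\<^sub>\<gamma> :: "real \<Rightarrow> real"
  defines "n \<equiv> real CARD('n)"
  defines "\<Phi> \<equiv> \<lambda>t. t powr r * (1 + log_plus t) powr \<delta>"
    and "\<eta> \<equiv> \<lambda>t. t powr q * (1 + log_plus t) powr (n * \<delta> / (n - r * \<gamma>))"
    and "\<phi> \<equiv> \<lambda>t. (t * (1 + log_plus t) powr \<delta>) powr (q / r)"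
    and "\<Psi> \<equiv> \<lambda>t. t powr r * (1 + log_plus (t powr (1 - q / r))) powr (n * \<delta> / (n - r * \<gamma>))"
  defines "\<Phi>\<^sub>\<gamma> \<equiv> \<lambda>t. \<Phi> t * (1 + log_plus t) powr (\<delta> * r * \<gamma> / (n - r * \<gamma>))"
  assumes "1 \<le> r" and "0 \<le> \<delta>"
    and "0 < \<gamma>" and "\<gamma> < n / r"
    and "1 / q = 1 / r - \<gamma> / n"
    and "muckenhoupt_one u"
    and "weight v" and "muckenhoupt_infinity (\<lambda>x. v x powr q)"
  shows "\<exists>C>0. \<forall>f \<in> borel_measurable lebesgue. (\<lambda>x. f x * v x) \<in> orlicz_loc \<Phi> \<longrightarrow>
           (\<forall>t>0. mass (\<lambda>x. u x * v x powr q)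
                    {x. fractional_maximal \<gamma> \<Phi> (\<lambda>y. f y * v y) x / maximal \<eta> v x > ennreal t}
                  \<le> ennreal C * extend_infinity \<phi>
                      (\<integral>\<^sup>+x. ennreal (\<Phi>\<^sub>\<gamma> (\<bar>f x\<bar> / t) * \<Psi> (u x powr (1 / q) * v x)) \<partial>lebesgue))"
proof -
  define p where "p = q / r"
  have r: "0 < r" "1 \<le> r" and \<delta>: "0 \<le> \<delta>" using assms by auto
  have n: "0 < n" by (simp add: n_def)
  have n\<gamma>: "0 < n - r * \<gamma>" using assms(10) r by (simp add: field_simps)
  have "0 < 1 / r - \<gamma> / n" using n n\<gamma> r by (simp add: field_simps)
  then have q: "0 < q" using assms(11) by (metis zero_less_divide_1_iff)
  have inv_p: "1 / p = 1 - r * \<gamma> / n"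
  proof -
    have "1 / p = r * (1 / q)" by (simp add: p_def)
    also have "\<dots> = 1 - r * \<gamma> / n" unfolding assms(11) using r by (simp add: field_simps)
    finally show ?thesis .
  qed
  have p0: "0 < p" using q r by (simp add: p_def)
  have p_eq: "p = n / (n - r * \<gamma>)"
  proof -
    have "1 / p = (n - r * \<gamma>) / n" unfolding inv_p using n by (simp add: field_simps)
    then show ?thesis using p0 n n\<gamma> by (simp add: field_simps)
  qed
  have p: "1 < p" using n\<gamma> assms(9) r unfolding p_eq by (simp add: less_divide_eq)
  \<comment> \<open>In terms of \<open>p\<close>, \<open>\<eta> = \<Phi>\<^sup>p\<close> and \<open>\<Phi>\<^sub>\<gamma>\<close> carries the logarithm to the power \<open>\<delta>p\<close>.\<close>
  have exp1: "n * \<delta> / (n - r * \<gamma>) = \<delta> * p" unfolding p_eq by simp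
  have exp2: "\<delta> * r * \<gamma> / (n - r * \<gamma>) = \<delta> * (p - 1)"
    unfolding p_eq using n\<gamma> by (simp add: field_simps)
  have \<eta>: "t powr q \<le> \<eta> t" for t
  proof -
    have "1 \<le> logf t powr (\<delta> * p)" using logf_ge_1 \<delta> p0 by (intro ge_one_powr_ge_zero) auto
    then have "t powr q * 1 \<le> t powr q * logf t powr (\<delta> * p)" by (intro mult_left_mono) auto
    then show ?thesis unfolding \<eta>_def exp1 logf_def by simp
  qed

  define u' where "u' = positive_version u"
  define w where "w = positive_version (\<lambda>x. v x powr q)"
  have wt: "weight u" "weight (\<lambda>x. v x powr q)"
    using assms(12,14) by (auto simp: muckenhoupt_one_def muckenhoupt_infinity_def muckenhoupt_def)
  note U = weightD[OF wt(1), folded u'_def] and W = weightD[OF wt(2), folded w_def]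
  note [measurable] = U(1) W(1)
  have v_pos: "AE x in lebesgue. 0 < v x" and v_meas[measurable]: "v \<in> borel_measurable lebesgue"
    using \<open>weight v\<close> by (auto simp: weight_def locally_integrable_measurable)
  obtain K0 where K0: "0 < K0" "\<And>a l. 0 < l \<Longrightarrow> AE x in lebesgue. x \<in> hcube a l \<longrightarrow>
       wmass (positive_version u) a l / l ^ CARD('n) \<le> K0 * positive_version u x"
    by (rule muckenhoupt_one_bound[OF assms(12)]) (rule that)
  interpret mixed_weights u' w "sqrt K0" p
  proof
    show "A_inf u'" unfolding u'_def by (rule A_inf_if_muckenhoupt_one[OF assms(12)])
    show "A_inf w" unfolding w_def by (rule A_inf_if_muckenhoupt_infinity[OF assms(14)])
    show "AE x in lebesgue. x \<in> hcube a l \<longrightarrow> wmass u' a l / l ^ CARD('n) \<le> (sqrt K0)\<^sup>2 * u' x"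
      if "0 < l" for a l using K0(2)[OF that, of a] K0(1) by (simp add: u'_def)
  qed (use K0 p in auto)
  \<comment> \<open>The grid cube containing a given cube has at most four times its side.\<close>
  have c0: "0 < 1 / (4::real) ^ CARD('n)" by simp
  obtain C where C: "0 < C" and main:
    "\<And>F H E. F \<in> borel_measurable lebesgue \<Longrightarrow> \<forall>x. 0 \<le> F x \<Longrightarrow> 0 < H \<Longrightarrow>
      (\<integral>\<^sup>+x. ennreal (source \<delta> F x) \<partial>lebesgue) \<le> ennreal H \<Longrightarrow>
      AE x in lebesgue. x \<in> E \<longrightarrow> concentrated \<delta> (1 / 4 ^ CARD('n)) F x \<Longrightarrow>
      (\<integral>\<^sup>+x\<in>E. ennreal (u' x * w x) \<partial>lebesgue) \<le> ennreal (C * (H * logf H powr \<delta>) powr p)"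
    by (rule level_set_mass_bound[OF \<delta> c0]) (rule that)
  define N where "N = max 1 (q / (p - 1))"
  define M where "M = r powr \<delta> * N powr \<delta>"
  have M: "1 \<le> M"
  proof -
    have "1 \<le> r powr \<delta>" "1 \<le> N powr \<delta>" using r \<delta> by (auto simp: N_def intro!: ge_one_powr_ge_zero)
    then show ?thesis unfolding M_def using mult_mono[of 1 "r powr \<delta>" 1 "N powr \<delta>"] by simp
  qed
  define C' where "C' = C * (M * logf M powr \<delta>) powr p"
  have C': "0 < C'"
  proof -
    have "0 < logf M powr \<delta>" using logf_pos[of M] by (simp del: logf_pos)
    then show ?thesis using C M by (auto simp: C'_def)
  qed
  show ?thesis
  proof (intro exI[of _ C'] conjI C' ballI impI allI)
    fix f :: "real ^ 'n \<Rightarrow> real" and t :: real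
    assume f[measurable]: "f \<in> borel_measurable lebesgue" and t: "0 < t"
    define E where "E = {x. fractional_maximal \<gamma> \<Phi> (\<lambda>y. f y * v y) x / maximal \<eta> v x > ennreal t}"
    define F where "F = (\<lambda>x. (\<bar>f x\<bar> / t) powr r)"
    have F: "F \<in> borel_measurable lebesgue" "\<forall>x. 0 \<le> F x" unfolding F_def by auto
    define I where "I = (\<integral>\<^sup>+x. ennreal (\<Phi>\<^sub>\<gamma> (\<bar>f x\<bar> / t) * \<Psi> (u x powr (1 / q) * v x)) \<partial>lebesgue)"
    have mass_eq: "mass (\<lambda>x. u x * v x powr q) E = (\<integral>\<^sup>+x\<in>E. ennreal (u' x * w x) \<partial>lebesgue)"
      unfolding mass_def
    proof (rule nn_integral_cong_AE)
      show "AE x in lebesgue. ennreal (u x * v x powr q) * indicator E x = ennreal (u' x * w x) * indicator E x"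
        using U(3) W(3) by eventually_elim simp
    qed

    have source_le: "AE x in lebesgue. source \<delta> F x \<le> M * (\<Phi>\<^sub>\<gamma> (\<bar>f x\<bar> / t) * \<Psi> (u x powr (1 / q) * v x))"
      using U(3) W(3) v_pos
    proof eventually_elim
      case (elim x)
      define g where "g = \<bar>f x\<bar> / t"
      define s where "s = u x powr (1 / q) * v x"
      have g: "0 \<le> g" using t by (simp add: g_def)
      have ux: "0 < u x" using U(2)[of x] elim by simp
      have s: "0 < s" using ux elim by (simp add: s_def)
      have sq: "s powr q = u' x * w x" using ux elim q by (simp add: s_def powr_mult powr_powr)
      have sr: "(u' x * w x) powr (1 / p) = s powr r"
        unfolding sq[symmetric] using q r by (simp add: p_def powr_powr)
      have "logf (F x) \<le> r * logf g"
        using logf_powr[of g r] g r by (simp add: F_def g_def max_def)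
      then have "logf (F x) powr \<delta> \<le> r powr \<delta> * logf g powr \<delta>"
        using \<delta> by (simp add: powr_mono2 flip: powr_mult)
      moreover have "logf (1 / (u' x * w x)) powr \<delta> \<le> N powr \<delta> * logf (s powr (1 - p)) powr (\<delta> * p)"
      proof -
        have "1 / (u' x * w x) = (s powr (1 - p)) powr (q / (p - 1))"
        proof -
          have "(1 - p) * (q / (p - 1)) = - q" using p by (simp add: field_simps)
          then show ?thesis unfolding sq[symmetric] powr_powr by (simp add: powr_minus_divide)
        qed
        then have "logf (1 / (u' x * w x)) \<le> N * logf (s powr (1 - p))"
          unfolding N_def using logf_powr[of "s powr (1 - p)" "q / (p - 1)"] q p by simp
        then have "logf (1 / (u' x * w x)) powr \<delta> \<le> (N * logf (s powr (1 - p))) powr \<delta>"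
          using \<delta> by (intro powr_mono2) auto
        also have "\<dots> = N powr \<delta> * logf (s powr (1 - p)) powr \<delta>" by (rule powr_mult)
        also have "\<dots> \<le> N powr \<delta> * logf (s powr (1 - p)) powr (\<delta> * p)"
          using logf_ge_1 \<delta> p by (intro mult_left_mono powr_mono) (auto simp: mult_le_cancel_left1)
        finally show ?thesis .
      qed
      ultimately have "logf (F x) powr \<delta> * logf (1 / (u' x * w x)) powr \<delta> \<le>
          (r powr \<delta> * logf g powr \<delta>) * (N powr \<delta> * logf (s powr (1 - p)) powr (\<delta> * p))"
        by (intro mult_mono) auto
      also have "\<dots> = M * (logf g powr \<delta> * 1 * logf (s powr (1 - p)) powr (\<delta> * p))"
        by (simp add: M_def ac_simps)
      also have "\<dots> \<le> M * (logf g powr \<delta> * logf g powr (\<delta> * (p - 1)) * logf (s powr (1 - p)) powr (\<delta> * p))"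
        using M logf_ge_1[of g] \<delta> p
        by (intro mult_left_mono mult_right_mono ge_one_powr_ge_zero) auto
      finally have le: "logf (F x) powr \<delta> * logf (1 / (u' x * w x)) powr \<delta> \<le>
          M * (logf g powr \<delta> * logf g powr (\<delta> * (p - 1)) * logf (s powr (1 - p)) powr (\<delta> * p))" .
      have "source \<delta> F x = g powr r * s powr r * (logf (F x) powr \<delta> * logf (1 / (u' x * w x)) powr \<delta>)"
        unfolding source_def sr by (simp add: F_def g_def)
      also have "\<dots> \<le> g powr r * s powr r * (M * (logf g powr \<delta> * logf g powr (\<delta> * (p - 1)) * logf (s powr (1 - p)) powr (\<delta> * p)))"
        by (intro mult_left_mono le) auto
      also have "\<dots> = M * (\<Phi>\<^sub>\<gamma> g * \<Psi> s)"
        unfolding \<Phi>\<^sub>\<gamma>_def \<Phi>_def \<Psi>_def exp1 exp2 p_def[symmetric] logf_def by (simp add: ac_simps)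
      finally show ?case by (simp add: g_def s_def)
    qed

    have nonneg: "0 \<le> \<Phi>\<^sub>\<gamma> (\<bar>f x\<bar> / t) * \<Psi> (u x powr (1 / q) * v x)" for x
      by (simp add: \<Phi>\<^sub>\<gamma>_def \<Phi>_def \<Psi>_def)
    have "(\<integral>\<^sup>+x. ennreal (source \<delta> F x) \<partial>lebesgue) \<le>
        (\<integral>\<^sup>+x. ennreal M * ennreal (\<Phi>\<^sub>\<gamma> (\<bar>f x\<bar> / t) * \<Psi> (u x powr (1 / q) * v x)) \<partial>lebesgue)"
    proof (rule nn_integral_mono_AE)
      show "AE x in lebesgue. ennreal (source \<delta> F x) \<le> ennreal M * ennreal (\<Phi>\<^sub>\<gamma> (\<bar>f x\<bar> / t) * \<Psi> (u x powr (1 / q) * v x))"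
        using source_le
      proof eventually_elim
        case (elim x)
        then show ?case using M nonneg[of x] by (subst ennreal_mult[symmetric]) (auto intro: ennreal_leI)
      qed
    qed
    also have "\<dots> = ennreal M * I"
      unfolding I_def
    proof (rule nn_integral_cmult)
      have [measurable]: "u \<in> borel_measurable lebesgue"
        using wt(1) by (auto simp: weight_def locally_integrable_measurable)
      show "(\<lambda>x. ennreal (\<Phi>\<^sub>\<gamma> (\<bar>f x\<bar> / t) * \<Psi> (u x powr (1 / q) * v x))) \<in> borel_measurable lebesgue"
        unfolding \<Phi>\<^sub>\<gamma>_def \<Phi>_def \<Psi>_def log_plus_def by measurable
    qed
    finally have source_I: "(\<integral>\<^sup>+x. ennreal (source \<delta> F x) \<partial>lebesgue) \<le> ennreal M * I" .

    have E_cubes: "AE x in lebesgue. x \<in> E \<longrightarrow> concentrated \<delta> (1 / 4 ^ CARD('n)) F x"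
      using AE_cube_average_exceeds[OF W(1)]
    proof eventually_elim
      case (elim x)
      show ?case
      proof
        assume "x \<in> E"
        then have gt: "ennreal t < fractional_maximal \<gamma> \<Phi> (\<lambda>y. f y * v y) x / maximal \<eta> v x" by (simp add: E_def)
        have "maximal \<eta> v x \<noteq> \<infinity>"
        proof
          assume "maximal \<eta> v x = \<infinity>"
          then show False using gt by simp
        qed
        then obtain c where c: "maximal \<eta> v x = ennreal c" "0 \<le> c" by (cases "maximal \<eta> v x") auto
        have avg: "wmass w a l \<le> c powr q * l ^ CARD('n) \<and> 0 < c" if l: "0 < l" and x: "x \<in> hcube a l" for a l
        proof -
          have m: "mass (\<lambda>x. v x powr q) (cbox a (\<chi> i. a $ i + l)) = ennreal (wmass w a l)" "0 < wmass w a l"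
            using W(5)[of a l] A_inf_wmass[OF w l, of a] by auto
          have "x \<in> cbox a (\<chi> i. a $ i + l)" using x hcube_sandwich(2) by blast
          from power_mass_le_if_maximal_le[OF v_pos v_meas \<eta> q l this _ c(2) m] c(1) show ?thesis by simp
        qed
        have "x \<in> hcube x 1" by (simp add: hcube_def)
        then have c_pos: "0 < c" using avg[of 1 x] by simp
        define L where "L = c powr q"
        have L: "0 < L" using c_pos by (simp add: L_def)
        have "w x \<le> L"
        proof (rule ccontr)
          assume "\<not> w x \<le> L"
          then obtain a l where al: "0 < l" "x \<in> hcube a l"
            "ennreal L * emeasure lebesgue (hcube a l) < emeasure (weighted w) (hcube a l)"
            using elim less_imp_le[OF L] unfolding not_le by blast
          then have "L * l ^ CARD('n) < wmass w a l"
            using L A_inf_wmass[OF w al(1), of a] by (simp add: emeasure_hcube ennreal_mult[symmetric] ennreal_less_iff)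
          then show False using avg[OF al(1,2)] by (simp add: L_def)
        qed
        have "ennreal (t * c) < fractional_maximal \<gamma> \<Phi> (\<lambda>y. f y * v y) x"
        proof (rule ccontr)
          assume "\<not> ennreal (t * c) < fractional_maximal \<gamma> \<Phi> (\<lambda>y. f y * v y) x"
          then have "fractional_maximal \<gamma> \<Phi> (\<lambda>y. f y * v y) x / ennreal c \<le> ennreal (t * c) / ennreal c"
            by (intro divide_right_mono_ennreal) simp
          also have "\<dots> = ennreal t" using t c_pos by (simp add: divide_ennreal)
          finally show False using gt c(1) by simp
        qed
        then obtain a l where l: "0 < l" and xQ: "x \<in> cbox a (\<chi> i. a $ i + l)" and big:
          "ennreal (l ^ CARD('n)) < mass (\<lambda>y. \<Phi> (\<bar>f y * v y\<bar> / (t * c / (l ^ CARD('n)) powr (\<gamma> / real CARD('n))))) (cbox a (\<chi> i. a $ i + l))"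
          using t c_pos by (elim fractional_maximal_gtD) auto
        obtain k z where kz: "cbox a (\<chi> i. a $ i + l) \<subseteq> grid_cube k z" "l \<le> grid_side k" "grid_side k \<le> 4 * l"
          by (rule cube_subset_grid_cube[OF l])
        have xg: "x \<in> grid_cube k z" using xQ kz by blast
        define V where "V = grid_side k ^ CARD('n)"
        define G where "G = (\<lambda>x. F x * (w x / L) powr (1 / p) * V powr (1 - 1 / p))"
        have V: "0 < V" by (simp add: V_def)
        have lV: "l ^ CARD('n) \<le> V" unfolding V_def using kz l by (intro power_mono) auto
        have "1 / 4 ^ CARD('n) * V \<le> 1 / 4 ^ CARD('n) * (4 * l) ^ CARD('n)"
          unfolding V_def using kz by (intro mult_left_mono power_mono) auto
        also have "\<dots> = l ^ CARD('n)" by (simp add: power_mult_distrib)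
        finally have "ennreal (1 / 4 ^ CARD('n) * V) \<le> ennreal (l ^ CARD('n))" by (rule ennreal_leI)
        also have "\<dots> < mass (\<lambda>y. \<Phi> (\<bar>f y * v y\<bar> / (t * c / (l ^ CARD('n)) powr (\<gamma> / real CARD('n))))) (cbox a (\<chi> i. a $ i + l))"
          by (rule big)
        also have "\<dots> \<le> (\<integral>\<^sup>+y\<in>grid_cube k z. ennreal (G y * logf (G y) powr \<delta>) \<partial>lebesgue)"
          unfolding mass_def
        proof (rule nn_integral_mono_AE)
          show "AE y in lebesgue. ennreal (\<Phi> (\<bar>f y * v y\<bar> / (t * c / (l ^ CARD('n)) powr (\<gamma> / real CARD('n))))) *
              indicator (cbox a (\<chi> i. a $ i + l)) y \<le> ennreal (G y * logf (G y) powr \<delta>) * indicator (grid_cube k z) y"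
            using W(3) v_pos
          proof eventually_elim
            case (elim y)
            define T where "T = \<bar>f y * v y\<bar> / (t * c / (l ^ CARD('n)) powr (\<gamma> / real CARD('n)))"
            have T0: "0 \<le> T" using t c_pos by (simp add: T_def)
            have T_eq: "T = \<bar>f y\<bar> / t * (v y / c) * (l ^ CARD('n)) powr (\<gamma> / n)"
              using elim by (simp add: T_def n_def abs_mult)
            have "T powr r = F y * (v y / c) powr r * (l ^ CARD('n)) powr (\<gamma> / n * r)"
              unfolding T_eq powr_mult powr_powr F_def ..
            also have "(v y / c) powr r = (w y / L) powr (1 / p)"
              using elim q r c_pos by (simp add: L_def p_def powr_powr flip: powr_divide)
            also have "\<gamma> / n * r = 1 - 1 / p" unfolding inv_p by simp
            also have "F y * (w y / L) powr (1 / p) * (l ^ CARD('n)) powr (1 - 1 / p) \<le> G y"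
              unfolding G_def using lV l p F(2) by (intro mult_left_mono powr_mono2) auto
            finally have Tr: "T powr r \<le> G y" .
            \<comment> \<open>Since \<open>r \<ge> 1\<close>, passing to the power \<open>r\<close> does not decrease numbers above \<open>1\<close>, where the logarithm lives.\<close>
            have "T \<le> G y \<or> T \<le> 1"
            proof (cases "T \<le> 1")
              case False
              then have "T powr 1 \<le> T powr r" using r by (intro powr_mono) auto
              then show ?thesis using Tr T0 by simp
            qed simp
            then have "logf T \<le> logf (G y)" using T0 logf_mono[of T "G y"] logf_le_1[of T] logf_ge_1[of "G y"] by auto
            then have "T powr r * logf T powr \<delta> \<le> G y * logf (G y) powr \<delta>"
              using Tr \<delta> order_trans[OF _ Tr, of 0] by (intro mult_mono powr_mono2) auto
            then have le: "\<Phi> T \<le> G y * logf (G y) powr \<delta>" by (simp add: \<Phi>_def logf_def)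
            have ind: "indicator (cbox a (\<chi> i. a $ i + l)) y \<le> (indicator (grid_cube k z) y :: ennreal)"
              using kz(1) by (auto simp: indicator_def)
            show ?case unfolding T_def[symmetric] by (intro mult_mono ennreal_leI le ind) auto
          qed
        qed
        finally have "ennreal (1 / 4 ^ CARD('n) * V) < (\<integral>\<^sup>+y\<in>grid_cube k z. ennreal (G y * logf (G y) powr \<delta>) \<partial>lebesgue)" .
        moreover have "wmass w (grid_corner k z) (grid_side k) \<le> L * V"
          using avg[OF _ xg] by (simp add: L_def V_def)
        ultimately show "concentrated \<delta> (1 / 4 ^ CARD('n)) F x"
          using xg L \<open>w x \<le> L\<close>
          unfolding concentrated_def orlicz_large_def rescaled_def G_def V_def by blast
      qed
    qed

    have bound: "mass (\<lambda>x. u x * v x powr q) E \<le> ennreal (C * (H * logf H powr \<delta>) powr p)"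
      if "0 < H" "ennreal M * I \<le> ennreal H" for H
      unfolding mass_eq using that source_I by (intro main[OF F] E_cubes) auto
    have "mass (\<lambda>x. u x * v x powr q) E \<le> ennreal C' * extend_infinity \<phi> I"
    proof (cases I)
      case top
      then show ?thesis using C' by (simp add: extend_infinity_def ennreal_mult_top)
    next
      case (real i)
      show ?thesis
      proof (cases "i = 0")
        case True
        \<comment> \<open>If the right-hand side vanishes, the bound for arbitrarily small \<open>H > 0\<close> shows that \<open>E\<close> has mass zero.\<close>
        have "mass (\<lambda>x. u x * v x powr q) E \<le> 0"
        proof (rule ennreal_le_epsilon)
          fix e :: real assume e: "0 < e"
          define H where "H = min 1 ((e / C) powr (1 / p))"
          have H: "0 < H" "H \<le> 1" using e C by (auto simp: H_def)
          have "mass (\<lambda>x. u x * v x powr q) E \<le> ennreal (C * (H * logf H powr \<delta>) powr p)"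
            using H real True by (intro bound) auto
          also have "\<dots> \<le> ennreal e"
          proof (rule ennreal_leI)
            have "H powr p \<le> ((e / C) powr (1 / p)) powr p" using H p0 by (intro powr_mono2) (auto simp: H_def)
            also have "\<dots> = e / C" using e C p0 by (simp add: powr_powr)
            finally show "C * (H * logf H powr \<delta>) powr p \<le> e" using H C by (simp add: logf_le_1 field_simps)
          qed
          finally show "mass (\<lambda>x. u x * v x powr q) E \<le> 0 + ennreal e" by simp
        qed
        then show ?thesis by simp
      next
        case False
        then have i: "0 < i" using real by simp
        have "mass (\<lambda>x. u x * v x powr q) E \<le> ennreal (C * (M * i * logf (M * i) powr \<delta>) powr p)"
          using i M real by (intro bound) (auto simp: ennreal_mult)
        also have "\<dots> \<le> ennreal (C' * \<phi> i)"
        proof (rule ennreal_leI)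
          have "logf (M * i) powr \<delta> \<le> (logf M * logf i) powr \<delta>"
            using M i \<delta> by (intro powr_mono2 logf_mult) auto
          also have "\<dots> = logf M powr \<delta> * logf i powr \<delta>" by (rule powr_mult)
          finally have "M * i * logf (M * i) powr \<delta> \<le> M * i * (logf M powr \<delta> * logf i powr \<delta>)"
            using M i by (intro mult_left_mono) auto
          also have "\<dots> = (M * logf M powr \<delta>) * (i * logf i powr \<delta>)" by (simp only: ac_simps)
          finally have "(M * i * logf (M * i) powr \<delta>) powr p \<le> ((M * logf M powr \<delta>) * (i * logf i powr \<delta>)) powr p"
            using M i p0 by (intro powr_mono2) auto
          also have "\<dots> = (M * logf M powr \<delta>) powr p * \<phi> i"
            unfolding \<phi>_def p_def[symmetric] logf_def[symmetric] by (rule powr_mult)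
          finally show "C * (M * i * logf (M * i) powr \<delta>) powr p \<le> C' * \<phi> i"
            using C unfolding C'_def by simp
        qed
        also have "\<dots> = ennreal C' * extend_infinity \<phi> I"
          using C' real by (simp add: extend_infinity_def ennreal_mult \<phi>_def)
        finally show ?thesis .
      qed
    qed
    then show "mass (\<lambda>x. u x * v x powr q)
                    {x. fractional_maximal \<gamma> \<Phi> (\<lambda>y. f y * v y) x / maximal \<eta> v x > ennreal t}
                  \<le> ennreal C' * extend_infinity \<phi>
                      (\<integral>\<^sup>+x. ennreal (\<Phi>\<^sub>\<gamma> (\<bar>f x\<bar> / t) * \<Psi> (u x powr (1 / q) * v x)) \<partial>lebesgue)"
      unfolding E_def I_def .
  qed
qed

end
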